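(* Let $i\in\mathbb S^2$. Then $\mathfrak B_{1,i}$ is a Banach space with the norm $$\|f\|_{\mathfrak B_{1,i}}=\inf\left\{\sum_{k=0}^\infty|\gamma_k|\ \Big|\ \exists (a_k)_{k\ge1}\subset\mathbb B_i:\ f=\gamma_0+\sum_{k=1}^\infty T_{a_k}\gamma_k\right\},$$ where $(\gamma_k)_{k\ge 0}\subset\mathbb H$. Furthermore, for all $f\in\mathfrak B_{1,i}$ and all $a\in\mathbb B_i$, $$\|f\circ_iT_a\|_{\mathfrak B_{1,i}}=\|f\|_{\mathfrak B_{1,i}}.$$
   Context: $\mathbb H$ denotes the quaternions with real part coordinate $x_0$, $\mathbb S^2$ the sphere of purely imaginary unit quaternions, $\mathbb C(i)=\{x+iy:x,y\in\mathbb R\}$ for $i\in\mathbb S^2$, $\mathbb B$ the open unit ball of $\mathbb H$, $\mathbb B_i=\mathbb B\cap\mathbb C(i)$. A real differentiable function $f:\mathbb B\to\mathbb H$ is (left) slice regular if for every $i\in\mathbb S^2$, $\left(\frac{\partial}{\partial x}+i\frac{\partial}{\partial y}\right)f(x+iy)=0$ on $\mathbb B_i$; $\mathcal{SR}(\mathbb B)$ is the set of these functions. $dA_i=\frac1\pi dx\,dy$ on $\mathbb B_i$ and $d\lambda_i(z)=\frac{dA_i(z)}{(1-|z|^2)^2}$. $\mathfrak B_{1,i}$ is the quaternionic right linear space of $f\in\mathcal{SR}(\mathbb B)$ such that $\int_{\mathbb B_i}(1-|z|^2)^n|\partial_{x_0}^nf(z)|\,d\lambda_i(z)<\infty$ for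 some $n\in\mathbb N$ with $n>1$ (this does not depend on the choice of $n$). Every $f\in\mathfrak B_{1,i}$ admits a representation $f=\gamma_0+\sum_{k\ge1}T_{a_k}\gamma_k$ with $a_k\in\mathbb B_i$ and $(\gamma_k)_{k\ge0}\in\ell^1(\mathbb H)$. $Q_i[f]=f|_{\mathbb B_i}$. For $j\in\mathbb S^2$ orthogonal to $i$, every $f\in\mathcal{SR}(\mathbb B)$ satisfies $Q_i[f]=f_1+f_2j$ with $f_1,f_2:\mathbb B_i\to\mathbb C(i)$ holomorphic. For $g=g_1+g_2j$ with $g_1,g_2$ holomorphic $\mathbb B_i\to\mathbb C(i)$, $P_i[g]\in\mathcal{SR}(\mathbb B)$ is the slice regular extension $P_i[g](x+I_qy)=\frac12[(1+I_qi)g(x-yi)+(1-I_qi)g(x+yi)]$. $T_a(q)=(1-q\bar a)^{-\ast}\ast(a-q)$, where $\ast$ is the slice regular product (for power series, $(\sum q^na_n)\ast(\sum q^nb_n)=\sum_nq^n\sum_ka_kb_{n-k}$) and $(1-q\bar a)^{-\ast}=\sum_{n\ge0}q^n\bar a^n$; for $a\in\mathbb B_i$, on $\mathbb B_i$ it equals $\frac{a-z}{1-\bar az}$. The composition is $f\circ_iT_a:=P_i[f_1\circ Q_i[T_a]]+P_i[f_2\circ Q_i[T_a]]\,j$. *)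

theory Defs
  imports "HOL-Analysis.Analysis"
begin

section \<open>Quaternions\<close>

codatatype quat = Quat (qRe: real) (qIm1: real) (qIm2: real) (qIm3: real)

lemma quat_eqI [intro?]:
  "qRe x = qRe y \<Longrightarrow> qIm1 x = qIm1 y \<Longrightarrow> qIm2 x = qIm2 y \<Longrightarrow> qIm3 x = qIm3 y \<Longrightarrow> x = y"
  by (rule quat.expand) simp

lemma quat_eq_iff:
  "x = y \<longleftrightarrow> qRe x = qRe y \<and> qIm1 x = qIm1 y \<and> qIm2 x = qIm2 y \<and> qIm3 x = qIm3 y"
  by (auto intro: quat.expand)

instantiation quat :: real_vector
begin

primcorec zero_quat :: quat where
  "qRe 0 = 0" | "qIm1 0 = 0" | "qIm2 0 = 0" | "qIm3 0 = 0"

primcorec plus_quat :: "quat \<Rightarrow> quat \<Rightarrow> quat" where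
  "qRe (x + y) = qRe x + qRe y"
| "qIm1 (x + y) = qIm1 x + qIm1 y"
| "qIm2 (x + y) = qIm2 x + qIm2 y"
| "qIm3 (x + y) = qIm3 x + qIm3 y"

primcorec uminus_quat :: "quat \<Rightarrow> quat" where
  "qRe (- x) = - qRe x"
| "qIm1 (- x) = - qIm1 x"
| "qIm2 (- x) = - qIm2 x"
| "qIm3 (- x) = - qIm3 x"

primcorec minus_quat :: "quat \<Rightarrow> quat \<Rightarrow> quat" where
  "qRe (x - y) = qRe x - qRe y"
| "qIm1 (x - y) = qIm1 x - qIm1 y"
| "qIm2 (x - y) = qIm2 x - qIm2 y"
| "qIm3 (x - y) = qIm3 x - qIm3 y"

primcorec scaleR_quat :: "real \<Rightarrow> quat \<Rightarrow> quat" where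
  "qRe (scaleR r x) = r * qRe x"
| "qIm1 (scaleR r x) = r * qIm1 x"
| "qIm2 (scaleR r x) = r * qIm2 x"
| "qIm3 (scaleR r x) = r * qIm3 x"

instance
  by standard (simp_all add: quat_eq_iff algebra_simps)

end

instantiation quat :: real_algebra_1
begin

primcorec one_quat :: quat where
  "qRe 1 = 1" | "qIm1 1 = 0" | "qIm2 1 = 0" | "qIm3 1 = 0"

primcorec times_quat :: "quat \<Rightarrow> quat \<Rightarrow> quat" where
  "qRe (x * y) = qRe x * qRe y - qIm1 x * qIm1 y - qIm2 x * qIm2 y - qIm3 x * qIm3 y"
| "qIm1 (x * y) = qRe x * qIm1 y + qIm1 x * qRe y + qIm2 x * qIm3 y - qIm3 x * qIm2 y"
| "qIm2 (x * y) = qRe x * qIm2 y - qIm1 x * qIm3 y + qIm2 x * qRe y + qIm3 x * qIm1 y"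
| "qIm3 (x * y) = qRe x * qIm3 y + qIm1 x * qIm2 y - qIm2 x * qIm1 y + qIm3 x * qRe y"

instance
  by standard (simp_all add: quat_eq_iff algebra_simps)

end

primcorec qcnj :: "quat \<Rightarrow> quat" where
  "qRe (qcnj x) = qRe x"
| "qIm1 (qcnj x) = - qIm1 x"
| "qIm2 (qcnj x) = - qIm2 x"
| "qIm3 (qcnj x) = - qIm3 x"

instantiation quat :: real_inner
begin

definition inner_quat :: "quat \<Rightarrow> quat \<Rightarrow> real" where
  "inner_quat x y = qRe x * qRe y + qIm1 x * qIm1 y + qIm2 x * qIm2 y + qIm3 x * qIm3 y"

definition norm_quat :: "quat \<Rightarrow> real" where
  "norm_quat x = sqrt (inner x x)"

definition sgn_quat :: "quat \<Rightarrow> quat" where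
  "sgn_quat x = x /\<^sub>R norm x"

definition dist_quat :: "quat \<Rightarrow> quat \<Rightarrow> real" where
  "dist_quat x y = norm (x - y)"

definition uniformity_quat :: "(quat \<times> quat) filter" where
  "uniformity_quat = (INF e\<in>{0<..}. principal {(x, y). dist x y < e})"

definition open_quat :: "quat set \<Rightarrow> bool" where
  "open_quat U \<longleftrightarrow> (\<forall>x\<in>U. eventually (\<lambda>(x', y). x' = x \<longrightarrow> y \<in> U) uniformity)"

instance
proof
  fix x y z :: quat and r :: real
  show "inner x y = inner y x"
    by (simp add: inner_quat_def mult.commute)
  show "inner (x + y) z = inner x z + inner y z"
    by (simp add: inner_quat_def algebra_simps)
  show "inner (scaleR r x) y = r * inner x y"
    by (simp add: inner_quat_def algebra_simps)
  show "0 \<le> inner x x"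
    by (simp add: inner_quat_def)
  show "inner x x = 0 \<longleftrightarrow> x = 0"
    by (auto simp: inner_quat_def quat_eq_iff add_nonneg_eq_0_iff)
  show "norm x = sqrt (inner x x)"
    by (rule norm_quat_def)
  show "sgn x = x /\<^sub>R norm x"
    by (rule sgn_quat_def)
  show "dist x y = norm (x - y)"
    by (rule dist_quat_def)
  show "(uniformity :: (quat \<times> quat) filter) = (INF e\<in>{0<..}. principal {(x, y). dist x y < e})"
    by (rule uniformity_quat_def)
next
  fix U :: "quat set"
  show "open U \<longleftrightarrow> (\<forall>x\<in>U. eventually (\<lambda>(x', y). x' = x \<longrightarrow> y \<in> U) uniformity)"
    by (rule open_quat_def)
qed

end

lemma quat_norm_eq_sqrt: "norm x = sqrt ((qRe x)\<^sup>2 + (qIm1 x)\<^sup>2 + (qIm2 x)\<^sup>2 + (qIm3 x)\<^sup>2)"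
  by (simp add: norm_quat_def inner_quat_def power2_eq_square)

instantiation quat :: real_normed_div_algebra
begin

definition inverse_quat :: "quat \<Rightarrow> quat" where
  "inverse_quat x = qcnj x /\<^sub>R (norm x)\<^sup>2"

definition divide_quat :: "quat \<Rightarrow> quat \<Rightarrow> quat" where
  "divide_quat x y = x * inverse y"

instance
proof
  fix x y :: quat
  have nn: "(norm x)\<^sup>2 = (qRe x)\<^sup>2 + (qIm1 x)\<^sup>2 + (qIm2 x)\<^sup>2 + (qIm3 x)\<^sup>2" for x :: quat
    by (simp add: quat_norm_eq_sqrt)
  have xc: "x * qcnj x = of_real ((norm x)\<^sup>2)" "qcnj x * x = of_real ((norm x)\<^sup>2)"
    unfolding nn by (simp_all add: of_real_def quat_eq_iff power2_eq_square)
  have mulR: "x * (qcnj x /\<^sub>R (norm x)\<^sup>2) = (x * qcnj x) /\<^sub>R (norm x)\<^sup>2"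
             "(qcnj x /\<^sub>R (norm x)\<^sup>2) * x = (qcnj x * x) /\<^sub>R (norm x)\<^sup>2"
    by simp_all
  show "x \<noteq> 0 \<Longrightarrow> inverse x * x = 1"
    by (simp only: inverse_quat_def mulR xc) (simp add: of_real_def)
  show "x \<noteq> 0 \<Longrightarrow> x * inverse x = 1"
    by (simp only: inverse_quat_def mulR xc) (simp add: of_real_def)
  show "x div y = x * inverse y"
    by (rule divide_quat_def)
  show "inverse (0 :: quat) = 0"
    by (simp add: inverse_quat_def quat_eq_iff)
  show "norm (x * y) = norm x * norm y"
    unfolding quat_norm_eq_sqrt real_sqrt_mult [symmetric]
    by (rule arg_cong [where f = sqrt]) (simp add: power2_eq_square algebra_simps)
qed

end

instantiation quat :: euclidean_space
begin

definition Basis_quat :: "quat set" where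
  "Basis_quat = {Quat 1 0 0 0, Quat 0 1 0 0, Quat 0 0 1 0, Quat 0 0 0 1}"

instance
proof
  show "(Basis :: quat set) \<noteq> {}" "finite (Basis :: quat set)"
    by (simp_all add: Basis_quat_def)
  fix u v :: quat
  assume "u \<in> Basis" "v \<in> Basis"
  then show "inner u v = (if u = v then 1 else 0)"
    unfolding Basis_quat_def inner_quat_def
    by (elim insertE emptyE) simp_all
next
  fix u :: quat
  show "(\<forall>v\<in>Basis. inner u v = 0) \<longleftrightarrow> u = 0"
    by (simp add: Basis_quat_def inner_quat_def) (simp add: quat_eq_iff)
qed

end


section \<open>Slices\<close>

definition imag_sphere :: "quat set" where
  "imag_sphere = {q. qRe q = 0 \<and> norm q = 1}"

definition slice :: "quat \<Rightarrow> quat set" where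
  "slice i = {of_real x + i * of_real y | x y. True}"

definition slice_ball :: "quat \<Rightarrow> quat set" where
  "slice_ball i = ball 0 1 \<inter> slice i"

definition of_complex_slice :: "quat \<Rightarrow> complex \<Rightarrow> quat" where
  "of_complex_slice i w = of_real (Re w) + i * of_real (Im w)"


section \<open>Slice regular functions\<close>

text \<open>A function on the open unit ball is represented by a total function that vanishes off
  the ball, so that equality of functions on the ball is equality in HOL.\<close>

definition slice_regular :: "(quat \<Rightarrow> quat) set" where
  "slice_regular = {f.
     (\<forall>q. q \<notin> ball 0 1 \<longrightarrow> f q = 0) \<and>
     f differentiable_on ball 0 1 \<and>
     (\<forall>i\<in>imag_sphere. \<forall>x y. of_real x + i * of_real y \<in> ball 0 1 \<longrightarrow>
        vector_derivative (\<lambda>s. f (of_real s + i * of_real y)) (at x)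
        + i * vector_derivative (\<lambda>t. f (of_real x + i * of_real t)) (at y) = 0)}"

definition sr_coeff :: "(quat \<Rightarrow> quat) \<Rightarrow> nat \<Rightarrow> quat" where
  "sr_coeff f = (THE c. \<forall>q\<in>ball 0 1. (\<lambda>n. q ^ n * c n) sums f q)"

text \<open>The slice product: Cauchy product of the power series coefficients.\<close>

definition sr_mult :: "(quat \<Rightarrow> quat) \<Rightarrow> (quat \<Rightarrow> quat) \<Rightarrow> quat \<Rightarrow> quat" where
  "sr_mult f g q =
     (if q \<in> ball 0 1 then \<Sum>n. q ^ n * (\<Sum>k\<le>n. sr_coeff f k * sr_coeff g (n - k)) else 0)"

text \<open>\<open>T\<^sub>a = (1 - q a\<^sup>*)\<^sup>-\<^sup>* * (a - q)\<close>, the regular inverse being the geometric series.\<close>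

definition slice_moebius :: "quat \<Rightarrow> quat \<Rightarrow> quat" where
  "slice_moebius a = sr_mult (\<lambda>q. \<Sum>n. q ^ n * qcnj a ^ n) (\<lambda>q. a - q)"

definition slice_restrict :: "quat \<Rightarrow> (quat \<Rightarrow> quat) \<Rightarrow> quat \<Rightarrow> quat" where
  "slice_restrict i f z = (if z \<in> slice_ball i then f z else 0)"

text \<open>For \<open>q = x + Iy\<close> we take \<open>y = \<bar>Im q\<bar>\<close> and \<open>I = Im q / \<bar>Im q\<bar>\<close>; for real \<open>q\<close> this gives
  \<open>I = 0\<close>, and the formula still returns \<open>g q\<close>, as it does for every imaginary unit \<open>I\<close>.\<close>

definition slice_extend :: "quat \<Rightarrow> (quat \<Rightarrow> quat) \<Rightarrow> quat \<Rightarrow> quat" where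
  "slice_extend i g q =
     (if q \<in> ball 0 1 then
        (let x = of_real (qRe q); v = q - x; y = of_real (norm v); I = sgn v
         in (1 / 2) *\<^sub>R ((1 + I * i) * g (x - y * i) + (1 - I * i) * g (x + y * i)))
      else 0)"

text \<open>The decomposition \<open>q = q\<^sub>1 + q\<^sub>2 j\<close> with \<open>q\<^sub>1\<close>, \<open>q\<^sub>2\<close> in the slice of \<open>i\<close>, for orthogonal \<open>i\<close>, \<open>j\<close>.\<close>

definition slice_split :: "quat \<Rightarrow> quat \<Rightarrow> quat \<Rightarrow> quat \<times> quat" where
  "slice_split i j q = (THE p. fst p \<in> slice i \<and> snd p \<in> slice i \<and> q = fst p + snd p * j)"

definition slice_comp ::
  "quat \<Rightarrow> quat \<Rightarrow> (quat \<Rightarrow> quat) \<Rightarrow> (quat \<Rightarrow> quat) \<Rightarrow> quat \<Rightarrow> quat" where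
  "slice_comp i j f h q =
     (let f1 = \<lambda>z. fst (slice_split i j (slice_restrict i f z));
          f2 = \<lambda>z. snd (slice_split i j (slice_restrict i f z))
      in slice_extend i (f1 \<circ> slice_restrict i h) q
           + slice_extend i (f2 \<circ> slice_restrict i h) q * j)"


section \<open>The Besov space\<close>

definition slice_area :: "quat \<Rightarrow> quat measure" where
  "slice_area i =
     distr (density lborel (\<lambda>w. ennreal (1 / pi) * indicator (ball 0 1) w)) borel (of_complex_slice i)"

definition slice_hyp_area :: "quat \<Rightarrow> quat measure" where
  "slice_hyp_area i = density (slice_area i) (\<lambda>z. ennreal (1 / (1 - (norm z)\<^sup>2)\<^sup>2))"

definition real_partial :: "(quat \<Rightarrow> quat) \<Rightarrow> quat \<Rightarrow> quat" where
  "real_partial f q = vector_derivative (\<lambda>t. f (q + of_real t)) (at 0)"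

definition besov1 :: "quat \<Rightarrow> (quat \<Rightarrow> quat) set" where
  "besov1 i = {f \<in> slice_regular.
     \<exists>n>1. (\<integral>\<^sup>+z\<in>slice_ball i.
        ennreal ((1 - (norm z)\<^sup>2) ^ n * norm ((real_partial ^^ n) f z)) \<partial>slice_hyp_area i) < \<infinity>}"

text \<open>Only absolutely summable coefficient families compete: for the others the sum of the norms
  is infinite, whereas \<open>suminf\<close> would return an arbitrary value.\<close>

definition besov1_norm :: "quat \<Rightarrow> (quat \<Rightarrow> quat) \<Rightarrow> real" where
  "besov1_norm i f =
     Inf {(\<Sum>k. norm (\<gamma> k)) | \<gamma> :: nat \<Rightarrow> quat.
       summable (\<lambda>k. norm (\<gamma> k)) \<and>
       (\<exists>a :: nat \<Rightarrow> quat. (\<forall>k\<ge>1. a k \<in> slice_ball i) \<and>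
          (\<forall>q\<in>ball 0 1. (\<lambda>k. slice_moebius (a (Suc k)) q * \<gamma> (Suc k)) sums (f q - \<gamma> 0)))}"

text \<open>Right quaternionic Banach spaces of quaternion-valued functions, with pointwise operations.
  The norm axioms at real multiples of any \<open>f \<in> V\<close> also rule out an infimum over the empty set
  in the norm above.\<close>

definition right_quat_banach :: "(quat \<Rightarrow> quat) set \<Rightarrow> ((quat \<Rightarrow> quat) \<Rightarrow> real) \<Rightarrow> bool" where
  "right_quat_banach V N \<longleftrightarrow>
     (\<lambda>_. 0) \<in> V \<and>
     (\<forall>f\<in>V. \<forall>g\<in>V. (\<lambda>q. f q + g q) \<in> V) \<and>
     (\<forall>f\<in>V. \<forall>c. (\<lambda>q. f q * c) \<in> V) \<and>
     (\<forall>f\<in>V. 0 \<le> N f \<and> (N f = 0 \<longleftrightarrow> f = (\<lambda>_. 0))) \<and>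
     (\<forall>f\<in>V. \<forall>g\<in>V. N (\<lambda>q. f q + g q) \<le> N f + N g) \<and>
     (\<forall>f\<in>V. \<forall>c. N (\<lambda>q. f q * c) = N f * norm c) \<and>
     (\<forall>F :: nat \<Rightarrow> quat \<Rightarrow> quat.
        (\<forall>n. F n \<in> V) \<and> (\<forall>e>0. \<exists>M. \<forall>m\<ge>M. \<forall>n\<ge>M. N (\<lambda>q. F m q - F n q) < e) \<longrightarrow>
        (\<exists>f\<in>V. (\<lambda>n. N (\<lambda>q. F n q - f q)) \<longlonglongrightarrow> 0))"

end

theory Submission
  imports Defs "HOL-Complex_Analysis.Complex_Analysis"
begin

text \<open>
  Everything follows once \<open>besov1 i\<close> is known to consist of exactly the functions with an
  \<open>\<ell>\<^sup>1\<close> representation by atoms: for such functions the norm is a quotient norm of \<open>\<ell>\<^sup>1\<close>, hence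
  complete, and composition with a Moebius map permutes the atoms up to unimodular factors.

  Splitting \<open>f = F\<^sub>1 + F\<^sub>2 j\<close> on the slice reduces this to a holomorphic function \<open>F\<close> on the disc.
  With \<open>A\<^sub>t F (z) = \<Sum>l<n. (1 - t)\<^sup>l / l! z\<^sup>l F\<^sup>(\<^sup>l\<^sup>)(t z)\<close> one has
  \<open>d/dt A\<^sub>t F (z) = (1 - t)\<^sup>n\<^sup>-\<^sup>1 / (n-1)! z\<^sup>n F\<^sup>(\<^sup>n\<^sup>)(t z)\<close> and \<open>A\<^sub>t F \<rightarrow> F\<close> as \<open>t \<rightarrow> 1\<close>. The increments of
  \<open>A\<^sub>t F\<close> between \<open>t = 1 - 2\<^sup>-\<^sup>k\<close> and \<open>t = 1 - 2\<^sup>-\<^sup>k\<^sup>-\<^sup>1\<close> extend beyond the disc to radius about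
  \<open>1 + 2\<^sup>-\<^sup>k\<^sup>-\<^sup>2\<close>. A function \<open>h\<close> holomorphic beyond \<open>\<bar>z\<bar> = S > 1\<close> is, by Cauchy's formula on that
  circle, an average of kernels \<open>1 / (1 - cnj a z)\<close> with \<open>\<bar>a\<bar> = 1/S\<close>; each is an affine function of
  \<open>T\<^sub>a\<close>, and a Riemann sum gives a representation of cost about \<open>S / (S - 1)\<close> times the mean of \<open>\<bar>h\<bar>\<close>.
  Summing over \<open>k\<close> gives a multiple of the Besov integral of \<open>F\<close>, for every \<open>n > 1\<close> at once.
  Conversely \<open>\<integral> \<bar>T\<^sub>a''\<bar> dA\<close> is bounded uniformly in \<open>a\<close>.
\<close>

section \<open>Atomic representations\<close>

text \<open>The exponents balance as follows. At the k-th step put d = 2^-(k+1). The circle has S -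
  1 of order d, so each kernel costs about 1/d, while the factor (1 - t)^(n-1) is at most d^(n-1).
  What remains is d^(n-2), comparable to (1 - |z|^2)^(n-2) at the points reached: exactly the Besov
  weight once the hyperbolic density is included. Taylor polynomials are used because their
  t-derivative involves F^(n) alone, so derivatives of different orders never have to be compared.
  The obstacle is that a Riemann sum reproduces h only approximately, and the error must be atomic
  as well, at small cost. It is made uniformly small on a disc of radius larger than 1, where a
  cruder estimate by the supremum absorbs it. Costs are upper bounds for some representation, not
  values of an infimum, so they add up over series without choosing minimisers. A representation on
  one slice extends to the ball with the same coefficients, hence at the same cost.\<close>

text \<open>One predicate for three settings: complex atoms on the disc, and
  \<open>slice_moebius\<close> on a slice ball or on the whole ball. The constant sits at index 0
  and the atoms start at 1, exactly as in the set whose infimum is \<open>besov1_norm\<close>, so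
  the two unfold into each other.\<close>

definition atomic_le ::
  "('p \<Rightarrow> 'x \<Rightarrow> 'v::{real_normed_div_algebra,banach}) \<Rightarrow> 'p set \<Rightarrow> 'x set \<Rightarrow> ('x \<Rightarrow> 'v) \<Rightarrow> real \<Rightarrow> bool"
where
  "atomic_le \<tau> P X f c \<longleftrightarrow> (\<exists>\<gamma> a. (\<forall>k\<ge>1::nat. a k \<in> P) \<and> summable (\<lambda>k. norm (\<gamma> k)) \<and>
     (\<Sum>k. norm (\<gamma> k)) \<le> c \<and> (\<forall>x\<in>X. (\<lambda>k. \<tau> (a (Suc k)) x * \<gamma> (Suc k)) sums (f x - \<gamma> 0)))"

lemma atomic_leI:
  assumes "\<And>k. a (Suc k) \<in> P" "summable (\<lambda>k. norm (\<gamma> k))" "(\<Sum>k. norm (\<gamma> k)) \<le> c"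
    "\<And>x. x \<in> X \<Longrightarrow> (\<lambda>k. \<tau> (a (Suc k)) x * \<gamma> (Suc k)) sums (f x - \<gamma> 0)"
  shows "atomic_le \<tau> P X f c"
proof -
  have "a k \<in> P" if "k \<ge> 1" for k using assms(1)[of "k-1"] that by simp
  then show ?thesis unfolding atomic_le_def using assms(2-4) by blast
qed

lemma atomic_leE:
  assumes "atomic_le \<tau> P X f c"
  obtains a \<gamma> where "\<And>k. a (Suc k) \<in> P" "summable (\<lambda>k. norm (\<gamma> k))" "(\<Sum>k. norm (\<gamma> k)) \<le> c"
    "\<And>x. x \<in> X \<Longrightarrow> (\<lambda>k. \<tau> (a (Suc k)) x * \<gamma> (Suc k)) sums (f x - \<gamma> 0)"
proof -
  obtain \<gamma> a where *: "\<forall>k\<ge>1::nat. a k \<in> P" "summable (\<lambda>k. norm (\<gamma> k))"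
     "(\<Sum>k. norm (\<gamma> k)) \<le> c" "\<forall>x\<in>X. (\<lambda>k. \<tau> (a (Suc k)) x * \<gamma> (Suc k)) sums (f x - \<gamma> 0)"
    using assms unfolding atomic_le_def by blast
  show thesis by (rule that[of a \<gamma>]) (use * in auto)
qed

lemma atomic_le_mono:
  assumes "atomic_le \<tau> P X f c" "c \<le> d" shows "atomic_le \<tau> P X f d"
  using assms(1)
proof (rule atomic_leE)
  fix a \<gamma>
  assume *: "\<And>k. a (Suc k) \<in> P" "summable (\<lambda>k. norm (\<gamma> k))" "(\<Sum>k. norm (\<gamma> k)) \<le> c"
    "\<And>x. x \<in> X \<Longrightarrow> (\<lambda>k. \<tau> (a (Suc k)) x * \<gamma> (Suc k)) sums (f x - \<gamma> 0)"
  show ?thesis by (rule atomic_leI[of a P \<gamma>, OF *(1,2) order_trans[OF *(3) assms(2)] *(4)])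
qed

lemma atomic_le_cong:
  assumes "atomic_le \<tau> P X f c" "\<And>x. x \<in> X \<Longrightarrow> f x = g x" shows "atomic_le \<tau> P X g c"
  using assms(1)
proof (rule atomic_leE)
  fix a \<gamma>
  assume *: "\<And>k. a (Suc k) \<in> P" "summable (\<lambda>k. norm (\<gamma> k))" "(\<Sum>k. norm (\<gamma> k)) \<le> c"
    "\<And>x. x \<in> X \<Longrightarrow> (\<lambda>k. \<tau> (a (Suc k)) x * \<gamma> (Suc k)) sums (f x - \<gamma> 0)"
  show ?thesis by (rule atomic_leI[of a P \<gamma>, OF *(1-3)]) (use *(4) assms(2) in auto)
qed

lemma atomic_le_const:
  assumes "P \<noteq> {}" shows "atomic_le \<tau> P X (\<lambda>x. g) (norm g)"
proof -
  obtain p where p: "p \<in> P" using assms by auto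
  have s: "(\<lambda>k. norm ((if k = 0 then g else 0))) sums (norm g)"
    using sums_single[of 0 "\<lambda>_. norm g"] by (simp add: if_distrib cong: if_cong)
  show ?thesis
    by (rule atomic_leI[where a = "\<lambda>_. p" and \<gamma> = "\<lambda>k. if k = 0 then g else 0"])
      (use p s sums_summable sums_unique in \<open>auto simp: sums_unique[symmetric]\<close>)
qed

lemma atomic_le_single:
  assumes "p \<in> P" shows "atomic_le \<tau> P X (\<lambda>x. \<tau> p x * g) (norm g)"
proof -
  have s: "(\<lambda>k. norm ((if k = 1 then g else 0))) sums (norm g)"
    using sums_single[of 1 "\<lambda>_. norm g"] by (simp add: if_distrib cong: if_cong)
  have t: "(\<lambda>k. \<tau> p x * (if Suc k = 1 then g else 0)) sums (\<tau> p x * g)" for x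
    using sums_single[of 0 "\<lambda>_. \<tau> p x * g"] by (simp add: if_distrib cong: if_cong)
  show ?thesis
    by (rule atomic_leI[where a = "\<lambda>_. p" and \<gamma> = "\<lambda>k. if k = 1 then g else 0"])
      (use assms s t in \<open>auto simp: sums_iff\<close>)
qed

lemma atomic_le_mult_right:
  assumes "atomic_le \<tau> P X f c" shows "atomic_le \<tau> P X (\<lambda>x. f x * q) (c * norm q)"
proof -
  obtain a \<gamma> where a: "\<And>k. a (Suc k) \<in> P" and s: "summable (\<lambda>k. norm (\<gamma> k))"
    and c: "(\<Sum>k. norm (\<gamma> k)) \<le> c"
    and S: "\<And>x. x \<in> X \<Longrightarrow> (\<lambda>k. \<tau> (a (Suc k)) x * \<gamma> (Suc k)) sums (f x - \<gamma> 0)"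
    using assms by (elim atomic_leE) blast
  show ?thesis
  proof (rule atomic_leI[where a = a and \<gamma> = "\<lambda>k. \<gamma> k * q"])
    show "summable (\<lambda>k. norm (\<gamma> k * q))"
      using s by (simp add: norm_mult summable_mult2)
    have "(\<Sum>k. norm (\<gamma> k * q)) = (\<Sum>k. norm (\<gamma> k)) * norm q"
      using s by (simp add: norm_mult suminf_mult2)
    also have "\<dots> \<le> c * norm q" using c by (rule mult_right_mono) simp
    finally show "(\<Sum>k. norm (\<gamma> k * q)) \<le> c * norm q" .
    show "(\<lambda>k. \<tau> (a (Suc k)) x * (\<gamma> (Suc k) * q)) sums (f x * q - \<gamma> 0 * q)" if "x \<in> X" for x
      using sums_mult2[OF S[OF that], of q] by (simp add: algebra_simps)
  qed (rule a)
qed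

text \<open>Used for definiteness of the norm and for pointwise convergence of Cauchy sequences.
  \<open>1 \<le> B\<close> lets the constant \<open>\<gamma> 0\<close> be charged at the same rate
  as the atoms.\<close>

lemma atomic_le_norm_bound:
  assumes "atomic_le \<tau> P X f c" "x \<in> X" "\<And>p. p \<in> P \<Longrightarrow> norm (\<tau> p x) \<le> B" "1 \<le> B"
  shows "norm (f x) \<le> B * c"
proof -
  obtain a \<gamma> where a: "\<And>k. a (Suc k) \<in> P" and s: "summable (\<lambda>k. norm (\<gamma> k))"
    and c: "(\<Sum>k. norm (\<gamma> k)) \<le> c"
    and S: "\<And>x. x \<in> X \<Longrightarrow> (\<lambda>k. \<tau> (a (Suc k)) x * \<gamma> (Suc k)) sums (f x - \<gamma> 0)"
    using assms(1) by (elim atomic_leE) blast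
  have s1: "summable (\<lambda>k. norm (\<gamma> (Suc k)))" using summable_Suc_iff[of "\<lambda>k. norm (\<gamma> k)"] s by simp
  have "norm (f x - \<gamma> 0) \<le> (\<Sum>k. B * norm (\<gamma> (Suc k)))"
    unfolding sums_unique[OF S[OF assms(2)]]
  proof (rule norm_suminf_le)
    show "norm (\<tau> (a (Suc k)) x * \<gamma> (Suc k)) \<le> B * norm (\<gamma> (Suc k))" for k
      using assms(3)[OF a] by (simp add: norm_mult mult_right_mono)
  qed (rule summable_mult[OF s1])
  also have "\<dots> = B * (\<Sum>k. norm (\<gamma> (Suc k)))" using s1 by (rule suminf_mult)
  also have "\<dots> = B * ((\<Sum>k. norm (\<gamma> k)) - norm (\<gamma> 0))" using suminf_split_head[OF s] by simp
  also have "\<dots> \<le> B * (c - norm (\<gamma> 0))" using c assms(4) by simp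
  finally have "norm (f x) \<le> norm (\<gamma> 0) + B * (c - norm (\<gamma> 0))"
    using norm_triangle_sub[of "f x" "\<gamma> 0"] by simp
  also have "\<dots> \<le> B * c" using assms(4) mult_right_mono[of 1 B "norm (\<gamma> 0)"] by (simp add: algebra_simps)
  finally show ?thesis .
qed

text \<open>An atomic representation is a single sequence, so a series of representations has to be
  flattened. Absolute convergence allows an unconditional sum over pairs, which is then enumerated
  by \<open>prod_decode\<close>.\<close>

lemma sums_prod_decode:
  fixes u :: "nat \<Rightarrow> nat \<Rightarrow> 'v::banach"
  assumes s1: "\<And>m. summable (\<lambda>l. norm (u m l))"
    and s2: "summable (\<lambda>m. \<Sum>l. norm (u m l))"
  shows "summable (\<lambda>k. norm (case_prod u (prod_decode k)))"
    and "(\<lambda>k. case_prod u (prod_decode k)) sums (\<Sum>m. \<Sum>l. u m l)"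
    and "(\<Sum>k. norm (case_prod u (prod_decode k))) = (\<Sum>m. \<Sum>l. norm (u m l))"
proof -
  have h1: "((\<lambda>l. norm (u m l)) has_sum (\<Sum>l. norm (u m l))) UNIV" for m
    using norm_summable_imp_has_sum[of "\<lambda>l. norm (u m l)"] s1[of m] by (simp add: summable_sums)
  have nn: "0 \<le> (\<Sum>l. norm (u m l))" for m using s1 by (simp add: suminf_nonneg)
  have h2: "((\<lambda>m. \<Sum>l. norm (u m l)) has_sum (\<Sum>m. \<Sum>l. norm (u m l))) UNIV"
    using norm_summable_imp_has_sum[of "\<lambda>m. \<Sum>l. norm (u m l)"] s2 nn by (simp add: summable_sums)
  have abs: "(\<lambda>p. norm (case_prod u p)) summable_on (UNIV \<times> UNIV)"
    unfolding Infinite_Sum.abs_summable_on_Sigma_iff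
  proof (intro conjI ballI)
    fix m show "(\<lambda>l. norm (case_prod u (m, l))) summable_on UNIV"
      using h1[of m] by (auto simp: summable_on_def)
    have "norm (\<Sum>\<^sub>\<infinity>l. norm (case_prod u (m, l))) = (\<Sum>l. norm (u m l))" for m
      using infsumI[OF h1] nn[of m] by simp
    then show "(\<lambda>m. norm (\<Sum>\<^sub>\<infinity>l. norm (case_prod u (m, l)))) summable_on UNIV"
      using h2 nn by (auto simp: summable_on_def simp del: real_norm_def)
  qed
  have bij: "bij_betw prod_decode UNIV (UNIV \<times> UNIV)" using bij_prod_decode by simp
  have a1: "((\<lambda>p. norm (case_prod u p)) has_sum (\<Sum>\<^sub>\<infinity>p. norm (case_prod u p))) (UNIV \<times> UNIV)"
    using abs by (simp add: has_sum_infsum)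
  have e1: "(\<Sum>\<^sub>\<infinity>p. norm (case_prod u p)) = (\<Sum>m. \<Sum>l. norm (u m l))"
    using has_sum_unique[OF has_sum_SigmaD[OF a1, of "\<lambda>m. \<Sum>l. norm (u m l)"] h2] h1 by simp
  have a2: "((\<lambda>k. norm (case_prod u (prod_decode k))) has_sum (\<Sum>m. \<Sum>l. norm (u m l))) UNIV"
    using has_sum_reindex_bij_betw[OF bij, of "\<lambda>p. norm (case_prod u p)"] a1 e1 by simp
  show sm: "summable (\<lambda>k. norm (case_prod u (prod_decode k)))"
    using has_sum_imp_sums[OF a2] by (rule sums_summable)
  show "(\<Sum>k. norm (case_prod u (prod_decode k))) = (\<Sum>m. \<Sum>l. norm (u m l))"
    using has_sum_imp_sums[OF a2] by (simp add: sums_iff)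
  have b1: "(case_prod u has_sum (infsum (case_prod u) (UNIV \<times> UNIV))) (UNIV \<times> UNIV)"
    using abs_summable_summable[OF abs] by (simp add: has_sum_infsum)
  have b2: "((\<lambda>l. u m l) has_sum (\<Sum>l. u m l)) UNIV" for m
    by (rule norm_summable_imp_has_sum[OF s1]) (simp add: s1 summable_norm_cancel summable_sums)
  have b3: "((\<lambda>m. \<Sum>l. u m l) has_sum (infsum (case_prod u) (UNIV \<times> UNIV))) UNIV"
    using has_sum_SigmaD[OF b1, of "\<lambda>m. \<Sum>l. u m l"] b2 by simp
  have e2: "infsum (case_prod u) (UNIV \<times> UNIV) = (\<Sum>m. \<Sum>l. u m l)"
    using has_sum_imp_sums[OF b3] by (simp add: sums_iff)
  have "((\<lambda>k. case_prod u (prod_decode k)) has_sum (\<Sum>m. \<Sum>l. u m l)) UNIV"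
    using has_sum_reindex_bij_betw[OF bij, of "case_prod u"] b1 e2 by simp
  then show "(\<lambda>k. case_prod u (prod_decode k)) sums (\<Sum>m. \<Sum>l. u m l)"
    by (rule has_sum_imp_sums)
qed

text \<open>The source of completeness: the representations of all \<open>f m\<close> are merged
  along \<open>prod_decode\<close>, and the constants \<open>\<gamma> m 0\<close> are summed into
  the new constant. The uniform bound \<open>B\<close> on the atoms makes the double series
  absolutely convergent at every point.\<close>

lemma atomic_le_sums:
  assumes f: "\<And>m. atomic_le \<tau> P X (f m) (c m)" and c: "summable c"
    and F: "\<And>x. x \<in> X \<Longrightarrow> (\<lambda>m. f m x) sums F x"
    and B: "\<And>p x. p \<in> P \<Longrightarrow> x \<in> X \<Longrightarrow> norm (\<tau> p x) \<le> B"
  shows "atomic_le \<tau> P X F (suminf c)"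
proof -
  define Q where "Q m a \<gamma> \<longleftrightarrow> (\<forall>k. a (Suc k) \<in> P) \<and> summable (\<lambda>k. norm (\<gamma> k)) \<and> (\<Sum>k. norm (\<gamma> k)) \<le> c m
      \<and> (\<forall>x\<in>X. (\<lambda>k. \<tau> (a (Suc k)) x * \<gamma> (Suc k)) sums (f m x - \<gamma> 0))" for m and a :: "nat \<Rightarrow> 'a" and \<gamma>
  have "\<exists>a \<gamma>. Q m a \<gamma>" for m
    using f[of m] unfolding Q_def by (elim atomic_leE) blast
  then obtain a \<gamma> where Q: "\<And>m. Q m (a m) (\<gamma> m)" by metis
  have a: "a m (Suc k) \<in> P" and s: "summable (\<lambda>k. norm (\<gamma> m k))"
    and cm: "(\<Sum>k. norm (\<gamma> m k)) \<le> c m" for m k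
    using Q[of m] by (simp_all add: Q_def)
  have S: "(\<lambda>k. \<tau> (a m (Suc k)) x * \<gamma> m (Suc k)) sums (f m x - \<gamma> m 0)" if "x \<in> X" for m x
    using Q[of m] that by (simp add: Q_def)
  have s1: "summable (\<lambda>k. norm (\<gamma> m (Suc k)))" for m using summable_Suc_iff[of "\<lambda>k. norm (\<gamma> m k)"] s by simp
  have split: "(\<Sum>k. norm (\<gamma> m k)) = norm (\<gamma> m 0) + (\<Sum>k. norm (\<gamma> m (Suc k)))" for m
    using suminf_split_head[OF s[of m]] by simp
  have nn: "0 \<le> (\<Sum>k. norm (\<gamma> m (Suc k)))" for m using s1 by (simp add: suminf_nonneg)
  have g0: "summable (\<lambda>m. norm (\<gamma> m 0))"
  proof (rule summable_comparison_test'[OF c, of 0])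
    show "norm (norm (\<gamma> m 0)) \<le> c m" for m using cm[of m] split[of m] nn[of m] by simp
  qed
  have s2: "summable (\<lambda>m. \<Sum>k. norm (\<gamma> m (Suc k)))"
  proof (rule summable_comparison_test'[OF c, of 0])
    show "norm (\<Sum>k. norm (\<gamma> m (Suc k))) \<le> c m" for m
      using cm[of m] split[of m] nn[of m] norm_ge_zero[of "\<gamma> m 0"] unfolding real_norm_def by linarith
  qed
  note D = sums_prod_decode[OF s1 s2]
  \<comment> \<open>Index 0 is reserved for the constant, so the pair with code \<open>j\<close>
    sits at \<open>Suc j\<close>, and its second entry \<open>l\<close> refers to the shifted index
    \<open>Suc l\<close> of representation \<open>m\<close>.\<close>
  define \<Gamma> where "\<Gamma> k = (case k of 0 \<Rightarrow> (\<Sum>m. \<gamma> m 0) | Suc j \<Rightarrow> (case prod_decode j of (m, l) \<Rightarrow> \<gamma> m (Suc l)))" for k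
  define A where "A k = (case k of 0 \<Rightarrow> undefined | Suc j \<Rightarrow> (case prod_decode j of (m, l) \<Rightarrow> a m (Suc l)))" for k
  have G: "\<Gamma> 0 = (\<Sum>m. \<gamma> m 0)" "\<Gamma> (Suc j) = (case prod_decode j of (m, l) \<Rightarrow> \<gamma> m (Suc l))" for j
    by (simp_all add: \<Gamma>_def)
  show ?thesis
  proof (rule atomic_leI[where a = A and \<gamma> = \<Gamma>])
    show "A (Suc k) \<in> P" for k using a by (simp add: A_def split: prod.split)
    have sG1: "summable (\<lambda>k. norm (\<Gamma> (Suc k)))" using D(1) by (simp add: G)
    then show sG: "summable (\<lambda>k. norm (\<Gamma> k))" using summable_Suc_iff by blast
    have "(\<Sum>k. norm (\<Gamma> k)) = norm (\<Gamma> 0) + (\<Sum>k. norm (\<Gamma> (Suc k)))"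
      using suminf_split_head[OF sG] by simp
    also have "(\<Sum>k. norm (\<Gamma> (Suc k))) = (\<Sum>m. \<Sum>k. norm (\<gamma> m (Suc k)))"
      using D(3) by (simp add: G)
    also have "norm (\<Gamma> 0) \<le> (\<Sum>m. norm (\<gamma> m 0))" unfolding G by (rule summable_norm[OF g0])
    also have "(\<Sum>m. norm (\<gamma> m 0)) + (\<Sum>m. \<Sum>k. norm (\<gamma> m (Suc k))) = (\<Sum>m. \<Sum>k. norm (\<gamma> m k))"
      using suminf_add[OF g0 s2] by (simp add: split)
    also have "\<dots> \<le> suminf c"
      by (rule suminf_le[OF cm _ c]) (use summable_add[OF g0 s2] in \<open>simp add: split\<close>)
    finally show "(\<Sum>k. norm (\<Gamma> k)) \<le> suminf c" by simp
    fix x assume x: "x \<in> X"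
    define u where "u m l = \<tau> (a m (Suc l)) x * \<gamma> m (Suc l)" for m l
    have ub: "norm (u m l) \<le> \<bar>B\<bar> * norm (\<gamma> m (Suc l))" for m l
      unfolding u_def norm_mult
    by (intro mult_right_mono order_trans[OF B[OF a x] abs_ge_self] norm_ge_zero)
    have us1: "summable (\<lambda>l. norm (u m l))" for m
      by (rule summable_comparison_test'[OF summable_mult[OF s1], of 0]) (use ub in auto)
    have us2: "summable (\<lambda>m. \<Sum>l. norm (u m l))"
    proof (rule summable_comparison_test'[OF summable_mult[OF s2, of "\<bar>B\<bar>"], of 0])
      fix m
      have "(\<Sum>l. norm (u m l)) \<le> (\<Sum>l. \<bar>B\<bar> * norm (\<gamma> m (Suc l)))"
        by (rule suminf_le[OF ub us1 summable_mult[OF s1]])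
      then show "norm (\<Sum>l. norm (u m l)) \<le> \<bar>B\<bar> * (\<Sum>l. norm (\<gamma> m (Suc l)))"
        using s1 us1 by (simp add: suminf_mult suminf_nonneg)
    qed
    have e: "(\<Sum>l. u m l) = f m x - \<gamma> m 0" for m
      using S[OF x, of m] by (simp add: u_def sums_iff)
    have "(\<lambda>m. f m x - \<gamma> m 0) sums (F x - (\<Sum>m. \<gamma> m 0))"
      by (rule sums_diff[OF F[OF x]]) (simp add: g0 summable_norm_cancel summable_sums)
    then have "(\<Sum>m. \<Sum>l. u m l) = F x - \<Gamma> 0"
      by (simp add: e G sums_iff)
    then have "(\<lambda>k. case_prod u (prod_decode k)) sums (F x - \<Gamma> 0)"
      using sums_prod_decode(2)[OF us1 us2] by simp
    moreover have "case_prod u (prod_decode k) = \<tau> (A (Suc k)) x * \<Gamma> (Suc k)" for k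
      by (simp add: u_def A_def G split: prod.split)
    ultimately show "(\<lambda>k. \<tau> (A (Suc k)) x * \<Gamma> (Suc k)) sums (F x - \<Gamma> 0)" by simp
  qed
qed

text \<open>The finite sum is padded to a series by zero functions; \<open>P \<noteq> {}\<close>
  supplies parameters for representing zero.\<close>

lemma atomic_le_sum:
  assumes f: "\<And>m. m < N \<Longrightarrow> atomic_le \<tau> P X (f m) (c m)" and P: "P \<noteq> {}"
    and B: "\<And>p x. p \<in> P \<Longrightarrow> x \<in> X \<Longrightarrow> norm (\<tau> p x) \<le> B"
  shows "atomic_le \<tau> P X (\<lambda>x. \<Sum>m<N::nat. f m x) (\<Sum>m<N. c m)"
proof -
  define f' where "f' m = (if m < N then f m else (\<lambda>x. 0))" for m
  define c' where "c' m = (if m < N then c m else 0)" for m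
  have z: "atomic_le \<tau> P X (\<lambda>x. 0) 0" using atomic_le_const[OF P, of \<tau> X 0] by simp
  have c: "c' sums (\<Sum>m<N. c' m)" by (rule sums_finite) (auto simp: c'_def)
  have "atomic_le \<tau> P X (\<lambda>x. \<Sum>m<N. f' m x) (suminf c')"
    (is "atomic_le _ _ _ ?F _")
  proof (rule atomic_le_sums[of \<tau> P X f' c'])
    show "(\<lambda>m. f' m x) sums ?F x" for x
      by (rule sums_finite) (auto simp: f'_def)
    show "summable c'" using c by (rule sums_summable)
  qed (use f z B in \<open>auto simp: f'_def c'_def\<close>)
  also have "suminf c' = (\<Sum>m<N. c m)" using c by (simp add: sums_iff c'_def)
  finally show ?thesis by (rule atomic_le_cong) (simp add: f'_def)
qed

lemma atomic_le_add:
  assumes "atomic_le \<tau> P X f c" "atomic_le \<tau> P X g d" and P: "P \<noteq> {}"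
    and B: "\<And>p x. p \<in> P \<Longrightarrow> x \<in> X \<Longrightarrow> norm (\<tau> p x) \<le> B"
  shows "atomic_le \<tau> P X (\<lambda>x. f x + g x) (c + d)"
proof -
  have "atomic_le \<tau> P X (\<lambda>x. \<Sum>m<2::nat. (if m = 0 then f else g) x) (\<Sum>m<2::nat. (if m = 0 then c else d))"
    by (rule atomic_le_sum) (use assms in auto)
  then show ?thesis by (simp add: numeral_2_eq_2)
qed

section \<open>Functions holomorphic beyond the disc\<close>

definition disc_moebius :: "complex \<Rightarrow> complex \<Rightarrow> complex" where
  "disc_moebius a z = (a - z) / (1 - cnj a * z)"

abbreviation "catomic \<equiv> atomic_le disc_moebius (ball 0 1) (ball 0 1)"

lemma disc_moebius_eq_Moebius: "disc_moebius a z = - Moebius_function 0 a z"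
  by (simp add: disc_moebius_def Moebius_function_simple minus_divide_left)

lemma norm_disc_moebius_less: "norm a < 1 \<Longrightarrow> norm z < 1 \<Longrightarrow> norm (disc_moebius a z) < 1"
  by (simp add: disc_moebius_eq_Moebius Moebius_function_norm_lt_1)

lemma disc_moebius_holomorphic: "norm a < 1 \<Longrightarrow> disc_moebius a holomorphic_on ball 0 1"
  using holomorphic_on_minus[OF Moebius_function_holomorphic[of a 0]]
  by (simp add: disc_moebius_eq_Moebius[abs_def])

lemma one_minus_cnj_mult_nonzero: "norm a < 1 \<Longrightarrow> norm z < 1 \<Longrightarrow> 1 - cnj a * z \<noteq> 0"
  using norm_mult_less[of "cnj a" 1 z 1] by auto

lemma disc_moebius_involution:
  assumes "norm a < 1" "norm z < 1" shows "disc_moebius a (disc_moebius a z) = z"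
proof -
  have n: "1 - cnj a * z \<noteq> 0" "1 - cnj a * a \<noteq> 0"
    using one_minus_cnj_mult_nonzero assms by auto
  have "a - (a - z) / (1 - cnj a * z) = z * (1 - cnj a * a) / (1 - cnj a * z)"
    using n by (simp add: field_simps)
  moreover have "1 - cnj a * ((a - z) / (1 - cnj a * z)) = (1 - cnj a * a) / (1 - cnj a * z)"
    using n by (simp add: field_simps)
  ultimately show ?thesis using n by (simp add: disc_moebius_def)
qed

text \<open>Both sides are automorphisms of the disc vanishing at \<open>disc_moebius a w\<close>,
  so they differ by a unimodular factor. Composition thus moves the parameter of an atom and keeps
  the modulus of its coefficient.\<close>

lemma disc_moebius_compose:
  assumes "norm w < 1" "norm a < 1" "norm z < 1"
  shows "disc_moebius w (disc_moebius a z)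
    = - ((1 - w * cnj a) / (1 - cnj w * a)) * disc_moebius (disc_moebius a w) z"
proof -
  have n: "1 - cnj a * z \<noteq> 0" "1 - cnj w * a \<noteq> 0" "1 - cnj a * w \<noteq> 0"
    using one_minus_cnj_mult_nonzero assms by auto
  \<comment> \<open>Up to their individual denominators, \<open>A\<close> and \<open>B\<close> are
    the numerator and the denominator of both sides, so the quotients agree except for the constant
    factor.\<close>
  define A where "A = (w - a) + z * (1 - w * cnj a)"
  define B where "B = (1 - cnj w * a) - z * (cnj a - cnj w)"
  have r: "1 - w * cnj a \<noteq> 0" and s: "1 - a * cnj w \<noteq> 0" using n by (auto simp: mult.commute)
  have 1: "w - disc_moebius a z = A / (1 - cnj a * z)"
    using n by (simp add: disc_moebius_def A_def field_simps)
  have 2: "1 - cnj w * disc_moebius a z = B / (1 - cnj a * z)"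
    using n by (simp add: disc_moebius_def B_def field_simps)
  have 3: "disc_moebius a w - z = - A / (1 - w * cnj a)"
    using n r by (simp add: disc_moebius_def A_def field_simps)
  have 4: "1 - cnj (disc_moebius a w) * z = B / (1 - cnj w * a)"
    using s by (simp add: disc_moebius_def B_def field_simps)
  have "1 - cnj w * disc_moebius a z \<noteq> 0"
    using one_minus_cnj_mult_nonzero norm_disc_moebius_less assms by auto
  then have B0: "B \<noteq> 0" unfolding 2 by auto
  show ?thesis
    unfolding disc_moebius_def[of w "disc_moebius a z"] disc_moebius_def[of "disc_moebius a w" z] 1 2 3 4
    using n r B0 by simp
qed

lemma norm_moebius_factor: "norm a < 1 \<Longrightarrow> norm w < 1 \<Longrightarrow> norm ((1 - w * cnj a) / (1 - cnj w * a)) = 1"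
proof -
  assume a: "norm a < 1" "norm w < 1"
  have "1 - w * cnj a = cnj (1 - cnj w * a)" by simp
  then have "norm (1 - w * cnj a) = norm (1 - cnj w * a)" by (metis complex_mod_cnj)
  then show ?thesis using one_minus_cnj_mult_nonzero[of w a] a by (simp add: norm_divide)
qed

lemma catomic_bounded: "p \<in> ball 0 1 \<Longrightarrow> x \<in> ball 0 1 \<Longrightarrow> norm (disc_moebius p x) \<le> 1"
  using norm_disc_moebius_less[of p x] by simp

lemmas catomic_sums = atomic_le_sums[of disc_moebius "ball 0 1" "ball 0 1", OF _ _ _ catomic_bounded]
lemmas catomic_add = atomic_le_add[of disc_moebius "ball 0 1" "ball 0 1", OF _ _ _ catomic_bounded, simplified]
lemmas catomic_sum = atomic_le_sum[of _ disc_moebius "ball 0 1" "ball 0 1", OF _ _ catomic_bounded, simplified]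

text \<open>\<open>1 - cnj a * disc_moebius a z = (1 - |a|^2) / (1 - cnj a * z)\<close>, so the
  kernel is affine in the atom. The moduli of the two coefficients add up to
  \<open>(1 + |a|) / (1 - |a|^2) = 1 / (1 - |a|)\<close> times \<open>|g|\<close>.\<close>

lemma catomic_kernel:
  assumes a: "norm a < 1"
  shows "catomic (\<lambda>z. g / (1 - cnj a * z)) (norm g / (1 - norm a))"
proof -
  define d where "d = 1 - cnj a * a"
  have d: "d = of_real (1 - (norm a)\<^sup>2)" unfolding d_def using complex_norm_square[of a] by (simp add: mult.commute)
  have d0: "d \<noteq> 0" using one_minus_cnj_mult_nonzero[OF a a] by (simp add: d_def)
  have nd: "norm d = (1 - norm a) * (1 + norm a)"
    unfolding d norm_of_real using a by (simp add: power2_eq_square algebra_simps mult_le_one)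
  have "catomic (\<lambda>z. g / d + disc_moebius a z * (- (cnj a * g) / d)) (norm (g / d) + norm (- (cnj a * g) / d))"
    by (rule catomic_add[OF atomic_le_const atomic_le_single]) (use a in auto)
  also have "norm (g / d) + norm (- (cnj a * g) / d) = norm g / (1 - norm a)"
  proof -
    have "norm (g / d) + norm (- (cnj a * g) / d) = (norm g * (1 + norm a)) / ((1 - norm a) * (1 + norm a))"
      by (simp add: norm_divide norm_mult nd add_divide_distrib[symmetric] algebra_simps)
    moreover have "1 + norm a \<noteq> 0" using norm_ge_zero[of a] by linarith
    ultimately show ?thesis by simp
  qed
  finally show ?thesis
  proof (rule atomic_le_cong)
    fix z :: complex assume "z \<in> ball 0 1"
    then have "1 - cnj a * z \<noteq> 0" using one_minus_cnj_mult_nonzero a by auto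
    then show "g / d + disc_moebius a z * (- (cnj a * g) / d) = g / (1 - cnj a * z)"
      using d0 by (simp add: disc_moebius_def divide_simps) (simp add: d_def algebra_simps)
  qed
qed

section \<open>Cauchy's formula as a finite sum of kernels\<close>

lemma riemann_sum_norm_bound:
  fixes f :: "real \<Rightarrow> 'a::banach"
  assumes cont: "continuous_on {0..1} f" and N: "N > 0"
    and osc: "\<And>s t. s \<in> {0..1} \<Longrightarrow> t \<in> {0..1} \<Longrightarrow> \<bar>s - t\<bar> \<le> 1 / real N \<Longrightarrow> norm (f s - f t) \<le> e"
  shows "norm (integral {0..1} f - (1 / real N) *\<^sub>R (\<Sum>m<N. f (real m / real N))) \<le> e"
proof -
  \<comment> \<open>Comparing on the first \<open>k\<close> cells lets the error accumulate cell by
    cell, in proportion to the length covered.\<close>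
  have "norm (integral {0..real k / real N} f - (1 / real N) *\<^sub>R (\<Sum>m<k. f (real m / real N))) \<le> e * (k / N)"
    if "k \<le> N" for k
    using that
  proof (induction k)
    case (Suc k)
    let ?a = "real k / real N" let ?b = "real (Suc k) / real N"
    have ab: "0 \<le> ?a" "?a \<le> ?b" "?b \<le> 1" using Suc.prems N by (auto simp: divide_simps)
    have int: "f integrable_on {0..?b}" "f integrable_on {?a..?b}"
      using ab order_trans[OF ab(1)]
      by (auto intro!: integrable_continuous_interval intro: continuous_on_subset[OF cont] order_trans[OF ab(1)])
    have c: "integral {0..?b} f = integral {0..?a} f + integral {?a..?b} f"
      by (rule Henstock_Kurzweil_Integration.integral_combine[OF ab(1,2) int(1), symmetric])
    have "((\<lambda>t. f t - f ?a) has_integral (integral {?a..?b} f - (?b - ?a) *\<^sub>R f ?a)) {?a..?b}"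
      using has_integral_diff[OF integrable_integral[OF int(2)] has_integral_const_real[of "f ?a" ?a ?b]] ab
      by simp
    then have "norm (integral {?a..?b} f - (?b - ?a) *\<^sub>R f ?a) \<le> e * measure lborel {?a..?b}"
    proof (rule has_integral_bound_real[rotated 2])
      show "0 \<le> e" using osc[of 0 0] by simp
      fix x assume x: "x \<in> {?a..?b} - {}"
      then have x': "?a \<le> x" "x \<le> ?b" by simp_all
      have "?b - ?a = 1 / N" by (simp add: divide_simps algebra_simps)
      then have "\<bar>x - ?a\<bar> \<le> 1 / N" using x' by linarith
      moreover have "x \<in> {0..1}" using x' ab order_trans[OF ab(1) x'(1)] order_trans[OF x'(2) ab(3)] by simp
      moreover have "?a \<in> {0..1}" using ab order_trans[OF ab(2,3)] by simp
      ultimately show "norm (f x - f ?a) \<le> e" by (intro osc)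
    qed auto
    moreover have "measure lborel {?a..?b} = ?b - ?a" using ab by simp
    moreover have "?b - ?a = 1 / N" by (simp add: divide_simps algebra_simps)
    ultimately have 2: "norm (integral {?a..?b} f - (1 / N) *\<^sub>R f ?a) \<le> e * (1 / N)" by simp
    have "integral {0..?b} f - (1 / real N) *\<^sub>R (\<Sum>m<Suc k. f (real m / real N))
        = (integral {0..?a} f - (1 / real N) *\<^sub>R (\<Sum>m<k. f (real m / real N)))
          + (integral {?a..?b} f - (1 / N) *\<^sub>R f ?a)"
      by (simp add: c scaleR_add_right del: of_nat_Suc)
    also have "norm \<dots> \<le> e * (k / N) + e * (1 / N)"
      using Suc.IH Suc.prems 2 by (intro norm_triangle_mono) auto
    also have "\<dots> = e * (Suc k / N)" by (simp add: add_divide_distrib algebra_simps)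
    finally show ?case .
  qed simp
  from this[of N] show ?thesis using N by simp
qed

text \<open>On the circle \<open>u = S e\<close> with \<open>|e| = 1\<close> one has
  \<open>1 / e = cnj e\<close>, so \<open>du / (u - z)\<close> becomes
  \<open>2 pi i dt / (1 - cnj e z / S)\<close>: a kernel whose parameter \<open>e / S\<close> lies
  in the unit disc as soon as \<open>S > 1\<close>.\<close>

lemma cauchy_formula_cis:
  assumes h: "h holomorphic_on ball 0 R'" and S: "0 < S" "S < R'" and z: "norm z < S"
  shows "integral {0..1} (\<lambda>t. h (S * cis (2*pi*t)) / (1 - cnj (cis (2*pi*t)) * z / S)) = h z"
proof -
  have "((\<lambda>u. h u / (u - z)) has_contour_integral (2 * of_real pi * \<i> * h z)) (circlepath 0 S)"
    by (rule Cauchy_integral_circlepath_simple)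
      (use S z in \<open>auto intro!: holomorphic_on_subset[OF h]\<close>)
  then have "((\<lambda>t. h (circlepath 0 S t) / (circlepath 0 S t - z)
      * vector_derivative (circlepath 0 S) (at t within {0..1})) has_integral (2 * of_real pi * \<i> * h z)) {0..1}"
    by (simp add: has_contour_integral_def)
  then have "((\<lambda>t. (2 * of_real pi * \<i>) * (h (S * cis (2*pi*t)) / (1 - cnj (cis (2*pi*t)) * z / S))) has_integral (2 * of_real pi * \<i> * h z)) {0..1}"
  proof (rule has_integral_eq[rotated])
    fix t :: real assume t: "t \<in> {0..1}"
    then have t0: "0 \<le> t" and t1: "t \<le> 1" by auto
    define u where "u = cis (2*pi*t)"
    have u: "exp (2 * of_real pi * \<i> * of_real t) = u"
      by (simp add: u_def cis_conv_exp mult_ac)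
    have "norm u = 1" by (simp add: u_def)
    then have cu: "cnj u * u = 1" and u0: "u \<noteq> 0"
      using complex_norm_square[of u] by (auto simp: mult.commute)
    have ne: "S * u - z \<noteq> 0" using z S \<open>norm u = 1\<close> by (auto simp: norm_mult)
    have "(1 - cnj u * z / S) * (S * u) = S * u - (cnj u * u) * z" using S by (simp add: field_simps)
    then have "S * u - z = (1 - cnj u * z / S) * (S * u)" by (simp add: cu)
    then have "h (S * u) / (1 - cnj u * z / S) = h (S * u) / (S * u - z) * (S * u)"
      using S u0 by simp
    then show "h (circlepath 0 S t) / (circlepath 0 S t - z) * vector_derivative (circlepath 0 S) (at t within {0..1})
       = (2 * of_real pi * \<i>) * (h (S * cis (2*pi*t)) / (1 - cnj (cis (2*pi*t)) * z / S))"
      using t unfolding vector_derivative_circlepath01[OF t0 t1] by (simp add: circlepath u u_def[symmetric])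
  qed
  from has_integral_mult_right[OF this, of "1 / (2 * of_real pi * \<i>)"]
  show ?thesis by (simp add: integral_unique)
qed

text \<open>The left Riemann sum with \<open>N\<close> nodes of the integral in
  \<open>cauchy_formula_cis\<close>, each summand in the form treated by
  \<open>catomic_kernel\<close>.\<close>

definition cauchy_sum :: "(complex \<Rightarrow> complex) \<Rightarrow> real \<Rightarrow> nat \<Rightarrow> complex \<Rightarrow> complex" where
  "cauchy_sum h S N z = (\<Sum>m<N. of_real (1 / real N) * h (S * cis (2*pi*(real m / real N))) / (1 - cnj (cis (2*pi*(real m / real N)) / S) * z))"

lemma cauchy_sum_holomorphic:
  assumes "0 < S" shows "cauchy_sum h S N holomorphic_on ball 0 S"
proof -
  have "1 - cnj (cis t / S) * z \<noteq> 0" if "norm z < S" for t z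
  proof
    assume "1 - cnj (cis t / S) * z = 0"
    then have "norm (cnj (cis t / S) * z) = 1" by (simp flip: eq_iff_diff_eq_0)
    then show False using that assms by (simp add: norm_mult norm_divide)
  qed
  then show ?thesis unfolding cauchy_sum_def[abs_def] by (intro holomorphic_intros) auto
qed

text \<open>All parameters have modulus \<open>1 / S\<close>, so every kernel contributes the same
  factor \<open>1 / (1 - 1/S) = S / (S - 1)\<close>; the rest is a Riemann sum of
  \<open>|h|\<close>.\<close>

lemma catomic_cauchy_sum:
  assumes S: "S > 1"
  shows "catomic (cauchy_sum h S N) (S / (S - 1) * (1 / N * (\<Sum>m<N. norm (h (S * cis (2*pi*(real m / real N)))))))"
proof -
  have "catomic (cauchy_sum h S N)
     (\<Sum>m<N. norm (of_real (1 / real N) * h (S * cis (2*pi*(real m / real N)))) / (1 - norm (cis (2*pi*(real m / real N)) / S)))"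
    unfolding cauchy_sum_def
    by (rule catomic_sum[OF catomic_kernel]) (use S in \<open>auto simp: norm_divide\<close>)
  also have "(\<Sum>m<N. norm (of_real (1 / real N) * h (S * cis (2*pi*(real m / real N)))) / (1 - norm (cis (2*pi*(real m / real N)) / S)))
     = (S / (S - 1) * (1 / N * (\<Sum>m<N. norm (h (S * cis (2*pi*(real m / real N)))))))"
    unfolding sum_distrib_left using S by (intro sum.cong) (auto simp: norm_divide norm_mult field_simps)
  finally show ?thesis .
qed

text \<open>The integrand is uniformly continuous on the compact set
  \<open>cball 0 r \<times> {0..1}\<close>, which avoids the poles on \<open>|z| = S\<close>.
  Uniformity up to a radius \<open>r > 1\<close> is what later makes the remainder atomic.\<close>

lemma cauchy_sum_uniform:
  assumes h: "h holomorphic_on ball 0 R'" and S: "0 < S" "S < R'" and r: "r < S" and e: "e > 0"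
  shows "\<exists>N0>0. \<forall>N\<ge>N0. \<forall>z\<in>cball 0 r. norm (h z - cauchy_sum h S N z) \<le> e"
proof -
  define G where "G = (\<lambda>(z, t). h (S * cis (2*pi*t)) / (1 - cnj (cis (2*pi*t)) * z / S))"
  have c1: "continuous_on (cball 0 r \<times> {0..1}) (\<lambda>x::complex \<times> real. h (S * cis (2*pi * snd x)))"
    by (rule continuous_on_compose2[OF holomorphic_on_imp_continuous_on[OF h]])
      (use S in \<open>auto intro!: continuous_intros simp: norm_mult\<close>)
  have ne: "1 - cnj (cis t) * z / S \<noteq> 0" if "norm z \<le> r" for t z
  proof
    assume "1 - cnj (cis t) * z / S = 0"
    then have "norm (cnj (cis t) * z / S) = 1" by (simp flip: eq_iff_diff_eq_0)
    then show False using that S r by (simp add: norm_mult norm_divide)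
  qed
  have contG: "continuous_on (cball 0 r \<times> {0..1}) G"
    unfolding G_def case_prod_unfold
    by (intro continuous_on_divide c1 continuous_intros) (use S ne in auto)
  have "uniformly_continuous_on (cball 0 r \<times> {0..1}) G"
    by (rule compact_uniformly_continuous[OF contG]) (auto intro: compact_Times)
  then obtain d where d: "d > 0" "\<And>x x'. x \<in> cball 0 r \<times> {0..1} \<Longrightarrow> x' \<in> cball 0 r \<times> {0..1} \<Longrightarrow>
      dist x' x < d \<Longrightarrow> dist (G x') (G x) < e"
    using e unfolding uniformly_continuous_on_def by metis
  obtain N0 :: nat where N0: "N0 > 0" "1 / real N0 < d"
    using d(1) by (metis nat_approx_posE of_nat_0_less_iff zero_less_Suc)
  show ?thesis
  proof (intro exI[of _ N0] conjI allI impI ballI N0(1))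
    fix N z assume N: "N \<ge> N0" and z: "z \<in> cball (0::complex) r"
    have "1 / real N \<le> 1 / real N0" using N N0(1) by (simp add: frac_le)
    then have Nd: "1 / real N < d" using N0(2) by linarith
    have cz: "continuous_on {0..1} (\<lambda>t. G (z, t))"
      by (rule continuous_on_compose2[OF contG]) (use z in \<open>auto intro!: continuous_intros\<close>)
    have "norm (integral {0..1} (\<lambda>t. G (z, t)) - (1 / real N) *\<^sub>R (\<Sum>m<N. G (z, m / N))) \<le> e"
    proof (rule riemann_sum_norm_bound[OF cz])
      show "0 < N" using N N0 by simp
      fix s t :: real assume "s \<in> {0..1}" "t \<in> {0..1}" "\<bar>s - t\<bar> \<le> 1 / real N"
      then show "norm (G (z, s) - G (z, t)) \<le> e"
        using d(2)[of "(z, t)" "(z, s)"] z Nd by (simp add: dist_Pair_Pair dist_norm)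
    qed
    moreover have "integral {0..1} (\<lambda>t. G (z, t)) = h z"
      unfolding G_def using cauchy_formula_cis[OF h S] z r by simp
    moreover have "(1 / real N) *\<^sub>R (\<Sum>m<N. G (z, m / N)) = cauchy_sum h S N z"
      by (simp add: cauchy_sum_def G_def scaleR_conv_of_real sum_distrib_left)
    ultimately show "norm (h z - cauchy_sum h S N z) \<le> e" by simp
  qed
qed


text \<open>Subtract Cauchy sums on circles whose radii decrease to \<open>1 + (R - 1) / 2\<close>, halving the error each
  time; the costs then form a geometric series.\<close>

lemma catomic_holomorphic_bounded:
  assumes R: "R > 1" and B: "B > 0" and h: "h holomorphic_on ball 0 R"
    and hB: "\<And>z. z \<in> ball 0 R \<Longrightarrow> norm (h z) \<le> B"
  shows "catomic h (4 * R / (R - 1) * B)"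
proof -
  \<comment> \<open>The radii start at \<open>r 0 = R\<close> and stay above
    \<open>1 + (R - 1) / 2\<close>, which keeps \<open>S - 1\<close> away from 0 and makes
    \<open>K\<close> a common bound for all factors \<open>S / (S - 1)\<close>.\<close>
  define r where "r m = 1 + (R - 1) * (1/2 + (1/2) ^ Suc m)" for m
  define K where "K = 2 * R / (R - 1)"
  have r0: "r 0 = R" by (simp add: r_def field_simps)
  have r_lower: "1 + (R - 1) / 2 < r m" for m using R by (simp add: r_def field_simps)
  have r_dec: "r (Suc m) < r m" for m using R by (simp add: r_def)
  have r_upper: "r m \<le> R" for m
  proof (induction m)
    case (Suc m) then show ?case using r_dec[of m] by simp
  qed (simp add: r0)
  \<comment> \<open>The choice principle yields only properties of the sequence, so the clause for
    \<open>m = 0\<close> records that it starts at \<open>h\<close>.\<close>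
  define P where "P m g \<longleftrightarrow> (m = 0 \<longrightarrow> g = h) \<and> g holomorphic_on ball 0 (r m) \<and> (\<forall>z\<in>ball 0 (r m). norm (g z) \<le> B / 2 ^ m)" for m g
  define Q where "Q m g g' \<longleftrightarrow> catomic (\<lambda>z. g z - g' z) (K * (B / 2 ^ m))" for m and g g' :: "complex \<Rightarrow> complex"
  have "\<exists>F. \<forall>m. P m (F m) \<and> Q m (F m) (F (Suc m))"
  proof (rule dependent_nat_choice)
    show "\<exists>g. P 0 g" using h hB r0 by (auto simp: P_def)
    fix g m assume P: "P m g"
    then have g: "g holomorphic_on ball 0 (r m)" and gB: "\<And>z. z \<in> ball 0 (r m) \<Longrightarrow> norm (g z) \<le> B / 2 ^ m"
      by (auto simp: P_def)
    \<comment> \<open>This circle lies inside the ball where \<open>g\<close> is holomorphic and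
      outside the next, smaller ball, where the remainder has to be small.\<close>
    define S where "S = (r m + r (Suc m)) / 2"
    have S: "r (Suc m) < S" "S < r m" using r_dec[of m] by (auto simp: S_def)
    have S1: "S - 1 \<ge> (R - 1) / 2" using S r_lower[of "Suc m"] by linarith
    have S0: "S > 1" using S1 R by (simp add: field_simps)
    have SR: "S \<le> R" using S r_upper[of m] by linarith
    obtain N where N: "N > 0" "\<And>z. z \<in> cball 0 (r (Suc m)) \<Longrightarrow> norm (g z - cauchy_sum g S N z) \<le> B / 2 ^ Suc m"
      using cauchy_sum_uniform[OF g, of S "r (Suc m)" "B / 2 ^ Suc m"] S S0 B by (metis divide_pos_pos le_refl less_trans zero_less_numeral zero_less_one zero_less_power)
    define g' where "g' z = g z - cauchy_sum g S N z" for z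
    have "P (Suc m) g'"
      unfolding P_def
    proof (intro conjI ballI)
      show "g' holomorphic_on ball 0 (r (Suc m))"
        unfolding g'_def[abs_def]
        by (intro holomorphic_on_diff holomorphic_on_subset[OF g] holomorphic_on_subset[OF cauchy_sum_holomorphic[of S]])
          (use S S0 in auto)
    qed (use N(2) in \<open>auto simp: g'_def\<close>)
    moreover have "Q m g g'"
      unfolding Q_def
    proof (rule atomic_le_mono[OF atomic_le_cong[OF catomic_cauchy_sum[OF S0, of g N]]])
      have "(\<Sum>m<N. norm (g (S * cis (2*pi*(real m / real N))))) \<le> (\<Sum>m'<N. B / 2 ^ m)"
        by (rule sum_mono, rule gB) (use S S0 in \<open>auto simp: norm_mult\<close>)
      then have "1 / N * (\<Sum>m<N. norm (g (S * cis (2*pi*(real m / real N))))) \<le> B / 2 ^ m"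
        using N(1) by (simp add: field_simps)
      moreover have "S / (S - 1) \<le> R / ((R - 1) / 2)"
        using S1 SR S0 R by (intro frac_le) auto
      moreover have "R / ((R - 1) / 2) = K" by (simp add: K_def)
      moreover have "0 \<le> K" using R by (simp add: K_def)
      moreover have "0 \<le> 1 / N * (\<Sum>m<N. norm (g (S * cis (2*pi*(real m / real N)))))"
        by (intro mult_nonneg_nonneg sum_nonneg) auto
      ultimately show "S / (S - 1) * (1 / N * (\<Sum>m<N. norm (g (S * cis (2*pi*(real m / real N)))))) \<le> K * (B / 2 ^ m)"
        by (intro mult_mono) (simp_all only:)
    qed (simp add: g'_def)
    ultimately show "\<exists>g'. P (Suc m) g' \<and> Q m g g'" by blast
  qed
  then obtain F where P: "\<And>m. P m (F m)" and Q: "\<And>m. Q m (F m) (F (Suc m))" by blast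
  have F0: "F 0 = h" using P[of 0] by (simp add: P_def)
  have geo: "(\<lambda>m. K * (B / 2 ^ m)) sums (K * (B * 2))"
    using sums_mult[OF sums_mult[OF geometric_sums[of "1/2::real"], of B], of K] by (simp add: power_divide)
  have "catomic h (suminf (\<lambda>m. K * (B / 2 ^ m)))"
  proof (rule catomic_sums[where f = "\<lambda>m z. F m z - F (Suc m) z"])
    show "catomic (\<lambda>z. F m z - F (Suc m) z) (K * (B / 2 ^ m))" for m using Q[of m] by (simp add: Q_def)
    show "summable (\<lambda>m. K * (B / 2 ^ m))" using geo by (rule sums_summable)
    fix z :: complex assume z: "z \<in> ball 0 1"
    have "norm (F m z) \<le> B * (1/2) ^ m" for m
    proof -
      have "z \<in> ball 0 (r m)" using z r_lower[of m] R by (simp, smt (verit) divide_nonneg_pos)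
      then show ?thesis using P[of m] by (simp add: P_def power_divide)
    qed
    moreover have "(\<lambda>m. B * (1/2) ^ m) \<longlonglongrightarrow> 0"
      by (intro tendsto_mult_right_zero LIMSEQ_realpow_zero) auto
    ultimately have "(\<lambda>m. F m z) \<longlonglongrightarrow> 0"
      by (intro Lim_null_comparison[of "\<lambda>m. F m z"]) auto
    from telescope_sums'[OF this] show "(\<lambda>m. F m z - F (Suc m) z) sums h z" by (simp add: F0)
  qed
  also have "suminf (\<lambda>m. K * (B / 2 ^ m)) = 4 * R / (R - 1) * B" using geo by (simp add: sums_iff K_def)
  finally show ?thesis .
qed

text \<open>One fine Cauchy sum on \<open>|z| = S\<close> carries almost all of \<open>h\<close> at
  the cost of the mean of \<open>|h|\<close>; the remainder is uniformly small up to a radius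
  \<open>r > 1\<close>, where the estimate by the supremum is affordable. A mean over a circle,
  unlike a supremum, can be integrated up to an area integral.\<close>

lemma catomic_circle_mean:
  assumes h: "h holomorphic_on ball 0 R" and S: "1 < S" "S < R" and e: "e > 0"
  shows "catomic h (S / (S - 1) * integral {0..1} (\<lambda>t. norm (h (S * cis (2*pi*t)))) + e)"
proof -
  define r where "r = (1 + S) / 2"
  have r: "1 < r" "r < S" using S by (auto simp: r_def)
  define K where "K = 4 * r / (r - 1)"
  have K: "K > 0" using r by (simp add: K_def)
  obtain N1 where N1: "\<And>N z. N \<ge> N1 \<Longrightarrow> z \<in> cball 0 r \<Longrightarrow> norm (h z - cauchy_sum h S N z) \<le> e / (2 * K)"
    using cauchy_sum_uniform[OF h, of S r "e / (2 * K)"] S r e K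
    by (metis divide_pos_pos less_trans mult_pos_pos zero_less_numeral zero_less_one)
  define f where "f t = norm (h (S * cis (2*pi*t)))" for t
  have cf: "continuous_on {0..1} f"
    unfolding f_def by (intro continuous_on_norm continuous_on_compose2[OF holomorphic_on_imp_continuous_on[OF h]])
      (use S in \<open>auto intro!: continuous_intros simp: norm_mult\<close>)
  \<comment> \<open>Chosen with \<open>S / (S - 1) * e' = e / 2\<close>; the remainder, bounded by
    \<open>e / (2 * K)\<close>, costs the other half.\<close>
  define e' where "e' = e * (S - 1) / (2 * S)"
  have e': "e' > 0" using e S by (simp add: e'_def)
  have "uniformly_continuous_on {0..1} f" by (rule compact_uniformly_continuous[OF cf]) simp
  then obtain d where d: "d > 0" "\<And>x x'. x \<in> {0..1} \<Longrightarrow> x' \<in> {0..1} \<Longrightarrow> dist x' x < d \<Longrightarrow> dist (f x') (f x) < e'"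
    using e' unfolding uniformly_continuous_on_def by metis
  obtain N2 :: nat where N2: "N2 > 0" "1 / real N2 < d"
    using d(1) by (metis nat_approx_posE of_nat_0_less_iff zero_less_Suc)
  define N where "N = max N1 N2"
  have N: "N \<ge> N1" "N > 0" using N2(1) by (auto simp: N_def)
  have "1 / real N \<le> 1 / real N2" using N2(1) by (intro frac_le) (auto simp: N_def)
  then have Nd: "1 / real N < d" using N2(2) by linarith
  have "norm (integral {0..1} f - (1 / real N) *\<^sub>R (\<Sum>m<N. f (real m / real N))) \<le> e'"
  proof (rule riemann_sum_norm_bound[OF cf N(2)])
    fix s t :: real assume "s \<in> {0..1}" "t \<in> {0..1}" "\<bar>s - t\<bar> \<le> 1 / real N"
    then show "norm (f s - f t) \<le> e'"
      using d(2)[of t s] Nd by (simp add: dist_norm)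
  qed
  then have mean: "1 / real N * (\<Sum>m<N. f (real m / real N)) \<le> integral {0..1} f + e'" by (simp add: abs_le_iff)
  have 1: "catomic (cauchy_sum h S N) (S / (S - 1) * (integral {0..1} f + e'))"
    by (rule atomic_le_mono[OF catomic_cauchy_sum[OF S(1)]])
      (use mean S in \<open>auto simp: f_def intro!: mult_left_mono simp del: times_divide_eq_left\<close>)
  have 2: "catomic (\<lambda>z. h z - cauchy_sum h S N z) (4 * r / (r - 1) * (e / (2 * K)))"
    by (rule catomic_holomorphic_bounded[OF r(1)])
      (use e K r S N1[OF N(1)] in \<open>auto intro!: holomorphic_on_diff holomorphic_on_subset[OF h] holomorphic_on_subset[OF cauchy_sum_holomorphic[of S]]\<close>)
  have "catomic h (S / (S - 1) * (integral {0..1} f + e') + 4 * r / (r - 1) * (e / (2 * K)))"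
    by (rule atomic_le_cong[OF catomic_add[OF 1 2]]) simp
  also have "S / (S - 1) * (integral {0..1} f + e') + 4 * r / (r - 1) * (e / (2 * K)) = S / (S - 1) * integral {0..1} f + e"
  proof -
    have "S / (S - 1) * e' = e / 2" using S by (simp add: e'_def field_simps)
    moreover have "4 * r / (r - 1) * (e / (2 * K)) = e / 2" using K unfolding K_def[symmetric] by simp
    ultimately show ?thesis by (simp add: distrib_left)
  qed
  finally show ?thesis unfolding f_def .
qed

section \<open>Polar coordinates in the plane\<close>

lemma measurable_Complex [measurable (raw)]:
  assumes [measurable]: "f \<in> borel_measurable M" "g \<in> borel_measurable M"
  shows "(\<lambda>x. Complex (f x) (g x)) \<in> borel_measurable M"
  unfolding Complex_eq by measurable

lemma lborel_complex_eq_distr: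
  "(lborel :: complex measure) = distr (lborel \<Otimes>\<^sub>M lborel) borel (\<lambda>(x, y). Complex x y)"
proof (rule lborel_eqI)
  fix l u :: complex
  assume le: "\<And>b. b \<in> Basis \<Longrightarrow> l \<bullet> b \<le> u \<bullet> b"
  then have le': "Re l \<le> Re u" "Im l \<le> Im u" using le[of 1] le[of \<i>] by (auto simp: Basis_complex_def)
  have "(\<lambda>(x, y). Complex x y) -` box l u \<inter> space (lborel \<Otimes>\<^sub>M lborel) = {Re l<..<Re u} \<times> {Im l<..<Im u}"
    by (auto simp: box_def Basis_complex_def space_pair_measure)
  then have "emeasure (distr (lborel \<Otimes>\<^sub>M lborel) borel (\<lambda>(x, y). Complex x y)) (box l u)
      = emeasure (lborel \<Otimes>\<^sub>M lborel) ({Re l<..<Re u} \<times> {Im l<..<Im u})"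
    by (subst emeasure_distr) auto
  also have "\<dots> = ennreal (Re u - Re l) * ennreal (Im u - Im l)"
    using le' by (subst lborel.emeasure_pair_measure_Times) auto
  also have "\<dots> = ennreal (\<Prod>b\<in>Basis. (u - l) \<bullet> b)"
    using le' by (simp add: Basis_complex_def ennreal_mult)
  finally show "emeasure (distr (lborel \<Otimes>\<^sub>M lborel) borel (\<lambda>(x, y). Complex x y)) (box l u) = (\<Prod>b\<in>Basis. (u - l) \<bullet> b)" .
qed simp

lemma nn_integral_complex_iterated:
  assumes [measurable]: "g \<in> borel_measurable borel"
  shows "(\<integral>\<^sup>+z. g z \<partial>lborel) = (\<integral>\<^sup>+x. \<integral>\<^sup>+y. g (Complex x y) \<partial>lborel \<partial>lborel)"
  by (subst lborel_complex_eq_distr, subst nn_integral_distr)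
    (auto simp: case_prod_unfold lborel.nn_integral_fst[symmetric])

text \<open>A quarter turn exchanges the coordinates and reflects one of them, so Tonelli and a
  one-dimensional substitution suffice. Four such copies of the sector of half-angle
  \<open>pi/4\<close> cover the plane.\<close>

lemma nn_integral_complex_rotate:
  fixes g :: "complex \<Rightarrow> ennreal"
  assumes [measurable]: "g \<in> borel_measurable borel"
  shows "(\<integral>\<^sup>+z. g (\<i> * z) \<partial>lborel) = (\<integral>\<^sup>+z. g z \<partial>lborel)"
proof -
  have "(\<integral>\<^sup>+z. g (\<i> * z) \<partial>lborel) = (\<integral>\<^sup>+x. \<integral>\<^sup>+y. g (Complex (- y) x) \<partial>lborel \<partial>lborel)"
  proof -
    have "\<i> * Complex x y = Complex (- y) x" for x y by (simp add: complex_eq_iff)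
    then show ?thesis by (subst nn_integral_complex_iterated) auto
  qed
  also have "\<dots> = (\<integral>\<^sup>+x. \<integral>\<^sup>+y. g (Complex y x) \<partial>lborel \<partial>lborel)"
  proof (rule nn_integral_cong)
    fix x :: real
    have "(\<integral>\<^sup>+y. g (Complex y x) \<partial>lborel) = ennreal \<bar>- 1\<bar> * (\<integral>\<^sup>+y. g (Complex (0 + (- 1) * y) x) \<partial>lborel)"
      by (rule nn_integral_real_affine) auto
    then show "(\<integral>\<^sup>+y. g (Complex (- y) x) \<partial>lborel) = (\<integral>\<^sup>+y. g (Complex y x) \<partial>lborel)" by simp
  qed
  also have "\<dots> = (\<integral>\<^sup>+x. \<integral>\<^sup>+y. g (Complex x y) \<partial>lborel \<partial>lborel)"
    by (rule lborel_pair.Fubini'[symmetric]) measurable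
  also have "\<dots> = (\<integral>\<^sup>+z. g z \<partial>lborel)" by (rule nn_integral_complex_iterated[symmetric]) simp
  finally show ?thesis .
qed

lemma cos_ge_half_of_sector: "\<theta> \<in> {-pi/4..pi/4} \<Longrightarrow> cos \<theta> \<ge> 1/2"
proof -
  assume "\<theta> \<in> {-pi/4..pi/4}"
  then have "\<bar>\<theta>\<bar> \<le> pi / 4" by auto
  then have "cos (pi / 3) \<le> cos \<bar>\<theta>\<bar>" by (intro cos_monotone_0_pi_le) auto
  then show ?thesis by (simp add: cos_60)
qed

text \<open>Substitute \<open>x = s cos \<theta>\<close>, exchange the integrals, and substitute \<open>y = x tan \<theta>\<close>; on the annulus
  all Jacobians are bounded. Rotations by \<open>\<i>\<close> cover the other sectors.\<close>

lemma nn_integral_polar_sector: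
  fixes g :: "complex \<Rightarrow> ennreal"
  assumes [measurable]: "g \<in> borel_measurable borel"
  shows "(\<integral>\<^sup>+\<theta>. (\<integral>\<^sup>+s. g (of_real s * cis \<theta>) * indicator {1/2..1} s \<partial>lborel) * indicator {-pi/4..pi/4} \<theta> \<partial>lborel)
    \<le> 8 * (\<integral>\<^sup>+z. g z \<partial>lborel)"
proof -
  \<comment> \<open>\<open>?h\<close> bounds the integrand after \<open>x = s cos \<theta>\<close>:
    as \<open>cos \<theta> \<ge> 1/2\<close>, the range \<open>s \<ge> 1/2\<close> gives
    \<open>x \<ge> 1/4\<close>, and 2 bounds \<open>1 / cos \<theta>\<close>. \<open>?k\<close>
    carries the Jacobian \<open>x / (cos \<theta>)^2\<close> of \<open>y = x tan \<theta>\<close>,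
    which is at least \<open>1/4\<close>; hence the factor 8.\<close>
  let ?h = "\<lambda>x \<theta>. 2 * g (Complex x (x * tan \<theta>)) * indicator {1/4..1} x * indicator {-pi/4..pi/4} \<theta>"
  let ?k = "\<lambda>x \<theta>. g (Complex x (x * tan \<theta>)) * ennreal (x * inverse ((cos \<theta>)\<^sup>2)) * indicator {-pi/4..pi/4} \<theta>"
  have [measurable]: "tan \<in> borel_measurable (borel :: real measure)" unfolding tan_def by measurable
  have "(\<integral>\<^sup>+s. g (of_real s * cis \<theta>) * indicator {1/2..1} s \<partial>lborel) * indicator {-pi/4..pi/4} \<theta>
     \<le> (\<integral>\<^sup>+x. ?h x \<theta> \<partial>lborel)" for \<theta>
  proof (cases "\<theta> \<in> {-pi/4..pi/4}")
    case True
    then have c: "cos \<theta> \<ge> 1/2" by (rule cos_ge_half_of_sector)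
    have "(\<integral>\<^sup>+s. g (of_real s * cis \<theta>) * indicator {1/2..1} s \<partial>lborel)
       = ennreal \<bar>1 / cos \<theta>\<bar> * (\<integral>\<^sup>+x. g (of_real (0 + 1 / cos \<theta> * x) * cis \<theta>) * indicator {1/2..1} (0 + 1 / cos \<theta> * x) \<partial>lborel)"
      by (rule nn_integral_real_affine) (use c in auto)
    also have "\<dots> \<le> ennreal 2 * (\<integral>\<^sup>+x. g (Complex x (x * tan \<theta>)) * indicator {1/4..1} x \<partial>lborel)"
    proof (rule mult_mono[OF ennreal_leI nn_integral_mono])
      show "\<bar>1 / cos \<theta>\<bar> \<le> 2" using c by (simp add: field_simps abs_if)
      fix x :: real
      have e: "of_real (0 + 1 / cos \<theta> * x) * cis \<theta> = Complex x (x * tan \<theta>)"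
        using c by (auto simp: complex_eq_iff tan_def)
      have "x \<in> {1/4..1}" if h: "0 + 1 / cos \<theta> * x \<in> {1/2..1}"
      proof -
        have "cos \<theta> * (1/2) \<le> x" "x \<le> cos \<theta> * 1" using h c by (auto simp: field_simps)
        then show ?thesis using c order_trans[OF _ cos_le_one[of \<theta>]] by auto
      qed
      then show "g (of_real (0 + 1 / cos \<theta> * x) * cis \<theta>) * indicator {1/2..1} (0 + 1 / cos \<theta> * x)
         \<le> g (Complex x (x * tan \<theta>)) * indicator {1/4..1} x"
        unfolding e by (intro mult_left_mono) (auto simp: indicator_def)
    qed auto
    also have "\<dots> = (\<integral>\<^sup>+x. 2 * g (Complex x (x * tan \<theta>)) * indicator {1/4..1} x \<partial>lborel)"
      by (subst nn_integral_cmult[symmetric]) (auto simp: mult_ac)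
    finally show ?thesis using True by simp
  qed simp
  then have "(\<integral>\<^sup>+\<theta>. (\<integral>\<^sup>+s. g (of_real s * cis \<theta>) * indicator {1/2..1} s \<partial>lborel) * indicator {-pi/4..pi/4} \<theta> \<partial>lborel)
    \<le> (\<integral>\<^sup>+\<theta>. \<integral>\<^sup>+x. ?h x \<theta> \<partial>lborel \<partial>lborel)"
    by (intro nn_integral_mono) auto
  also have "\<dots> = (\<integral>\<^sup>+x. \<integral>\<^sup>+\<theta>. ?h x \<theta> \<partial>lborel \<partial>lborel)"
    by (rule lborel_pair.Fubini') measurable
  also have "\<dots> \<le> (\<integral>\<^sup>+x. 8 * (\<integral>\<^sup>+y. g (Complex x y) \<partial>lborel) \<partial>lborel)"
  proof (rule nn_integral_mono)
    fix x :: real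
    show "(\<integral>\<^sup>+\<theta>. ?h x \<theta> \<partial>lborel)
       \<le> 8 * (\<integral>\<^sup>+y. g (Complex x y) \<partial>lborel)"
    proof (cases "x \<in> {1/4..1}")
      case True
      have nz: "cos \<theta> \<noteq> 0" if "\<theta> \<in> {-pi/4..pi/4}" for \<theta> using cos_ge_half_of_sector[OF that] by auto
      have "(\<integral>\<^sup>+\<theta>. ?h x \<theta> \<partial>lborel)
        \<le> (\<integral>\<^sup>+\<theta>. 8 * (?k x \<theta>) \<partial>lborel)"
      proof (rule nn_integral_mono)
        fix \<theta>
        have "ennreal 2 \<le> ennreal (8 * (x * inverse ((cos \<theta>)\<^sup>2)))" if "\<theta> \<in> {-pi/4..pi/4}"
        proof (rule ennreal_leI)
          have "(cos \<theta>)\<^sup>2 \<le> 1" "(cos \<theta>)\<^sup>2 > 0" using nz[OF that] by (auto simp: abs_square_le_1)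
          then have "1 \<le> inverse ((cos \<theta>)\<^sup>2)" by (simp add: one_le_inverse)
          then have "1/4 * 1 \<le> x * inverse ((cos \<theta>)\<^sup>2)" using True by (intro mult_mono) auto
          then show "2 \<le> 8 * (x * inverse ((cos \<theta>)\<^sup>2))" by simp
        qed
        then have "2 * g (Complex x (x * tan \<theta>)) \<le> 8 * (g (Complex x (x * tan \<theta>)) * ennreal (x * inverse ((cos \<theta>)\<^sup>2)))"
          if "\<theta> \<in> {-pi/4..pi/4}"
          using mult_right_mono[of "ennreal 2" "ennreal (8 * (x * inverse ((cos \<theta>)\<^sup>2)))" "g (Complex x (x * tan \<theta>))"] that True
          by (simp add: ennreal_mult mult_ac)
        then show "?h x \<theta>
          \<le> 8 * (?k x \<theta>)"
          using True by (auto simp: indicator_def)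
      qed
      also have "\<dots> = 8 * (\<integral>\<^sup>+\<theta>. ?k x \<theta> \<partial>lborel)"
        by (rule nn_integral_cmult) measurable
      also have "(\<integral>\<^sup>+\<theta>. ?k x \<theta> \<partial>lborel)
        = (\<integral>\<^sup>+y. g (Complex x y) * indicator {x * tan (-pi/4)..x * tan (pi/4)} y \<partial>lborel)"
      proof (rule nn_integral_substitution_aux[symmetric])
        show "((\<lambda>\<theta>. x * tan \<theta>) has_real_derivative x * inverse ((cos \<theta>)\<^sup>2)) (at \<theta>)" if "\<theta> \<in> {-pi/4..pi/4}" for \<theta>
          by (intro DERIV_cmult DERIV_tan nz that)
        show "continuous_on {-pi/4..pi/4} (\<lambda>\<theta>. x * inverse ((cos \<theta>)\<^sup>2))"
          by (intro continuous_intros) (use nz in auto)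
      qed (use True in auto)
      also have "\<dots> \<le> (\<integral>\<^sup>+y. g (Complex x y) \<partial>lborel)"
        by (intro nn_integral_mono) (auto simp: indicator_def)
      finally show ?thesis by (simp add: mult_left_mono)
    qed simp
  qed
  also have "\<dots> = 8 * (\<integral>\<^sup>+z. g z \<partial>lborel)"
    by (subst nn_integral_cmult) (auto simp: nn_integral_complex_iterated)
  finally show ?thesis .
qed

text \<open>The radial factor \<open>s\<close> of the area element is missing on the left; on this
  annulus it is at least \<open>1/2\<close>, so its omission is paid for by a constant.\<close>

lemma nn_integral_polar_annulus:
  fixes g :: "complex \<Rightarrow> ennreal"
  assumes [measurable]: "g \<in> borel_measurable borel"
  shows "(\<integral>\<^sup>+t. (\<integral>\<^sup>+s. g (of_real s * cis (2*pi*t)) * indicator {1/2..1} s \<partial>lborel) * indicator {0..1} t \<partial>lborel)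
    \<le> 40 * (\<integral>\<^sup>+z. g z \<partial>lborel)"
proof -
  \<comment> \<open>In the variable \<open>t = \<theta> / (2 * pi)\<close> a sector has half-width
    \<open>1/8\<close>. Five windows are taken because the one around 0 meets the unit interval in
    only half its length and the other half reappears around 1; this gives
    \<open>40 = 5 * 8\<close>.\<close>
  let ?C = "\<lambda>k::nat. {real k / 4 - 1/8..real k / 4 + 1/8}"
  define H where "H t = (\<integral>\<^sup>+s. g (of_real s * cis (2*pi*t)) * indicator {1/2..1} s \<partial>lborel)" for t
  have [measurable]: "cis \<in> borel_measurable borel"
    by (intro borel_measurable_continuous_onI continuous_intros)
  have [measurable]: "H \<in> borel_measurable borel" unfolding H_def by measurable
  have sector: "(\<integral>\<^sup>+t. H t * indicator (?C k) t \<partial>lborel) \<le> 8 * (\<integral>\<^sup>+z. g z \<partial>lborel)" for k :: nat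
  proof -
    have rot: "(\<integral>\<^sup>+z. g (\<i> ^ k * z) \<partial>lborel) = (\<integral>\<^sup>+z. g z \<partial>lborel)"
    proof (induction k)
      case (Suc k)
      then show ?case using nn_integral_complex_rotate[of "\<lambda>z. g (\<i> ^ k * z)"] by (simp add: mult_ac)
    qed simp
    have ik: "cis (2*pi*(k/4 + t)) = \<i> ^ k * cis (2*pi*t)" for t
    proof -
      have "2*pi*(k/4 + t) = real k * (pi/2) + 2*pi*t" by (simp add: field_simps)
      then have "cis (2*pi*(k/4 + t)) = cis (pi/2) ^ k * cis (2*pi*t)"
        by (simp only: cis_mult Complex.DeMoivre)
      then show ?thesis by simp
    qed
    have "(\<integral>\<^sup>+t. H t * indicator (?C k) t \<partial>lborel)
      = ennreal \<bar>1 / (2*pi)\<bar> * (\<integral>\<^sup>+\<theta>. H (k/4 + 1 / (2*pi) * \<theta>) * indicator (?C k) (k/4 + 1 / (2*pi) * \<theta>) \<partial>lborel)"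
      by (rule nn_integral_real_affine) auto
    also have "\<dots> \<le> 1 * (\<integral>\<^sup>+\<theta>. H (k/4 + 1 / (2*pi) * \<theta>) * indicator (?C k) (k/4 + 1 / (2*pi) * \<theta>) \<partial>lborel)"
    proof (rule mult_right_mono)
      have "\<bar>1 / (2*pi)\<bar> \<le> 1" using pi_ge_two by simp
      then show "ennreal \<bar>1 / (2*pi)\<bar> \<le> 1" by (simp add: ennreal_le_1)
    qed simp
    also have "\<dots> = (\<integral>\<^sup>+\<theta>. (\<integral>\<^sup>+s. g (\<i> ^ k * (of_real s * cis \<theta>)) * indicator {1/2..1} s \<partial>lborel) * indicator {-pi/4..pi/4} \<theta> \<partial>lborel)"
      unfolding mult_1
    proof (rule nn_integral_cong)
      fix \<theta> :: real
      have "k/4 + 1 / (2*pi) * \<theta> \<in> ?C k \<longleftrightarrow> \<theta> \<in> {-pi/4..pi/4}"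
        by (auto simp: field_simps)
      moreover have "H (k/4 + 1 / (2*pi) * \<theta>) = (\<integral>\<^sup>+s. g (\<i> ^ k * (of_real s * cis \<theta>)) * indicator {1/2..1} s \<partial>lborel)"
        unfolding H_def ik by (simp add: mult_ac)
      ultimately show "H (k/4 + 1 / (2*pi) * \<theta>) * indicator (?C k) (k/4 + 1 / (2*pi) * \<theta>)
        = (\<integral>\<^sup>+s. g (\<i> ^ k * (of_real s * cis \<theta>)) * indicator {1/2..1} s \<partial>lborel) * indicator {-pi/4..pi/4} \<theta>"
        by (simp add: indicator_def)
    qed
    also have "\<dots> \<le> 8 * (\<integral>\<^sup>+z. g (\<i> ^ k * z) \<partial>lborel)"
      by (rule nn_integral_polar_sector) measurable
    finally show ?thesis by (simp add: rot)
  qed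
  have "(\<integral>\<^sup>+t. H t * indicator {0..1} t \<partial>lborel)
     \<le> (\<integral>\<^sup>+t. (\<Sum>k<5::nat. H t * indicator (?C k) t) \<partial>lborel)"
  proof (rule nn_integral_mono)
    fix t :: real
    have "indicator {0..1} t \<le> (\<Sum>k<5::nat. indicator (?C k) t :: ennreal)"
      by (auto simp: eval_nat_numeral indicator_def)
    then show "H t * indicator {0..1} t \<le> (\<Sum>k<5::nat. H t * indicator (?C k) t)"
      by (subst sum_distrib_left[symmetric]) (rule mult_left_mono, auto)
  qed
  also have "\<dots> = (\<Sum>k<5::nat. \<integral>\<^sup>+t. H t * indicator (?C k) t \<partial>lborel)"
    by (rule nn_integral_sum) measurable
  also have "\<dots> \<le> (\<Sum>k<5::nat. 8 * (\<integral>\<^sup>+z. g z \<partial>lborel))" by (rule sum_mono, rule sector)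
  also have "\<dots> = 40 * (\<integral>\<^sup>+z. g z \<partial>lborel)" by (simp flip: mult.assoc)
  finally show ?thesis by (simp add: H_def)
qed

section \<open>Atomic decomposition in the disc\<close>

text \<open>The Taylor polynomial of degree below \<open>n\<close> of \<open>F\<close> at the point
  \<open>t * z\<close>, evaluated at \<open>z = t * z + (1 - t) * z\<close>.\<close>

definition slid_taylor :: "nat \<Rightarrow> (complex \<Rightarrow> complex) \<Rightarrow> real \<Rightarrow> complex \<Rightarrow> complex" where
  "slid_taylor n F t z = (\<Sum>l<n. of_real ((1 - t) ^ l / fact l) * z ^ l * (deriv ^^ l) F (of_real t * z))"

definition slid_deriv :: "nat \<Rightarrow> (complex \<Rightarrow> complex) \<Rightarrow> real \<Rightarrow> complex \<Rightarrow> complex" where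
  "slid_deriv n F t z = of_real ((1 - t) ^ (n - 1) / fact (n - 1)) * z ^ n * (deriv ^^ n) F (of_real t * z)"

text \<open>Differentiating the power of \<open>1 - t\<close> in one term cancels the derivative of
  the factor \<open>F^(l)\<close> in the preceding term, so only the contribution of the last term
  survives.\<close>

lemma has_vector_derivative_slid_taylor:
  assumes F: "F holomorphic_on ball 0 1" and z: "norm (of_real t * z) < 1" and n: "n > 0"
  shows "((\<lambda>t. slid_taylor n F t z) has_vector_derivative slid_deriv n F t z) (at t)"
proof -
  have D: "((\<lambda>t. (deriv ^^ l) F (of_real t * z)) has_vector_derivative z * (deriv ^^ Suc l) F (of_real t * z)) (at t)" for l
  proof -
    have 1: "((\<lambda>t. of_real t * z) has_vector_derivative z) (at t)"
      by (auto intro!: derivative_eq_intros)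
    have "((deriv ^^ l) F has_field_derivative (deriv ^^ Suc l) F (of_real t * z)) (at (of_real t * z))"
      using has_field_derivative_higher_deriv[OF F] z by simp
    from field_vector_diff_chain_at[OF 1 this] show ?thesis by (simp add: o_def)
  qed
  show ?thesis using n
  proof (induction n rule: nat_induct_non_zero)
    case 1
    then show ?case using D[of 0] by (simp add: slid_taylor_def slid_deriv_def)
  next
    case (Suc n)
    have P: "((\<lambda>t. complex_of_real ((1 - t) ^ n / fact n)) has_vector_derivative
        - of_real ((1 - t) ^ (n - 1) / fact (n - 1))) (at t)"
    proof -
      have "((\<lambda>t. (1 - t) ^ n / fact n) has_real_derivative - (n * (1 - t) ^ (n - 1) / fact n)) (at t)"
        by (auto intro!: derivative_eq_intros)
      moreover have "n * (1 - t) ^ (n - 1) / fact n = (1 - t) ^ (n - 1) / fact (n - 1)"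
        using Suc.hyps by (simp add: fact_reduce)
      ultimately have "((\<lambda>t. (1 - t) ^ n / fact n) has_real_derivative - ((1 - t) ^ (n - 1) / fact (n - 1))) (at t)"
        by (simp only:)
      from has_vector_derivative_of_real[OF this] show ?thesis unfolding of_real_minus .
    qed
    have eq: "(\<lambda>t. slid_taylor (Suc n) F t z) = (\<lambda>t. slid_taylor n F t z
        + complex_of_real ((1 - t) ^ n / fact n) * z ^ n * (deriv ^^ n) F (of_real t * z))"
      by (simp only: slid_taylor_def sum.lessThan_Suc)
    have alg: "p * (z * w) * D1 = q * w * D0 + (p * w * (z * D1) + - q * w * D0)" for p q w D0 D1
      by (simp add: algebra_simps)
    have "slid_deriv (Suc n) F t z = slid_deriv n F t z + (complex_of_real ((1 - t) ^ n / fact n) * z ^ n * (z * (deriv ^^ Suc n) F (of_real t * z))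
        + - of_real ((1 - t) ^ (n - 1) / fact (n - 1)) * z ^ n * (deriv ^^ n) F (of_real t * z))"
      unfolding slid_deriv_def diff_Suc_1 power_Suc[of z] by (rule alg)
    then show ?case unfolding eq
      using has_vector_derivative_add[OF Suc.IH has_vector_derivative_mult[OF has_vector_derivative_mult_left[OF P, of "z ^ n"] D[of n]]]
      by (simp only:)
  qed
qed

lemma slid_taylor_holomorphic:
  assumes F: "F holomorphic_on ball 0 1" and t: "0 < t"
  shows "slid_taylor n F t holomorphic_on ball 0 (1 / t)"
proof -
  have "((deriv ^^ l) F \<circ> (\<lambda>z. of_real t * z)) holomorphic_on ball 0 (1 / t)" for l
  proof (rule holomorphic_on_compose_gen[OF _ holomorphic_higher_deriv[OF F open_ball]])
    show "(*) (complex_of_real t) ` ball 0 (1 / t) \<subseteq> ball 0 1"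
      using t by (auto simp: norm_mult field_simps)
  qed (intro holomorphic_intros)
  then show ?thesis unfolding slid_taylor_def[abs_def] by (intro holomorphic_intros) (simp add: o_def)
qed

lemma slid_taylor_diff:
  assumes F: "F holomorphic_on ball 0 1" and z: "norm (of_real b * z) < 1" and n: "n > 0" and ab: "0 \<le> a" "a \<le> b"
  shows "((\<lambda>t. slid_deriv n F t z) has_integral (slid_taylor n F b z - slid_taylor n F a z)) {a..b}"
proof (rule fundamental_theorem_of_calculus[OF ab(2)])
  fix t assume t: "t \<in> {a..b}"
  have "norm (of_real t * z) \<le> norm (of_real b * z)"
    unfolding norm_mult using t ab by (intro mult_right_mono) auto
  then show "((\<lambda>t. slid_taylor n F t z) has_vector_derivative slid_deriv n F t z) (at t within {a..b})"
    by (rule has_vector_derivative_at_within[OF has_vector_derivative_slid_taylor[OF F le_less_trans[OF _ z] n]])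
qed

text \<open>The exponent \<open>n - 2\<close> is what the hyperbolic density
  \<open>(1 - |z|^2)^-2\<close> leaves of \<open>(1 - |z|^2)^n\<close>.\<close>

definition besov_weight :: "nat \<Rightarrow> (complex \<Rightarrow> complex) \<Rightarrow> complex \<Rightarrow> real" where
  "besov_weight n F z = (1 - (norm z)\<^sup>2) ^ (n - 2) * norm ((deriv ^^ n) F z)"

lemma besov_weight_nonneg: "norm z \<le> 1 \<Longrightarrow> 0 \<le> besov_weight n F z"
  unfolding besov_weight_def by (simp add: power_le_one)

lemma borel_measurable_besov_weight:
  assumes F: "F holomorphic_on ball 0 1"
  shows "(\<lambda>z. ennreal (besov_weight n F z) * indicator (ball 0 1) z) \<in> borel_measurable borel"
proof -
  have "continuous_on (ball 0 1) (besov_weight n F)"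
    unfolding besov_weight_def[abs_def]
    by (intro continuous_intros holomorphic_on_imp_continuous_on holomorphic_higher_deriv F open_ball)
  then have "(\<lambda>z. indicator (ball 0 1) z *\<^sub>R besov_weight n F z) \<in> borel_measurable borel"
    by (rule borel_measurable_continuous_on_indicator[rotated]) simp
  then have "(\<lambda>z. ennreal (indicator (ball 0 1) z *\<^sub>R besov_weight n F z)) \<in> borel_measurable borel"
    by simp
  also have "(\<lambda>z. ennreal (indicator (ball 0 1) z *\<^sub>R besov_weight n F z))
     = (\<lambda>z. ennreal (besov_weight n F z) * indicator (ball 0 1) z)"
    by (auto simp: indicator_def fun_eq_iff)
  finally show ?thesis .
qed

text \<open>The radius \<open>S\<close> is chosen such that \<open>S t\<close> stays in \<open>[1 - d, 1 - d/4]\<close> for \<open>t\<close> in \<open>[1 - d, 1 - d/2]\<close>.\<close>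

context
  fixes F :: "complex \<Rightarrow> complex" and n :: nat and d S :: real
  assumes F: "F holomorphic_on ball 0 1" and n: "n \<ge> 2" and d: "0 < d" "d \<le> 1/2"
  defines "S \<equiv> (1 - d/4) / (1 - d/2)"
begin

lemma S_props: "1 < S" "S \<le> 2" "S < 1 / (1 - d/2)" "S * (1 - d/2) = 1 - d/4" "1 - d \<le> S * (1 - d)" "d / 4 \<le> S - 1"
proof -
  have p: "1 - d/2 > 0" using d by simp
  show 1: "1 < S" "S \<le> 2" "S < 1 / (1 - d/2)" "S * (1 - d/2) = 1 - d/4"
    using p d unfolding S_def
    by (simp_all add: less_divide_eq divide_le_eq divide_strict_right_mono)
  show "1 - d \<le> S * (1 - d)" using 1(1) d by simp
  have "S - 1 = (d/4) / (1 - d/2)" using p by (simp add: S_def divide_simps)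
  also have "\<dots> \<ge> (d/4) / 1" using p d by (intro divide_left_mono) auto
  finally show "d / 4 \<le> S - 1" by simp
qed

text \<open>This is where the Besov weight appears. \<open>S / (S - 1) \<le> 8 / d\<close> uses up
  one power of \<open>d^(n-1)\<close>; at radius \<open>S * u \<le> 1 - d/4\<close> the remaining
  \<open>d^(n-2)\<close> is at most \<open>4^(n-2)\<close> times the weight factor, and
  \<open>S^n \<le> 2^n\<close>.\<close>

lemma slid_deriv_bound:
  assumes u: "u \<in> {1 - d..1 - d/2}" and e: "norm e = 1"
  shows "S / (S - 1) * norm (slid_deriv n F u (of_real S * e)) \<le> 2 * 8 ^ n * besov_weight n F (of_real (S * u) * e)"
proof -
  let ?B = "besov_weight n F (of_real (S * u) * e)"
  let ?q = "1 - (norm (of_real (S * u) * e))\<^sup>2"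
  note S = S_props
  have u': "1 - u \<le> d" "0 \<le> 1 - u" "0 \<le> u" using u d by auto
  have Su: "0 \<le> S * u" "S * u \<le> 1 - d/4"
  proof -
    show "0 \<le> S * u" using u' S(1) by simp
    have "S * u \<le> S * (1 - d/2)" using u S(1) by (intro mult_left_mono) auto
    then show "S * u \<le> 1 - d/4" using S(4) by simp
  qed
  let ?D = "norm ((deriv ^^ n) F (of_real (S * u) * e))"
  have nn: "norm (of_real (S * u) * e) = S * u"
    unfolding norm_mult[of _ e] norm_of_real e using Su(1) by (simp only: abs_of_nonneg mult_1_right)
  have "norm (slid_deriv n F u (of_real S * e)) = (1 - u) ^ (n - 1) / fact (n - 1) * S ^ n * ?D"
    using u' S(1) e by (simp add: slid_deriv_def norm_mult norm_divide norm_power mult_ac del: of_real_diff of_real_mult of_real_divide of_real_power)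
      (simp add: norm_power abs_of_nonneg mult_ac)
  also have "\<dots> \<le> d ^ (n - 1) * 2 ^ n * ?D"
  proof (intro mult_right_mono mult_mono power_mono)
    have "(1 - u) ^ (n - 1) / fact (n - 1) \<le> (1 - u) ^ (n - 1) / 1"
      using u' by (intro divide_left_mono) auto
    also have "\<dots> \<le> d ^ (n - 1)" using u' by (simp add: power_mono)
    finally show "(1 - u) ^ (n - 1) / fact (n - 1) \<le> d ^ (n - 1)" .
  qed (use S u' d in auto)
  finally have 1: "norm (slid_deriv n F u (of_real S * e)) \<le> d ^ (n - 1) * 2 ^ n * ?D" .
  have 2: "S / (S - 1) \<le> 8 / d"
  proof -
    have "S / (S - 1) \<le> 2 / (d/4)" using S d by (intro frac_le) auto
    then show ?thesis by simp
  qed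
  have "S / (S - 1) * norm (slid_deriv n F u (of_real S * e)) \<le> (8 / d) * (d ^ (n - 1) * 2 ^ n * ?D)"
    using 1 2 S d by (intro mult_mono) auto
  also have "d ^ (n - 1) = d * d ^ (n - 2)"
  proof -
    have "n - 1 = Suc (n - 2)" using n by simp
    then show ?thesis by simp
  qed
  also have "(8 / d) * (d * d ^ (n - 2) * 2 ^ n * ?D) = 8 * 2 ^ n * (4 ^ (n - 2) * (d/4) ^ (n - 2)) * ?D"
    using d by (simp flip: power_mult_distrib)
  also have "\<dots> \<le> 8 * 2 ^ n * (4 ^ (n - 2) * ?q ^ (n - 2)) * ?D"
  proof (intro mult_right_mono mult_left_mono power_mono)
    have "(S * u)\<^sup>2 \<le> S * u" using Su d by (simp add: power2_eq_square mult_left_le_one_le)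
    then show "d/4 \<le> 1 - (norm (of_real (S * u) * e))\<^sup>2" unfolding nn using Su by simp
  qed (use d in auto)
  also have "8 * 2 ^ n * (4 ^ (n - 2) * ?q ^ (n - 2)) * ?D
     = (8 * 2 ^ n * 4 ^ (n - 2)) * ?B"
    by (simp add: besov_weight_def)
  also have "\<dots> \<le> (2 * 8 ^ n) * ?B"
  proof (intro mult_right_mono besov_weight_nonneg)
    have "8 * 2 ^ n * 4 ^ (n - 2) \<le> 2 * 2 ^ n * (4 ^ 2 * 4 ^ (n - 2) :: real)" by simp
    also have "4 ^ 2 * 4 ^ (n - 2) = (4 ^ n :: real)"
      unfolding power_add[symmetric] le_add_diff_inverse[OF n] ..
    also have "2 * 2 ^ n * 4 ^ n = (2 * 8 ^ n :: real)" by (simp flip: power_mult_distrib)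
    finally show "8 * 2 ^ n * 4 ^ (n - 2) \<le> (2 * 8 ^ n :: real)" .
    show "norm (of_real (S * u) * e) \<le> 1" unfolding nn using Su d by simp
  qed
  finally show ?thesis .
qed

text \<open>On a fixed ray the increment is the integral of \<open>slid_deriv\<close> in
  \<open>u\<close>; the substitution \<open>s = S * u\<close> turns the bound into a radial integral
  inside the disc. Its Jacobian \<open>S\<close> exceeds 1 and may be inserted on the larger
  side.\<close>

lemma slid_taylor_increment_bound:
  assumes e: "norm e = 1"
  shows "ennreal (S / (S - 1) * norm (slid_taylor n F (1 - d/2) (of_real S * e) - slid_taylor n F (1 - d) (of_real S * e)))
    \<le> 2 * 8 ^ n * (\<integral>\<^sup>+s. ennreal (besov_weight n F (of_real s * e)) * indicator (ball 0 1) (of_real s * e)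
         * indicator {1 - d..1 - d/4} s \<partial>lborel)"
proof -
  note S = S_props
  have nS: "norm (of_real (1 - d/2) * (of_real S * e)) < 1"
  proof -
    have "norm (of_real (1 - d/2) * (of_real S * e)) = S * (1 - d/2)"
      using d S(1) e by (simp add: norm_mult abs_of_nonneg del: of_real_diff of_real_divide)
    then show ?thesis using S(4) d by simp
  qed
  let ?h = "slid_taylor n F (1 - d/2) (of_real S * e) - slid_taylor n F (1 - d) (of_real S * e)"
  let ?q = "\<lambda>u. slid_deriv n F u (of_real S * e)"
  let ?w = "\<lambda>s. ennreal (besov_weight n F (of_real s * e)) * indicator (ball 0 1) (of_real s * e) * indicator {1 - d..1 - d/4} s"
  let ?b = "\<lambda>u. besov_weight n F (of_real (S * u) * e)"
  have hi: "(?q has_integral ?h) {1 - d..1 - d/2}"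
    by (rule slid_taylor_diff[OF F nS]) (use n d in auto)
  have lt: "norm (of_real (S * u) * e) < 1" if "u \<in> {1 - d..1 - d/2}" for u
  proof -
    have "0 \<le> S * u" using that d S(1) by simp
    moreover have "S * u \<le> S * (1 - d/2)" using that S(1) by (intro mult_left_mono) auto
    ultimately show ?thesis
      unfolding norm_mult[of _ e] norm_of_real e using S(4) d by (simp only: abs_of_nonneg mult_1_right)
  qed
  have cont: "continuous_on {1 - d..1 - d/2} ?b"
  proof -
    have "continuous_on {1 - d..1 - d/2} (\<lambda>u. (deriv ^^ n) F (of_real (S * u) * e))"
      by (rule continuous_on_compose2[OF holomorphic_on_imp_continuous_on[OF holomorphic_higher_deriv[OF F open_ball]]])
        (use lt in \<open>auto intro!: continuous_intros\<close>)
    then show ?thesis unfolding besov_weight_def by (intro continuous_intros)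
  qed
  have hb: "(?b has_integral integral {1 - d..1 - d/2} ?b) {1 - d..1 - d/2}"
    using cont by (intro integrable_integral integrable_continuous_interval)
  have "norm (of_real (S / (S - 1)) * ?h) \<le> 2 * 8 ^ n * integral {1 - d..1 - d/2} ?b"
  proof -
    have 1: "((\<lambda>u. of_real (S / (S - 1)) * ?q u) has_integral of_real (S / (S - 1)) * ?h) {1 - d..1 - d/2}"
      by (rule has_integral_mult_right[OF hi])
    have 2: "((\<lambda>u. 2 * 8 ^ n * ?b u) has_integral 2 * 8 ^ n * integral {1 - d..1 - d/2} ?b) {1 - d..1 - d/2}"
      by (rule has_integral_mult_right[OF hb])
    have "norm (integral {1 - d..1 - d/2} (\<lambda>u. of_real (S / (S - 1)) * ?q u)) \<le> integral {1 - d..1 - d/2} (\<lambda>u. 2 * 8 ^ n * ?b u)"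
    proof (rule Henstock_Kurzweil_Integration.integral_norm_bound_integral)
      fix u assume u: "u \<in> {1 - d..1 - d/2}"
      have "norm (of_real (S / (S - 1)) * ?q u) = S / (S - 1) * norm (?q u)"
        using S(1) unfolding norm_mult norm_of_real by simp
      then show "norm (of_real (S / (S - 1)) * ?q u) \<le> 2 * 8 ^ n * ?b u"
        using slid_deriv_bound[OF u e] by simp
    qed (use 1 2 in \<open>auto simp: has_integral_integrable\<close>)
    then show ?thesis unfolding integral_unique[OF 1] integral_unique[OF 2] .
  qed
  moreover have "norm (of_real (S / (S - 1)) * ?h) = S / (S - 1) * norm ?h"
    using S(1) unfolding norm_mult norm_of_real by simp
  ultimately have "ennreal (S / (S - 1) * norm ?h) \<le> ennreal (2 * 8 ^ n * integral {1 - d..1 - d/2} ?b)"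
    by (intro ennreal_leI) simp
  also have "\<dots> = 2 * 8 ^ n * ennreal (integral {1 - d..1 - d/2} ?b)"
    by (simp add: ennreal_mult' ennreal_power[symmetric] del: ennreal_power)
  finally have le1: "ennreal (S / (S - 1) * norm ?h) \<le> 2 * 8 ^ n * ennreal (integral {1 - d..1 - d/2} ?b)" .
  have "ennreal (integral {1 - d..1 - d/2} ?b) = (\<integral>\<^sup>+u. ennreal (?b u) * indicator {1 - d..1 - d/2} u \<partial>lborel)"
    by (rule nn_integral_has_integral_lebesgue'[symmetric, OF _ hb])
      (rule besov_weight_nonneg[OF less_imp_le[OF lt]])
  also have "\<dots> \<le> ennreal \<bar>S\<bar> * (\<integral>\<^sup>+u. ?w (0 + S * u) \<partial>lborel)"
  proof -
    have "(\<integral>\<^sup>+u. ennreal (?b u) * indicator {1 - d..1 - d/2} u \<partial>lborel) \<le> 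
      1 * (\<integral>\<^sup>+u. ?w (0 + S * u) \<partial>lborel)"
      unfolding mult_1
    proof (rule nn_integral_mono)
      fix u :: real
      have "S * u \<in> {1 - d..1 - d/4}" if u: "u \<in> {1 - d..1 - d/2}"
      proof -
        have "S * (1 - d) \<le> S * u" "S * u \<le> S * (1 - d/2)" using u S(1) by (auto intro: mult_left_mono)
        then show ?thesis using S(4,5) by auto
      qed
      then show "ennreal (?b u) * indicator {1 - d..1 - d/2} u \<le> ?w (0 + S * u)"
        using lt[of u] by (auto simp: indicator_def)
    qed
    also have "\<dots> \<le> ennreal \<bar>S\<bar> * (\<integral>\<^sup>+u. ?w (0 + S * u) \<partial>lborel)"
      using S(1) by (intro mult_right_mono) auto
    finally show ?thesis .
  qed
  also have "\<dots> = (\<integral>\<^sup>+s. ennreal (besov_weight n F (of_real s * e)) * indicator (ball 0 1) (of_real s * e) * indicator {1 - d..1 - d/4} s \<partial>lborel)"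
  proof (rule nn_integral_real_affine[symmetric])
    note [measurable] = borel_measurable_besov_weight[OF F, of n]
    have "(\<lambda>s. (\<lambda>z. ennreal (besov_weight n F z) * indicator (ball 0 1) z) (of_real s * e)) \<in> borel_measurable borel"
      by measurable
    then show "(\<lambda>s. ennreal (besov_weight n F (of_real s * e)) * indicator (ball 0 1) (of_real s * e) * indicator {1 - d..1 - d/4} s) \<in> borel_measurable borel"
      by measurable
  qed (use S in auto)
  finally show ?thesis by (rule order_trans[OF le1 mult_left_mono[OF _ zero_le]])
qed

end

text \<open>Averages the bound for single rays over all directions; the quantity bounded is the main
  cost in \<open>catomic_circle_mean\<close>.\<close>

lemma slid_taylor_increment_mean_bound:
  fixes d S :: real
  assumes F: "F holomorphic_on ball 0 1" and n: "n \<ge> 2" and d: "0 < d" "d \<le> 1/2"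
    and S: "S = (1 - d/4) / (1 - d/2)"
    and h: "h = (\<lambda>z. slid_taylor n F (1 - d/2) z - slid_taylor n F (1 - d) z)"
  shows "h holomorphic_on ball 0 (1 / (1 - d/2))"
    and "ennreal (S / (S - 1) * integral {0..1} (\<lambda>t. norm (h (of_real S * cis (2*pi*t)))))
      \<le> 2 * 8 ^ n * (\<integral>\<^sup>+t. (\<integral>\<^sup>+s. ennreal (besov_weight n F (of_real s * cis (2*pi*t))) * indicator (ball 0 1) (of_real s * cis (2*pi*t))
         * indicator {1 - d..1 - d/4} s \<partial>lborel) * indicator {0..1} t \<partial>lborel)"
proof -
  let ?J = "\<lambda>t. \<integral>\<^sup>+s. ennreal (besov_weight n F (of_real s * cis (2*pi*t))) * indicator (ball 0 1) (of_real s * cis (2*pi*t))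
         * indicator {1 - d..1 - d/4} s \<partial>lborel"
  note P = S_props[OF F n d, folded S]
  show hol: "h holomorphic_on ball 0 (1 / (1 - d/2))"
    unfolding h
  proof (intro holomorphic_on_diff)
    show "slid_taylor n F (1 - d/2) holomorphic_on ball 0 (1 / (1 - d/2))"
      by (rule slid_taylor_holomorphic[OF F]) (use d in auto)
    have "1 / (1 - d/2) \<le> 1 / (1 - d)" using d by (intro divide_left_mono) auto
    then show "slid_taylor n F (1 - d) holomorphic_on ball 0 (1 / (1 - d/2))"
      by (intro holomorphic_on_subset[OF slid_taylor_holomorphic[OF F, of "1 - d"]] subset_ball) (use d in auto)
  qed
  let ?g = "\<lambda>t. norm (h (of_real S * cis (2*pi*t)))"
  have "continuous_on {0..1} ?g"
    by (intro continuous_on_norm continuous_on_compose2[OF holomorphic_on_imp_continuous_on[OF hol]])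
      (use P in \<open>auto intro!: continuous_intros simp: norm_mult\<close>)
  then have "(?g has_integral integral {0..1} ?g) {0..1}"
    by (intro integrable_integral integrable_continuous_interval)
  then have "((\<lambda>t. S / (S - 1) * ?g t) has_integral S / (S - 1) * integral {0..1} ?g) {0..1}"
    by (rule has_integral_mult_right)
  then have "ennreal (S / (S - 1) * integral {0..1} ?g) = (\<integral>\<^sup>+t. ennreal (S / (S - 1) * ?g t) * indicator {0..1} t \<partial>lborel)"
    by (intro nn_integral_has_integral_lebesgue'[symmetric]) (use P in auto)
  also have "\<dots> \<le> (\<integral>\<^sup>+t. 2 * 8 ^ n * (?J t * indicator {0..1} t) \<partial>lborel)"
    unfolding mult.assoc[symmetric] h
    by (intro nn_integral_mono mult_right_mono slid_taylor_increment_bound[OF F n d, folded S, unfolded mult.assoc[symmetric]]) auto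
  also have "\<dots> = 2 * 8 ^ n * (\<integral>\<^sup>+t. ?J t * indicator {0..1} t \<partial>lborel)"
  proof (rule nn_integral_cmult)
    note [measurable] = borel_measurable_besov_weight[OF F, of n]
    have [measurable]: "cis \<in> borel_measurable borel"
      by (intro borel_measurable_continuous_onI continuous_intros)
    have [measurable]: "(\<lambda>x. (\<lambda>z. ennreal (besov_weight n F z) * indicator (ball 0 1) z) (of_real (snd x) * cis (2*pi*fst x)))
       \<in> borel_measurable (borel \<Otimes>\<^sub>M lborel)"
      by measurable
    show "(\<lambda>t. ?J t * indicator {0..1} t) \<in> borel_measurable lborel"
      by (simp add: case_prod_unfold) measurable
  qed
  finally show "ennreal (S / (S - 1) * integral {0..1} ?g) \<le> 2 * 8 ^ n * (\<integral>\<^sup>+t. ?J t * indicator {0..1} t \<partial>lborel)" .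
qed

lemma sum_indicator_consecutive_le:
  fixes r :: "nat \<Rightarrow> real"
  assumes "strict_mono r"
  shows "(\<Sum>k<K. indicator {r k..r (Suc k)} s :: ennreal) \<le> 2"
proof -
  \<comment> \<open>The induction needs the sharper count at the end: the point \<open>r K\<close>
    has so far been met by at most one interval, and points beyond it by none.\<close>
  have "(\<Sum>k<K. indicator {r k..r (Suc k)} s :: ennreal) \<le> (if s < r K then 2 else if s = r K then 1 else 0)"
  proof (induction K)
    case (Suc K)
    have "r K < r (Suc K)" using assms by (simp add: strict_mono_def)
    then show ?case using Suc.IH by (auto simp: indicator_def split: if_splits)
      (auto intro: order_trans[OF add_right_mono] simp: one_add_one[symmetric] simp del: one_add_one)
  qed auto
  then show ?thesis by (auto split: if_splits intro: order_trans)
qed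

theorem catomic_of_finite_besov_weight:
  assumes F: "F holomorphic_on ball 0 1" and n: "n \<ge> 2"
    and fin: "(\<integral>\<^sup>+z. ennreal (besov_weight n F z) * indicator (ball 0 1) z \<partial>lborel) < \<infinity>"
  shows "\<exists>c. catomic F c"
proof -
  \<comment> \<open>With \<open>t = 1 - d k\<close> the steps begin at \<open>t = 1/2\<close>, and
    \<open>d k / 2 = d (Suc k)\<close> makes consecutive increments telescope.\<close>
  define d where "d k = (1/2::real) ^ Suc k" for k
  have d: "0 < d k" "d k \<le> 1/2" for k by (auto simp: d_def power_le_one)
  have d2: "d k / 2 = d (Suc k)" "d k / 4 = d (Suc (Suc k))" for k by (auto simp: d_def)
  define S where "S k = (1 - d k/4) / (1 - d k/2)" for k
  define h where "h k z = slid_taylor n F (1 - d k/2) z - slid_taylor n F (1 - d k) z" for k z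
  have h': "h k = (\<lambda>z. slid_taylor n F (1 - d k/2) z - slid_taylor n F (1 - d k) z)" for k by (simp add: h_def fun_eq_iff)
  define c where "c k = S k / (S k - 1) * integral {0..1} (\<lambda>t. norm (h k (of_real (S k) * cis (2*pi*t))))" for k
  note P = S_props[OF F n d, folded S_def]
  note Q = slid_taylor_increment_mean_bound[OF F n d S_def h', folded c_def]
  let ?W = "\<lambda>z. ennreal (besov_weight n F z) * indicator (ball 0 1) z"
  let ?J = "\<lambda>a b t. \<integral>\<^sup>+s. ?W (of_real s * cis (2*pi*t)) * indicator {a..b} s \<partial>lborel"
  have c0: "0 \<le> c k" for k
  proof -
    have "0 \<le> integral {0..1} (\<lambda>t. norm (h k (of_real (S k) * cis (2*pi*t))))"
      by (cases "(\<lambda>t. norm (h k (of_real (S k) * cis (2*pi*t)))) integrable_on {0..1}")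
        (auto intro: Henstock_Kurzweil_Integration.integral_nonneg simp: not_integrable_integral)
    then show ?thesis unfolding c_def using P(1)[of k] by (intro mult_nonneg_nonneg) auto
  qed
  \<comment> \<open>The allowance \<open>(1/2) ^ k\<close> for the approximation error keeps the
    total cost summable.\<close>
  have at: "catomic (h k) (c k + (1/2) ^ k)" for k
    unfolding c_def by (rule catomic_circle_mean[OF Q(1)]) (use P in auto)
  have sm: "strict_mono (\<lambda>k. 1 - d k)"
    by (rule strict_monoI_Suc) (use d in \<open>simp flip: d2(1)\<close>)
  \<comment> \<open>Each interval \<open>{1 - d k..1 - d k/4}\<close> is the union of two
    consecutive dyadic intervals, and at most two closed dyadic intervals contain a given
    \<open>s\<close>; hence \<open>2 + 2\<close>.\<close>
  have ov: "(\<Sum>k<K. indicator {1 - d k..1 - d k/4} s :: ennreal) \<le> 4" for K s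
  proof -
    let ?J = "\<lambda>k. indicator {1 - d k..1 - d (Suc k)} s :: ennreal"
    have "(\<Sum>k<K. indicator {1 - d k..1 - d k/4} s :: ennreal) \<le> (\<Sum>k<K. ?J k + ?J (Suc k))"
      by (intro sum_mono) (auto simp: indicator_def d2)
    also have "\<dots> = (\<Sum>k<K. ?J k) + (\<Sum>k\<in>Suc ` {..<K}. ?J k)"
      by (simp add: sum.distrib sum.reindex)
    also have "(\<Sum>k\<in>Suc ` {..<K}. ?J k) \<le> (\<Sum>k<Suc K. ?J k)"
      by (intro sum_mono2) auto
    also have "(\<Sum>k<K. ?J k) + (\<Sum>k<Suc K. ?J k) \<le> 2 + 2"
      by (intro add_mono sum_indicator_consecutive_le[OF sm])
    finally show ?thesis by simp
  qed
  let ?L = "\<lambda>K t. \<integral>\<^sup>+s. (\<Sum>k<K. ?W (of_real s * cis (2*pi*t)) * indicator {1 - d k..1 - d k/4} s) \<partial>lborel"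
  define I where "I = (\<integral>\<^sup>+z. ?W z \<partial>lborel)"
  \<comment> \<open>The three constants come from the estimate along rays, the overlap of the radial
    intervals and the polar coordinates.\<close>
  define B where "B = 2 * 8 ^ n * (4 * (40 * I))"
  have Bfin: "B < \<infinity>" using fin
    by (auto simp: B_def I_def ennreal_mult_less_top power_less_top_ennreal)
  have cB: "ennreal (\<Sum>k<K. c k) \<le> B" for K
  proof -
    note [measurable] = borel_measurable_besov_weight[OF F, of n]
    have [measurable]: "cis \<in> borel_measurable borel"
      by (intro borel_measurable_continuous_onI continuous_intros)
    have [measurable]: "(\<lambda>x. ?W (of_real (snd x) * cis (2*pi*fst x))) \<in> borel_measurable (borel \<Otimes>\<^sub>M lborel)"
      by measurable
    have [measurable]: "(\<lambda>s. ?W (of_real s * cis (2*pi*t))) \<in> borel_measurable borel" for t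
      by measurable
    have m: "?J a b \<in> borel_measurable borel" for a b
      by (simp add: case_prod_unfold) measurable
    have "ennreal (\<Sum>k<K. c k) = (\<Sum>k<K. ennreal (c k))" using c0 by simp
    also have "\<dots> \<le> (\<Sum>k<K. 2 * 8 ^ n * (\<integral>\<^sup>+t. ?J (1 - d k) (1 - d k/4) t * indicator {0..1} t \<partial>lborel))"
      by (intro sum_mono Q(2))
    also have "\<dots> = 2 * 8 ^ n * (\<Sum>k<K. (\<integral>\<^sup>+t. ?J (1 - d k) (1 - d k/4) t * indicator {0..1} t \<partial>lborel))"
      by (simp add: sum_distrib_left)
    finally have le1: "ennreal (\<Sum>k<K. c k) \<le> \<dots>" .
    have "(\<Sum>k<K. (\<integral>\<^sup>+t. ?J (1 - d k) (1 - d k/4) t * indicator {0..1} t \<partial>lborel))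
       = (\<integral>\<^sup>+t. (\<Sum>k<K. ?J (1 - d k) (1 - d k/4) t * indicator {0..1} t) \<partial>lborel)"
      by (rule nn_integral_sum[symmetric]) (use m in measurable)
    also have "\<dots> = (\<integral>\<^sup>+t. ?L K t * indicator {0..1} t \<partial>lborel)"
      by (subst nn_integral_sum) (auto simp: sum_distrib_right)
    also have "\<dots> \<le> (\<integral>\<^sup>+t. 4 * (?J (1/2) 1 t * indicator {0..1} t) \<partial>lborel)"
    proof (rule nn_integral_mono)
      fix t :: real
      have "?L K t
         \<le> (\<integral>\<^sup>+s. 4 * (?W (of_real s * cis (2*pi*t)) * indicator {1/2..1} s) \<partial>lborel)"
      proof (rule nn_integral_mono)
        fix s :: real
        have "(\<Sum>k<K. indicator {1 - d k..1 - d k/4} s :: ennreal) \<le> 4 * indicator {1/2..1} s"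
        proof (cases "s \<in> {1/2..1}")
          case False
          then have "s \<notin> {1 - d k..1 - d k/4}" for k using d[of k] by auto
          then show ?thesis by simp
        qed (use ov in auto)
        then show "(\<Sum>k<K. ?W (of_real s * cis (2*pi*t)) * indicator {1 - d k..1 - d k/4} s) \<le> 4 * (?W (of_real s * cis (2*pi*t)) * indicator {1/2..1} s)"
          unfolding sum_distrib_left[symmetric] by (subst mult.left_commute) (rule mult_left_mono, auto)
      qed
      also have "\<dots> = 4 * ?J (1/2) 1 t"
        by (rule nn_integral_cmult) measurable
      finally show "?L K t * indicator {0..1} t
         \<le> 4 * (?J (1/2) 1 t * indicator {0..1} t)"
        unfolding mult.assoc[symmetric] by (rule mult_right_mono) simp
    qed
    also have "\<dots> = 4 * (\<integral>\<^sup>+t. ?J (1/2) 1 t * indicator {0..1} t \<partial>lborel)"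
      by (rule nn_integral_cmult) (use m in measurable)
    also have "\<dots> \<le> 4 * (40 * I)"
      unfolding I_def by (intro mult_left_mono nn_integral_polar_annulus borel_measurable_besov_weight[OF F]) auto
    finally show ?thesis unfolding B_def by (rule order_trans[OF le1 mult_left_mono[OF _ zero_le]])
  qed
  have "(\<Sum>k<K. c k) \<le> enn2real B" for K
    using cB[of K] Bfin by (metis enn2real_leI ennreal_enn2real enn2real_mono c0 enn2real_ennreal sum_nonneg infinity_ennreal_def)
  then have "summable c" by (intro summableI_nonneg_bounded c0)
  then have sc: "summable (\<lambda>k. c k + (1/2) ^ k)" by (intro summable_add) (auto intro: summable_geometric)
  have sums: "(\<lambda>k. h k z) sums (F z - slid_taylor n F (1/2) z)" if z: "z \<in> ball 0 1" for z
  proof -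
    have "(\<lambda>k. slid_taylor n F (1 - d k) z) \<longlonglongrightarrow> (\<Sum>l<n. of_real ((1 - 1) ^ l / fact l) * z ^ l * (deriv ^^ l) F (of_real 1 * z))"
      unfolding slid_taylor_def
    proof (intro tendsto_intros)
      have "(\<lambda>k. 1 - d k) \<longlonglongrightarrow> 1 - 0"
        unfolding d_def by (intro tendsto_intros LIMSEQ_Suc LIMSEQ_realpow_zero) auto
      then show l: "(\<lambda>k. 1 - d k) \<longlonglongrightarrow> 1" by simp
      fix l
      have "isCont ((deriv ^^ l) F) (of_real 1 * z)"
        using holomorphic_on_imp_continuous_on[OF holomorphic_higher_deriv[OF F open_ball, of l]] z
        by (simp add: continuous_on_eq_continuous_at)
      from isCont_tendsto_compose[OF this tendsto_mult[OF tendsto_of_real[OF l] tendsto_const]]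
      show "(\<lambda>k. (deriv ^^ l) F (of_real (1 - d k) * z)) \<longlonglongrightarrow> (deriv ^^ l) F (of_real 1 * z)" .
    qed auto
    \<comment> \<open>Since \<open>0 ^ 0 = 1\<close>, the term \<open>l = 0\<close> is the one that
      survives at \<open>t = 1\<close>.\<close>
    also have "(\<Sum>l<n. of_real ((1 - 1) ^ l / fact l) * z ^ l * (deriv ^^ l) F (of_real 1 * z)) = F z"
    proof -
      obtain m where m: "n = Suc m" using n by (cases n) auto
      show ?thesis unfolding m sum.lessThan_Suc_shift by simp
    qed
    finally have "(\<lambda>k. slid_taylor n F (1 - d k) z) \<longlonglongrightarrow> F z" .
    from telescope_sums[OF this] show ?thesis
      by (simp add: h_def d2 d_def[of 0])
  qed
  have a1: "catomic (\<lambda>z. F z - slid_taylor n F (1/2) z) (suminf (\<lambda>k. c k + (1/2) ^ k))"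
    by (rule catomic_sums[OF at sc sums])
  \<comment> \<open>The starting term of the telescope is holomorphic up to radius 2, so a single
    application on the circle of radius \<open>3/2\<close> represents it.\<close>
  have "slid_taylor n F (1/2) holomorphic_on ball 0 2"
    using slid_taylor_holomorphic[OF F, of "1/2"] by simp
  from catomic_circle_mean[OF this, of "3/2" 1] obtain c' where a2: "catomic (slid_taylor n F (1/2)) c'" by auto
  from atomic_le_cong[OF catomic_add[OF a1 a2], of F] show ?thesis by auto
qed

section \<open>Atoms have finite Besov integral\<close>

lemma ex_dyadic_scale:
  assumes "1 \<le> (x::real)" shows "\<exists>k. 2 ^ k \<le> x \<and> x < 2 ^ Suc k"
proof -
  define n where "n = (LEAST n. x < 2 ^ n)"
  have "\<exists>n. x < 2 ^ n" by (rule real_arch_pow) simp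
  then have n: "x < 2 ^ n" unfolding n_def by (rule LeastI_ex)
  then have "n \<noteq> 0" using assms by (cases n) auto
  then obtain k where k: "n = Suc k" by (cases n) auto
  have "\<not> x < 2 ^ k" using not_less_Least[of k "\<lambda>n. x < 2 ^ n"] k n_def by auto
  then show ?thesis using n k by (intro exI[of _ k]) auto
qed

text \<open>For \<open>a\<close> near the circle, split the disc into dyadic annuli about \<open>1 / cnj a\<close>.\<close>

lemma moebius_kernel_integral_bound:
  assumes a: "norm a < 1"
  shows "(\<integral>\<^sup>+z. ennreal ((1 - (norm a)\<^sup>2) / norm (1 - cnj a * z) ^ 3) * indicator (ball 0 1) z \<partial>lborel) \<le> ennreal (128 * pi)"
    (is "(\<integral>\<^sup>+z. ?k z \<partial>lborel) \<le> _")
proof (cases "norm a \<le> 1/2")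
  case True
  have "?k z \<le> ennreal 8 * indicator (ball 0 1) z" for z
  proof (cases "z \<in> ball 0 1")
    case z: True
    have "norm (cnj a * z) \<le> 1/2 * 1" unfolding norm_mult using True z by (intro mult_mono) auto
    moreover have "1 - norm (cnj a * z) \<le> norm (1 - cnj a * z)" using norm_triangle_ineq2[of 1 "cnj a * z"] by simp
    ultimately have "1/2 \<le> norm (1 - cnj a * z)" by linarith
    then have "(1/2) ^ 3 \<le> norm (1 - cnj a * z) ^ 3" by (intro power_mono) auto
    then have "(1 - (norm a)\<^sup>2) / norm (1 - cnj a * z) ^ 3 \<le> 1 / (1/2) ^ 3" using a by (intro frac_le) (auto simp: power_le_one)
    then show ?thesis by (auto intro!: mult_right_mono ennreal_leI simp: power3_eq_cube simp del: ennreal_numeral)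
  qed simp
  then have "(\<integral>\<^sup>+z. ?k z \<partial>lborel)
    \<le> (\<integral>\<^sup>+z. ennreal 8 * indicator (ball (0::complex) 1) z \<partial>lborel)" by (intro nn_integral_mono) auto
  also have "\<dots> = ennreal 8 * ennreal pi"
    by (simp add: nn_integral_cmult_indicator emeasure_ball unit_ball_vol_2)
  also have "\<dots> \<le> ennreal (128 * pi)" by (subst ennreal_mult[symmetric]) (auto intro!: ennreal_leI)
  finally show ?thesis .
next
  case False
  \<comment> \<open>\<open>p\<close> below is the pole of the kernel; its distance from the disc is
    at least \<open>\<delta>\<close>, so the dyadic scales start there.\<close>
  define \<delta> where "\<delta> = 1 - norm a"
  define p where "p = 1 / cnj a"
  have \<delta>: "\<delta> > 0" "1 - (norm a)\<^sup>2 \<le> 2 * \<delta>"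
    using a zero_le_square[of "norm a - 1"] by (auto simp: \<delta>_def power2_eq_square algebra_simps)
  have a0: "a \<noteq> 0" using False by auto
  \<comment> \<open>For \<open>2^k \<delta> \<le> |z - p| < 2^(k+1) \<delta>\<close>, the bound
    \<open>|a| \<ge> 1/2\<close> gives \<open>|1 - cnj a z| \<ge> 2^k \<delta> / 2\<close>, and with
    \<open>1 - |a|^2 \<le> 2 \<delta>\<close> the kernel is at most this constant. The annulus is
    enlarged to a ball of known volume; the integrals \<open>64 pi / 2^k\<close> add up to
    \<open>128 pi\<close>.\<close>
  define u where "u k z = ennreal (16 * \<delta> / (2 ^ k * \<delta>) ^ 3) * indicator (ball p (2 ^ Suc k * \<delta>)) z" for k z
  have uk: "(\<integral>\<^sup>+z. u k z \<partial>lborel) = ennreal (64 * pi * (1/2) ^ k)" for k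
  proof -
    have "(\<integral>\<^sup>+z. u k z \<partial>lborel) = ennreal (16 * \<delta> / (2 ^ k * \<delta>) ^ 3) * ennreal (pi * (2 ^ Suc k * \<delta>)\<^sup>2)"
      using \<delta> unfolding u_def by (subst nn_integral_cmult_indicator) (auto simp: emeasure_ball unit_ball_vol_2)
    also have "\<dots> = ennreal (16 * \<delta> / (2 ^ k * \<delta>) ^ 3 * (pi * (2 ^ Suc k * \<delta>)\<^sup>2))"
      using \<delta> by (intro ennreal_mult[symmetric]) auto
    also have "16 * \<delta> / (2 ^ k * \<delta>) ^ 3 * (pi * (2 ^ Suc k * \<delta>)\<^sup>2) = 64 * pi * (1/2) ^ k"
      using \<delta> by (simp add: power2_eq_square power3_eq_cube power_divide field_simps)
    finally show ?thesis .
  qed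
  have "?k z \<le> (\<Sum>k. u k z)" for z
  proof (cases "z \<in> ball 0 1")
    case z: True
    have "1 - cnj a * z = cnj a * (p - z)" using a0 by (simp add: p_def field_simps)
    then have n1: "norm (1 - cnj a * z) = norm a * norm (p - z)" by (simp add: norm_mult)
    have "norm p - norm z \<le> norm (p - z)" by (rule norm_triangle_ineq2)
    moreover have "norm p = 1 / norm a" by (simp add: p_def norm_divide)
    moreover have "\<delta> \<le> 1 / norm a - 1"
      using a a0 zero_le_square[of "norm a - 1"] by (simp add: \<delta>_def field_simps)
    ultimately have d: "\<delta> \<le> norm (p - z)" using z by simp
    then have "1 \<le> norm (p - z) / \<delta>" using \<delta> by simp
    then obtain k where "2 ^ k \<le> norm (p - z) / \<delta>" "norm (p - z) / \<delta> < 2 ^ Suc k" using ex_dyadic_scale by blast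
    then have k: "2 ^ k * \<delta> \<le> norm (p - z)" "norm (p - z) < 2 ^ Suc k * \<delta>"
      using \<delta> by (auto simp: field_simps)
    have "2 ^ k * \<delta> / 2 \<le> norm (1 - cnj a * z)"
      unfolding n1 using k False mult_mono[of "1/2" "norm a" "2 ^ k * \<delta>" "norm (p - z)"] \<delta> by simp
    then have "(1 - (norm a)\<^sup>2) / norm (1 - cnj a * z) ^ 3 \<le> (2 * \<delta>) / (2 ^ k * \<delta> / 2) ^ 3"
      using \<delta> by (intro frac_le power_mono) auto
    also have "\<dots> = 16 * \<delta> / (2 ^ k * \<delta>) ^ 3" by (simp add: power_divide)
    finally have "?k z \<le> u k z"
      using z k by (simp add: u_def dist_norm ennreal_leI)
    also have "\<dots> = (\<Sum>k\<in>{k}. u k z)" by simp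
    also have "\<dots> \<le> (\<Sum>k. u k z)" by (rule sum_le_suminf) auto
    finally show ?thesis .
  qed simp
  then have "(\<integral>\<^sup>+z. ?k z \<partial>lborel)
     \<le> (\<integral>\<^sup>+z. (\<Sum>k. u k z) \<partial>lborel)" by (intro nn_integral_mono) auto
  also have "\<dots> = (\<Sum>k. \<integral>\<^sup>+z. u k z \<partial>lborel)"
    unfolding u_def by (intro nn_integral_suminf borel_measurable_times_ennreal borel_measurable_indicator) auto
  also have "\<dots> = (\<Sum>k. ennreal (64 * pi * (1/2) ^ k))" by (simp only: uk)
  also have "(\<Sum>k. ennreal (64 * pi * (1/2) ^ k)) = ennreal (\<Sum>k. 64 * pi * (1/2) ^ k)"
    by (rule suminf_ennreal2) (auto intro!: summable_mult summable_geometric)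
  also have "(\<Sum>k. 64 * pi * (1/2::real) ^ k) = 128 * pi"
    using suminf_mult[OF summable_geometric[of "1/2::real"], of "64 * pi"] suminf_geometric[of "1/2::real"] by simp
  finally show ?thesis .
qed

lemma disc_moebius_derivs:
  assumes a: "norm a < 1" and z: "norm z < 1"
  shows "(disc_moebius a has_field_derivative (a * cnj a - 1) / (1 - cnj a * z) ^ 2) (at z)"
    and "((\<lambda>z. (a * cnj a - 1) / (1 - cnj a * z) ^ 2) has_field_derivative 2 * cnj a * (a * cnj a - 1) / (1 - cnj a * z) ^ 3) (at z)"
proof -
  have n: "1 - cnj a * z \<noteq> 0" using one_minus_cnj_mult_nonzero a z by auto
  show "(disc_moebius a has_field_derivative (a * cnj a - 1) / (1 - cnj a * z) ^ 2) (at z)"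
    unfolding disc_moebius_def[abs_def]
    by (rule derivative_eq_intros refl n)+ (use n in \<open>simp add: power2_eq_square algebra_simps\<close>)
  show "((\<lambda>z. (a * cnj a - 1) / (1 - cnj a * z) ^ 2) has_field_derivative 2 * cnj a * (a * cnj a - 1) / (1 - cnj a * z) ^ 3) (at z)"
    using n by (auto intro!: derivative_eq_intros simp: power2_eq_square power3_eq_cube divide_simps)
qed

text \<open>Partial sums converge uniformly, so their second derivatives converge pointwise on the
  disc. Their integrals are bounded through \<open>moebius_kernel_integral_bound\<close>, and Fatou
  passes the bound to \<open>F\<close>. For \<open>n = 2\<close> the weight factor is 1.\<close>

theorem catomic_imp_finite_besov_weight:
  assumes "catomic F c"
  shows "F holomorphic_on ball 0 1"
    and "(\<integral>\<^sup>+z. ennreal (besov_weight 2 F z) * indicator (ball 0 1) z \<partial>lborel) < \<infinity>"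
proof -
  obtain a \<gamma> where a: "\<And>k. a (Suc k) \<in> ball 0 1" and s: "summable (\<lambda>k. norm (\<gamma> k))"
    and S: "\<And>x. x \<in> ball 0 1 \<Longrightarrow> (\<lambda>k. disc_moebius (a (Suc k)) x * \<gamma> (Suc k)) sums (F x - \<gamma> 0)"
    using assms by (elim atomic_leE) blast
  define b g where "b k = a (Suc k)" and "g k = \<gamma> (Suc k)" for k
  have b: "norm (b k) < 1" for k using a by (simp add: b_def)
  have sg: "summable (\<lambda>k. norm (g k))" using summable_Suc_iff[of "\<lambda>k. norm (\<gamma> k)"] s by (simp add: g_def)
  define P where "P N z = \<gamma> 0 + (\<Sum>k<N. disc_moebius (b k) z * g k)" for N z
  have Phol: "P N holomorphic_on ball 0 1" for N
    unfolding P_def[abs_def] by (intro holomorphic_intros disc_moebius_holomorphic b)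
  have ul: "uniform_limit (ball 0 1) P F sequentially"
  proof -
    have "uniform_limit (ball 0 1) (\<lambda>N z. \<Sum>k<N. disc_moebius (b k) z * g k) (\<lambda>z. suminf (\<lambda>k. disc_moebius (b k) z * g k)) sequentially"
    proof (rule Weierstrass_m_test[OF _ sg])
      fix k and z :: complex assume "z \<in> ball 0 1"
      then have "norm (disc_moebius (b k) z) \<le> 1" using norm_disc_moebius_less[OF b] by (simp add: less_imp_le)
      then show "norm (disc_moebius (b k) z * g k) \<le> norm (g k)"
        using mult_right_mono[of _ 1 "norm (g k)"] by (simp add: norm_mult)
    qed
    then have "uniform_limit (ball 0 1) P (\<lambda>z. \<gamma> 0 + suminf (\<lambda>k. disc_moebius (b k) z * g k)) sequentially"
      unfolding P_def[abs_def] by (intro uniform_limit_add uniform_limit_const)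
    then show ?thesis
      by (rule uniform_limit_cong'[THEN iffD1, rotated 2]) (use S in \<open>auto simp: sums_iff b_def g_def\<close>)
  qed
  show "F holomorphic_on ball 0 1"
  proof (rule holomorphic_uniform_sequence[OF open_ball Phol])
    fix x :: complex assume x: "x \<in> ball 0 1"
    then obtain d where d: "d > 0" "cball x d \<subseteq> ball 0 1" using open_contains_cball by (metis open_ball)
    then show "\<exists>d>0. cball x d \<subseteq> ball 0 1 \<and> uniform_limit (cball x d) P F sequentially"
      using uniform_limit_on_subset[OF ul] by blast
  qed
  \<comment> \<open>This formula agrees with the second derivative of \<open>P N\<close> on the disc
    and is visibly Borel on the whole plane.\<close>
  define P2 where "P2 N z = (\<Sum>k<N. 2 * cnj (b k) * (b k * cnj (b k) - 1) / (1 - cnj (b k) * z) ^ 3 * g k)" for N z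
  have d1: "deriv (P N) z = (\<Sum>k<N. (b k * cnj (b k) - 1) / (1 - cnj (b k) * z) ^ 2 * g k)" if "z \<in> ball 0 1" for N z
    unfolding P_def[abs_def] using that disc_moebius_derivs(1)[OF b]
    by (intro DERIV_imp_deriv) (auto intro!: derivative_eq_intros)
  have d2: "(deriv ^^ 2) (P N) z = P2 N z" if z: "z \<in> ball 0 1" for N z
  proof -
    have "(deriv ^^ 2) (P N) z = deriv (deriv (P N)) z" by (simp add: numeral_2_eq_2)
    also have "\<dots> = deriv (\<lambda>z. \<Sum>k<N. (b k * cnj (b k) - 1) / (1 - cnj (b k) * z) ^ 2 * g k) z"
      by (rule deriv_cong_ev[OF _ refl]) (use d1 z in \<open>auto simp: eventually_nhds intro!: exI[of _ "ball 0 1"]\<close>)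
    also have "\<dots> = P2 N z"
      unfolding P2_def
      by (intro DERIV_imp_deriv DERIV_sum DERIV_cmult_right disc_moebius_derivs(2) b) (use z in auto)
    finally show ?thesis .
  qed
  have lim: "(\<lambda>N. P2 N z) \<longlonglongrightarrow> (deriv ^^ 2) F z" if z: "z \<in> ball 0 1" for z
    using higher_deriv_complex_uniform_limit[OF ul always_eventually[OF allI[OF Phol]] _ open_ball z, of 2] d2[OF z]
    by simp
  define K where "K k z = (1 - (norm (b k))\<^sup>2) / norm (1 - cnj (b k) * z) ^ 3" for k z
  have [measurable]: "K k \<in> borel_measurable borel" for k unfolding K_def[abs_def] by measurable
  have [measurable]: "P2 N \<in> borel_measurable borel" for N unfolding P2_def[abs_def] by measurable
  have P2b: "norm (P2 N z) \<le> (\<Sum>k<N. 2 * norm (g k) * K k z)" for N z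
  proof -
    have "norm (2 * cnj (b k) * (b k * cnj (b k) - 1) / (1 - cnj (b k) * z) ^ 3 * g k) \<le> 2 * norm (g k) * K k z" for k
    proof -
      have e: "b k * cnj (b k) - 1 = of_real ((norm (b k))\<^sup>2 - 1)" using complex_norm_square[of "b k"] by simp
      have "(norm (b k))\<^sup>2 \<le> 1" using b[of k] by (simp add: power_le_one)
      then have n1: "norm (b k * cnj (b k) - 1) = 1 - (norm (b k))\<^sup>2" unfolding e norm_of_real by simp
      have "norm (2 * cnj (b k) * (b k * cnj (b k) - 1) / (1 - cnj (b k) * z) ^ 3 * g k)
         = norm (b k) * (2 * norm (g k) * K k z)"
        by (simp add: norm_mult norm_divide norm_power n1 K_def)
      also have "\<dots> \<le> 1 * (2 * norm (g k) * K k z)"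
        by (rule mult_right_mono) (use b[of k] \<open>(norm (b k))\<^sup>2 \<le> 1\<close> in \<open>auto simp: K_def\<close>)
      finally show ?thesis by simp
    qed
    then show ?thesis unfolding P2_def by (intro order_trans[OF norm_sum] sum_mono)
  qed
  have K0: "0 \<le> K k z" for k z using b[of k] by (simp add: K_def power_le_one)
  define C where "C = (\<Sum>k. 2 * norm (g k) * (128 * pi))"
  have IP2: "(\<integral>\<^sup>+z. ennreal (norm (P2 N z)) * indicator (ball 0 1) z \<partial>lborel) \<le> ennreal C" for N
  proof -
    have "(\<integral>\<^sup>+z. ennreal (norm (P2 N z)) * indicator (ball 0 1) z \<partial>lborel)
       \<le> (\<integral>\<^sup>+z. (\<Sum>k<N. ennreal (2 * norm (g k)) * (ennreal (K k z) * indicator (ball 0 1) z)) \<partial>lborel)"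
    proof (rule nn_integral_mono)
      fix z
      have "ennreal (norm (P2 N z)) \<le> ennreal (\<Sum>k<N. 2 * norm (g k) * K k z)" by (rule ennreal_leI[OF P2b])
      also have "\<dots> = (\<Sum>k<N. ennreal (2 * norm (g k)) * ennreal (K k z))"
        using K0 by (subst sum_ennreal[symmetric]) (auto simp: ennreal_mult)
      finally show "ennreal (norm (P2 N z)) * indicator (ball 0 1) z \<le> (\<Sum>k<N. ennreal (2 * norm (g k)) * (ennreal (K k z) * indicator (ball 0 1) z))"
        by (auto simp: indicator_def)
    qed
    also have "\<dots> = (\<Sum>k<N. ennreal (2 * norm (g k)) * (\<integral>\<^sup>+z. ennreal (K k z) * indicator (ball 0 1) z \<partial>lborel))"
      by (subst nn_integral_sum)
        (auto intro!: sum.cong nn_integral_cmult borel_measurable_times_ennreal borel_measurable_indicator)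
    also have "\<dots> \<le> (\<Sum>k<N. ennreal (2 * norm (g k)) * ennreal (128 * pi))"
      unfolding K_def by (intro sum_mono mult_left_mono moebius_kernel_integral_bound b) auto
    also have "\<dots> = ennreal (\<Sum>k<N. 2 * norm (g k) * (128 * pi))"
      by (simp add: ennreal_mult[symmetric])
    also have "\<dots> \<le> ennreal C"
      unfolding C_def by (intro ennreal_leI sum_le_suminf summable_mult2 summable_mult sg) auto
    finally show ?thesis .
  qed
  have "(\<integral>\<^sup>+z. ennreal (besov_weight 2 F z) * indicator (ball 0 1) z \<partial>lborel)
     = (\<integral>\<^sup>+z. liminf (\<lambda>N. ennreal (norm (P2 N z)) * indicator (ball 0 1) z) \<partial>lborel)"
  proof (rule nn_integral_cong)
    fix z
    show "ennreal (besov_weight 2 F z) * indicator (ball 0 1) z = liminf (\<lambda>N. ennreal (norm (P2 N z)) * indicator (ball 0 1) z)"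
    proof (cases "z \<in> ball 0 1")
      case True
      have "(\<lambda>N. ennreal (norm (P2 N z))) \<longlonglongrightarrow> ennreal (norm ((deriv ^^ 2) F z))"
        by (intro tendsto_intros lim True)
      then have "liminf (\<lambda>N. ennreal (norm (P2 N z))) = ennreal (norm ((deriv ^^ 2) F z))"
        by (intro lim_imp_Liminf) auto
      then show ?thesis using True by (simp add: besov_weight_def)
    qed (simp add: Liminf_const)
  qed
  also have "\<dots> \<le> liminf (\<lambda>N. \<integral>\<^sup>+z. ennreal (norm (P2 N z)) * indicator (ball 0 1) z \<partial>lborel)"
    by (intro nn_integral_liminf borel_measurable_times_ennreal borel_measurable_indicator) auto
  also have "\<dots> \<le> liminf (\<lambda>N. ennreal C)" by (intro Liminf_mono always_eventually allI IP2)
  also have "\<dots> = ennreal C" by (simp add: Liminf_const)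
  finally show "(\<integral>\<^sup>+z. ennreal (besov_weight 2 F z) * indicator (ball 0 1) z \<partial>lborel) < \<infinity>"
    by (simp add: le_less_trans)
qed

section \<open>Slices of the quaternions\<close>

lemma imag_sphere_iff: "i \<in> imag_sphere \<longleftrightarrow> qRe i = 0 \<and> qIm1 i * qIm1 i + qIm2 i * qIm2 i + qIm3 i * qIm3 i = 1"
  by (auto simp: imag_sphere_def quat_norm_eq_sqrt power2_eq_square)

lemma norm_imag_sphere: "i \<in> imag_sphere \<Longrightarrow> norm i = 1"
  by (simp add: imag_sphere_def)

lemma imag_sphere_square: "i \<in> imag_sphere \<Longrightarrow> i * i = - 1"
  by (auto simp: imag_sphere_iff quat_eq_iff)

lemma imag_sphere_square_mult: "i \<in> imag_sphere \<Longrightarrow> i * (i * q) = - q"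
  using imag_sphere_square[of i] by (metis mult.assoc mult_minus1)

lemma of_complex_slice_scaleR: "of_complex_slice i w = Re w *\<^sub>R 1 + Im w *\<^sub>R i"
  by (simp add: of_complex_slice_def of_real_def)

lemma of_complex_slice_zero [simp]: "of_complex_slice i 0 = 0"
  and of_complex_slice_one [simp]: "of_complex_slice i 1 = 1"
  and of_complex_slice_of_real [simp]: "of_complex_slice i (of_real r) = of_real r"
  and of_complex_slice_ii [simp]: "of_complex_slice i \<i> = i"
  and of_complex_slice_add: "of_complex_slice i (w + z) = of_complex_slice i w + of_complex_slice i z"
  and of_complex_slice_diff: "of_complex_slice i (w - z) = of_complex_slice i w - of_complex_slice i z"
  and of_complex_slice_minus: "of_complex_slice i (- z) = - of_complex_slice i z"
  by (simp_all add: of_complex_slice_scaleR algebra_simps scaleR_conv_of_real)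

lemma of_complex_slice_mult:
  "i \<in> imag_sphere \<Longrightarrow> of_complex_slice i (w * z) = of_complex_slice i w * of_complex_slice i z"
  by (simp add: of_complex_slice_scaleR algebra_simps imag_sphere_square)

lemma of_complex_slice_power:
  "i \<in> imag_sphere \<Longrightarrow> of_complex_slice i (z ^ n) = of_complex_slice i z ^ n"
  by (induction n) (simp_all add: of_complex_slice_mult)

lemma norm_of_complex_slice:
  assumes "i \<in> imag_sphere" shows "norm (of_complex_slice i w) = norm w"
proof -
  have "(Im w * qIm1 i)\<^sup>2 + (Im w * qIm2 i)\<^sup>2 + (Im w * qIm3 i)\<^sup>2
      = (Im w)\<^sup>2 * (qIm1 i * qIm1 i + qIm2 i * qIm2 i + qIm3 i * qIm3 i)"
    by (simp add: power2_eq_square algebra_simps)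
  then show ?thesis
    using assms by (simp add: imag_sphere_iff of_complex_slice_scaleR quat_norm_eq_sqrt cmod_def add.assoc)
qed

lemma bounded_linear_of_complex_slice: "bounded_linear (of_complex_slice i)"
proof
  show "\<exists>K. \<forall>w. norm (of_complex_slice i w) \<le> norm w * K"
  proof (intro exI allI)
    fix w
    have "norm (of_complex_slice i w) \<le> \<bar>Re w\<bar> + \<bar>Im w\<bar> * norm i"
      unfolding of_complex_slice_scaleR by (rule order_trans[OF norm_triangle_ineq]) simp
    also have "\<dots> \<le> norm w + norm w * norm i"
      by (intro add_mono mult_right_mono abs_Re_le_cmod abs_Im_le_cmod) simp
    finally show "norm (of_complex_slice i w) \<le> norm w * (1 + norm i)" by (simp add: algebra_simps)
  qed
qed (simp_all add: of_complex_slice_scaleR algebra_simps)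

lemma slice_eq_range: "slice i = range (of_complex_slice i)"
  unfolding slice_def of_complex_slice_def by (auto intro: rev_image_eqI[of "Complex _ _"])

lemma slice_ball_eq: "i \<in> imag_sphere \<Longrightarrow> slice_ball i = of_complex_slice i ` ball 0 1"
  using norm_of_complex_slice[of i] by (auto simp: slice_ball_def slice_eq_range)

lemma of_complex_slice_mem_ball [simp]:
  "i \<in> imag_sphere \<Longrightarrow> of_complex_slice i w \<in> ball 0 1 \<longleftrightarrow> w \<in> ball 0 1"
  by (simp add: norm_of_complex_slice)

lemma of_complex_slice_mem: "of_complex_slice i w \<in> slice i"
  by (auto simp: slice_def of_complex_slice_def)

lemma slice_ball_subset: "slice_ball i \<subseteq> ball 0 1"
  by (auto simp: slice_ball_def)

section \<open>Projection onto a slice\<close>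

text \<open>Complex coordinates of the orthogonal projection onto the slice of \<open>i\<close>. The
  map is linear over the slice for left multiplication, which suits left slice regularity and
  coefficients standing on the right.\<close>

definition slice_proj :: "quat \<Rightarrow> quat \<Rightarrow> complex" where
  "slice_proj i q = Complex (qRe q) (inner q i)"

lemma slice_proj_add: "slice_proj i (q + r) = slice_proj i q + slice_proj i r"
  and slice_proj_diff: "slice_proj i (q - r) = slice_proj i q - slice_proj i r"
  and slice_proj_scaleR: "slice_proj i (t *\<^sub>R q) = t *\<^sub>R slice_proj i q"
  by (simp_all add: slice_proj_def complex_eq_iff inner_simps)

lemma slice_proj_of_complex_slice [simp]:
  "i \<in> imag_sphere \<Longrightarrow> slice_proj i (of_complex_slice i w) = w"
proof -
  assume i: "i \<in> imag_sphere"
  then have "inner i i = 1" using norm_imag_sphere[OF i] by (simp add: dot_square_norm)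
  moreover have "inner 1 i = 0" using i by (simp add: inner_quat_def imag_sphere_iff)
  ultimately show ?thesis using i
    by (simp add: slice_proj_def of_complex_slice_scaleR complex_eq_iff inner_simps imag_sphere_iff)
qed

lemma slice_proj_left_mult_unit:
  assumes "i \<in> imag_sphere" shows "slice_proj i (i * q) = \<i> * slice_proj i q"
proof -
  \<comment> \<open>The unit length of \<open>i\<close>, oriented as a rewrite rule that eliminates
    the square of its first imaginary coordinate.\<close>
  have 1: "qIm1 i * (qIm1 i * t) = t - qIm2 i * (qIm2 i * t) - qIm3 i * (qIm3 i * t)" for t
  proof -
    have "(qIm1 i * qIm1 i + qIm2 i * qIm2 i + qIm3 i * qIm3 i) * t = t" using assms by (simp add: imag_sphere_iff)
    then show ?thesis by (simp add: algebra_simps)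
  qed
  show ?thesis using assms
    by (simp add: slice_proj_def complex_eq_iff inner_quat_def imag_sphere_iff) (simp add: algebra_simps 1)
qed

lemma slice_proj_left_mult:
  assumes "i \<in> imag_sphere" shows "slice_proj i (of_complex_slice i w * q) = w * slice_proj i q"
proof -
  have "of_complex_slice i w * q = Re w *\<^sub>R q + Im w *\<^sub>R (i * q)"
    by (simp add: of_complex_slice_scaleR algebra_simps)
  then show ?thesis
    by (simp add: slice_proj_add slice_proj_scaleR slice_proj_left_mult_unit[OF assms] complex_eq_iff)
qed

text \<open>The map \<open>q \<mapsto> - i q i\<close> is the identity on the slice and
  \<open>-1\<close> on its orthogonal complement, so its average with the identity is the
  projection.\<close>

lemma of_complex_slice_proj:
  assumes "i \<in> imag_sphere"
  shows "of_complex_slice i (slice_proj i q) = (1/2) *\<^sub>R (q - i * q * i)"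
proof -
  have 1: "qIm1 i * (qIm1 i * t) = t - qIm2 i * (qIm2 i * t) - qIm3 i * (qIm3 i * t)" for t
  proof -
    have "(qIm1 i * qIm1 i + qIm2 i * qIm2 i + qIm3 i * qIm3 i) * t = t" using assms by (simp add: imag_sphere_iff)
    then show ?thesis by (simp add: algebra_simps)
  qed
  have 2: "2 *\<^sub>R of_complex_slice i (slice_proj i q) = q - i * q * i"
    using assms
    by (simp add: quat_eq_iff of_complex_slice_scaleR slice_proj_def inner_quat_def imag_sphere_iff)
      (simp add: algebra_simps 1)
  show ?thesis unfolding 2[symmetric] by simp
qed

lemma norm_slice_proj_le:
  assumes "i \<in> imag_sphere" shows "norm (slice_proj i q) \<le> norm q"
proof -
  have "norm (slice_proj i q) = norm ((1/2) *\<^sub>R (q - i * q * i))"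
    by (metis assms norm_of_complex_slice of_complex_slice_proj)
  also have "\<dots> \<le> (1/2) * (norm q + norm (i * q * i))" by (simp add: norm_triangle_ineq4)
  finally show ?thesis using norm_imag_sphere[OF assms] by (simp add: norm_mult)
qed

lemma bounded_linear_slice_proj: "i \<in> imag_sphere \<Longrightarrow> bounded_linear (slice_proj i)"
  by (rule bounded_linear_intro[where K = 1]) (simp_all add: slice_proj_add slice_proj_scaleR norm_slice_proj_le)

lemma imag_sphere_anticommute:
  "i \<in> imag_sphere \<Longrightarrow> j \<in> imag_sphere \<Longrightarrow> inner i j = 0 \<Longrightarrow> j * i = - (i * j)"
  by (auto simp: imag_sphere_iff quat_eq_iff inner_quat_def algebra_simps)

text \<open>Right multiplication by \<open>- j\<close>, the inverse of \<open>j\<close>,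
  interchanges the slice and its orthogonal complement, so the coefficient of \<open>j\<close> is
  again a projection.\<close>

lemma slice_decomposition:
  assumes i: "i \<in> imag_sphere" and j: "j \<in> imag_sphere" and ij: "inner i j = 0"
  shows "of_complex_slice i (slice_proj i q) + of_complex_slice i (slice_proj i (q * - j)) * j = q"
proof -
  have "j * i * j = i"
    unfolding imag_sphere_anticommute[OF assms] using imag_sphere_square[OF j] by (simp add: mult.assoc)
  then have 1: "(i * (q * - j) * i) * j = - (i * q * i)" by (simp add: mult.assoc)
  have 2: "(q * - j) * j = q" using imag_sphere_square[OF j] by (simp add: mult.assoc)
  have "(q * - j - i * (q * - j) * i) * j = q + i * q * i" unfolding left_diff_distrib 1 2 by simp
  then have "2 *\<^sub>R (of_complex_slice i (slice_proj i q) + of_complex_slice i (slice_proj i (q * - j)) * j) = 2 *\<^sub>R q"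
    unfolding of_complex_slice_proj[OF i] by (simp add: algebra_simps flip: scaleR_2)
  then show ?thesis by simp
qed

lemma slice_proj_right_mult_orthogonal:
  assumes i: "i \<in> imag_sphere" and j: "j \<in> imag_sphere" and ij: "inner i j = 0"
  shows "slice_proj i (of_complex_slice i w * j) = 0"
proof -
  have "slice_proj i j = 0" using j ij by (simp add: slice_proj_def complex_eq_iff imag_sphere_iff inner_commute)
  then show ?thesis by (simp add: slice_proj_left_mult[OF i])
qed

lemma slice_components:
  assumes i: "i \<in> imag_sphere" and j: "j \<in> imag_sphere" and ij: "inner i j = 0"
    and q: "q = of_complex_slice i w + of_complex_slice i z * j"
  shows "slice_proj i q = w" "slice_proj i (q * - j) = z"
proof -
  show "slice_proj i q = w"
    using i by (simp add: q slice_proj_add slice_proj_right_mult_orthogonal[OF assms(1-3)])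
  have "q * - j = of_complex_slice i z + of_complex_slice i (- w) * j"
    using imag_sphere_square[OF j] by (simp add: q distrib_right mult.assoc of_complex_slice_minus)
  then show "slice_proj i (q * - j) = z"
    using i by (simp add: slice_proj_add slice_proj_right_mult_orthogonal[OF assms(1-3)])
qed

lemma ex_orthogonal_imag_sphere: "\<exists>j\<in>imag_sphere. inner i j = 0"
proof (cases "qIm1 i = 0 \<and> qIm2 i = 0")
  case True
  then show ?thesis by (intro bexI[of _ "Quat 0 1 0 0"]) (auto simp: imag_sphere_iff inner_quat_def)
next
  case False
  define r where "r = sqrt ((qIm1 i)\<^sup>2 + (qIm2 i)\<^sup>2)"
  have r: "r \<noteq> 0" "r * r = qIm1 i * qIm1 i + qIm2 i * qIm2 i"
    using False by (auto simp: r_def sum_power2_eq_zero_iff power2_eq_square)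
  show ?thesis
  proof (intro bexI[of _ "Quat 0 (- qIm2 i / r) (qIm1 i / r) 0"])
    show "Quat 0 (- qIm2 i / r) (qIm1 i / r) 0 \<in> imag_sphere"
      using r False by (auto simp: imag_sphere_iff add_divide_distrib[symmetric])
  qed (simp add: inner_quat_def)
qed

lemma ex_slice: "\<exists>i\<in>imag_sphere. \<exists>z. q = of_complex_slice i z"
proof -
  define v where "v = q - of_real (qRe q)"
  have v0: "qRe v = 0" by (simp add: v_def of_real_def)
  show ?thesis
  proof (cases "v = 0")
    case True
    have "Quat 0 1 0 0 \<in> imag_sphere" by (simp add: imag_sphere_iff)
    moreover have "q = of_complex_slice (Quat 0 1 0 0) (of_real (qRe q))" using True by (simp add: v_def)
    ultimately show ?thesis by blast
  next
    case False
    have "sgn v \<in> imag_sphere" using v0 False by (simp add: imag_sphere_def sgn_div_norm norm_sgn)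
    moreover have "q = of_complex_slice (sgn v) (Complex (qRe q) (norm v))"
      using False by (simp add: of_complex_slice_scaleR sgn_div_norm) (simp add: v_def scaleR_conv_of_real)
    ultimately show ?thesis by blast
  qed
qed

section \<open>Slice regular functions as power series\<close>

text \<open>For the real derivative \<open>D\<close> the slice equation reads
  \<open>D i = i * D 1\<close>, and the condition on \<open>L\<close> turns this into complex
  linearity of \<open>L \<circ> D\<close> on the slice. A general \<open>L\<close> serves both
  components.\<close>

lemma holomorphic_slice_component:
  assumes i: "i \<in> imag_sphere" and f: "f \<in> slice_regular" and L: "bounded_linear L"
    and Li: "\<And>q. L (i * q) = \<i> * L q"
  shows "(\<lambda>z. L (f (of_complex_slice i z))) holomorphic_on ball 0 1"
proof (rule holomorphic_onI)
  fix z :: complex assume z: "z \<in> ball 0 1"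
  let ?e = "of_complex_slice i"
  have ez: "?e z \<in> ball 0 1" using z by (simp add: norm_of_complex_slice[OF i])
  have "f differentiable (at (?e z) within ball 0 1)"
    using f ez unfolding slice_regular_def differentiable_on_def by blast
  then obtain D where D: "(f has_derivative D) (at (?e z))"
    unfolding differentiable_def at_within_open[OF ez open_ball] by blast
  have lin: "linear D" using D by (rule has_derivative_linear)
  have p1: "((\<lambda>s. f (of_real s + i * of_real (Im z))) has_vector_derivative D 1) (at (Re z))"
  proof -
    have "((\<lambda>s. of_real s + i * of_real (Im z)) has_derivative (\<lambda>h. of_real h)) (at (Re z))"
      by (auto intro!: derivative_eq_intros)
    from has_derivative_compose[OF this, of f D] D
    show ?thesis
      by (simp add: of_complex_slice_def has_vector_derivative_def of_real_def linear_scale[OF lin])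
  qed
  have p2: "((\<lambda>t. f (of_real (Re z) + i * of_real t)) has_vector_derivative D i) (at (Im z))"
  proof -
    have "((\<lambda>t. of_real (Re z) + i * of_real t) has_derivative (\<lambda>h. i * of_real h)) (at (Im z))"
      by (auto intro!: derivative_eq_intros)
    from has_derivative_compose[OF this, of f D] D
    show ?thesis
      by (simp add: of_complex_slice_def has_vector_derivative_def of_real_def linear_scale[OF lin])
  qed
  have "vector_derivative (\<lambda>s. f (of_real s + i * of_real (Im z))) (at (Re z))
      + i * vector_derivative (\<lambda>t. f (of_real (Re z) + i * of_real t)) (at (Im z)) = 0"
    using f i ez unfolding slice_regular_def of_complex_slice_def mem_Collect_eq by blast
  then have "D 1 + i * D i = 0"
    unfolding vector_derivative_at[OF p1] vector_derivative_at[OF p2] .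
  then have "i * (D 1 + i * D i) = 0" by simp
  then have Di: "D i = i * D 1" by (simp add: distrib_left imag_sphere_square_mult[OF i] eq_neg_iff_add_eq_0)
  have "((\<lambda>z. L (f (?e z))) has_derivative (\<lambda>h. L (D (?e h)))) (at z)"
    using bounded_linear.has_derivative[OF L has_derivative_compose[OF bounded_linear_imp_has_derivative[OF bounded_linear_of_complex_slice[of i]] D]] .
  also have "(\<lambda>h. L (D (?e h))) = (*) (L (D 1))"
  proof
    fix h
    have "L (D (?e h)) = Re h *\<^sub>R L (D 1) + Im h *\<^sub>R (\<i> * L (D 1))"
      using bounded_linear.linear[OF L]
      by (simp add: of_complex_slice_scaleR linear_add[OF lin] linear_scale[OF lin] Di Li linear_add linear_scale)
    also have "\<dots> = L (D 1) * h" by (simp add: complex_eq_iff)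
    finally show "L (D (?e h)) = L (D 1) * h" .
  qed
  finally have "((\<lambda>z. L (f (?e z))) has_field_derivative L (D 1)) (at z)" by (simp add: has_field_derivative_def)
  then show "(\<lambda>z. L (f (?e z))) field_differentiable at z within ball 0 1"
    using field_differentiable_at_within field_differentiable_def by blast
qed

lemma slice_regular_components:
  assumes i: "i \<in> imag_sphere" and f: "f \<in> slice_regular"
  shows "(\<lambda>z. slice_proj i (f (of_complex_slice i z))) holomorphic_on ball 0 1"
    and "(\<lambda>z. slice_proj i (f (of_complex_slice i z) * - j)) holomorphic_on ball 0 1"
proof -
  show "(\<lambda>z. slice_proj i (f (of_complex_slice i z))) holomorphic_on ball 0 1"
    by (rule holomorphic_slice_component[OF i f bounded_linear_slice_proj[OF i]])
      (rule slice_proj_left_mult_unit[OF i])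
  show "(\<lambda>z. slice_proj i (f (of_complex_slice i z) * - j)) holomorphic_on ball 0 1"
    by (rule holomorphic_slice_component[OF i f bounded_linear_compose[OF bounded_linear_slice_proj[OF i] bounded_linear_mult_left]])
      (simp only: mult.assoc slice_proj_left_mult_unit[OF i])
qed

lemma real_partial_on_slice:
  assumes i: "i \<in> imag_sphere" and G: "G1 holomorphic_on ball 0 1" "G2 holomorphic_on ball 0 1"
    and f: "\<And>z. z \<in> ball 0 1 \<Longrightarrow> f (of_complex_slice i z) = of_complex_slice i (G1 z) + of_complex_slice i (G2 z) * j"
    and z: "z \<in> ball 0 1"
  shows "real_partial f (of_complex_slice i z) = of_complex_slice i (deriv G1 z) + of_complex_slice i (deriv G2 z) * j"
proof -
  let ?e = "of_complex_slice i"
  have D: "((\<lambda>t. ?e (G (z + of_real t))) has_vector_derivative ?e (deriv G z)) (at 0)" if "G holomorphic_on ball 0 1" for G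
  proof -
    have 1: "((\<lambda>t. z + of_real t) has_vector_derivative 1) (at (0::real))"
      by (auto intro!: derivative_eq_intros)
    have 2: "(G has_field_derivative deriv G z) (at (z + of_real 0))"
      using holomorphic_derivI[OF that open_ball z] by simp
    show ?thesis
      using bounded_linear.has_vector_derivative[OF bounded_linear_of_complex_slice field_vector_diff_chain_at[OF 1 2]]
      by (simp add: o_def)
  qed
  have 3: "((\<lambda>t. ?e (G1 (z + of_real t)) + ?e (G2 (z + of_real t)) * j) has_vector_derivative
      (?e (deriv G1 z) + ?e (deriv G2 z) * j)) (at 0)"
    by (rule has_vector_derivative_add[OF D[OF G(1)] has_vector_derivative_mult_left[OF D[OF G(2)]]])
  have "((\<lambda>t. f (?e z + of_real t)) has_vector_derivative (?e (deriv G1 z) + ?e (deriv G2 z) * j)) (at 0)"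
  proof (rule has_vector_derivative_transform_within_open[OF 3])
    have "open ((\<lambda>t. z + of_real t) -` ball 0 1 :: real set)"
      by (intro open_vimage open_ball continuous_intros)
    then show "open {t::real. z + of_real t \<in> ball 0 1}" by (simp add: vimage_def)
    show "0 \<in> {t::real. z + of_real t \<in> ball 0 1}" using z by simp
    fix t :: real assume "t \<in> {t::real. z + of_real t \<in> ball 0 1}"
    then have "f (?e (z + of_real t)) = ?e (G1 (z + of_real t)) + ?e (G2 (z + of_real t)) * j" by (intro f) simp
    then show "?e (G1 (z + of_real t)) + ?e (G2 (z + of_real t)) * j = f (?e z + of_real t)"
      by (simp add: of_complex_slice_add)
  qed
  then show ?thesis unfolding real_partial_def by (rule vector_derivative_at)
qed

lemma real_partial_funpow_on_slice:
  assumes i: "i \<in> imag_sphere" and G: "G1 holomorphic_on ball 0 1" "G2 holomorphic_on ball 0 1"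
    and f: "\<And>z. z \<in> ball 0 1 \<Longrightarrow> f (of_complex_slice i z) = of_complex_slice i (G1 z) + of_complex_slice i (G2 z) * j"
    and z: "z \<in> ball 0 1"
  shows "(real_partial ^^ n) f (of_complex_slice i z)
    = of_complex_slice i ((deriv ^^ n) G1 z) + of_complex_slice i ((deriv ^^ n) G2 z) * j"
  using z
proof (induction n arbitrary: z)
  case (Suc n)
  show ?case
    using real_partial_on_slice[OF i holomorphic_higher_deriv[OF G(1) open_ball, of n] holomorphic_higher_deriv[OF G(2) open_ball, of n], of "(real_partial ^^ n) f" j z] Suc
    by simp
qed (simp add: f)

lemma slice_power_series:
  assumes i: "i \<in> imag_sphere" and G: "G1 holomorphic_on ball 0 1" "G2 holomorphic_on ball 0 1"
    and z: "z \<in> ball 0 1"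
  shows "(\<lambda>n. of_complex_slice i z ^ n * (of_complex_slice i ((deriv ^^ n) G1 0 / fact n) + of_complex_slice i ((deriv ^^ n) G2 0 / fact n) * j))
    sums (of_complex_slice i (G1 z) + of_complex_slice i (G2 z) * j)"
proof -
  let ?e = "of_complex_slice i"
  have S: "(\<lambda>n. ?e z ^ n * ?e ((deriv ^^ n) G 0 / fact n)) sums ?e (G z)" if "G holomorphic_on ball 0 1" for G
    using bounded_linear.sums[OF bounded_linear_of_complex_slice holomorphic_power_series[OF that z]]
    by (simp add: of_complex_slice_mult[OF i, symmetric] of_complex_slice_power[OF i, symmetric] mult.commute)
  show ?thesis
    using sums_add[OF S[OF G(1)] sums_mult2[OF S[OF G(2)], of j]] by (simp add: distrib_left mult.assoc)
qed

text \<open>On each slice this is the Taylor expansion of the two components. The coefficients are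
  derivatives in the real direction at 0 and hence the same for every slice.\<close>

lemma slice_regular_power_series:
  assumes f: "f \<in> slice_regular" and q: "q \<in> ball 0 1"
  shows "(\<lambda>n. q ^ n * ((real_partial ^^ n) f 0 /\<^sub>R fact n)) sums f q"
proof -
  obtain i z where i: "i \<in> imag_sphere" and z: "q = of_complex_slice i z" using ex_slice by blast
  obtain j where j: "j \<in> imag_sphere" "inner i j = 0" using ex_orthogonal_imag_sphere by blast
  have zb: "z \<in> ball 0 1" using q z by (simp add: norm_of_complex_slice[OF i])
  define G1 where "G1 z = slice_proj i (f (of_complex_slice i z))" for z
  define G2 where "G2 z = slice_proj i (f (of_complex_slice i z) * - j)" for z
  have G: "G1 holomorphic_on ball 0 1" "G2 holomorphic_on ball 0 1"
    using slice_regular_components[OF i f] by (auto simp: G1_def[abs_def] G2_def[abs_def])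
  have dec: "f (of_complex_slice i z) = of_complex_slice i (G1 z) + of_complex_slice i (G2 z) * j" for z
    unfolding G1_def G2_def by (rule slice_decomposition[OF i j, symmetric])
  have c: "of_complex_slice i ((deriv ^^ n) G1 0 / fact n) + of_complex_slice i ((deriv ^^ n) G2 0 / fact n) * j
     = (real_partial ^^ n) f 0 /\<^sub>R fact n" for n
  proof -
    have "(real_partial ^^ n) f (of_complex_slice i 0) = of_complex_slice i ((deriv ^^ n) G1 0) + of_complex_slice i ((deriv ^^ n) G2 0) * j"
      by (rule real_partial_funpow_on_slice[OF i G dec]) simp
    moreover have "of_complex_slice i (w / fact n) = of_complex_slice i w /\<^sub>R fact n" for w
    proof -
      have "w / fact n = w /\<^sub>R fact n" by (simp add: scaleR_conv_of_real divide_inverse mult.commute)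
      then show ?thesis using linear_scale[OF bounded_linear.linear[OF bounded_linear_of_complex_slice]] by metis
    qed
    ultimately show ?thesis by (simp add: scaleR_add_right)
  qed
  show ?thesis using slice_power_series[OF i G zb, of j] unfolding c dec[symmetric] z .
qed

section \<open>Power series are slice regular\<close>

text \<open>The recursion yields the sum of \<open>q^k h q^(n-1-k)\<close> over
  \<open>k < n\<close>, the noncommutative form of \<open>n q^(n-1) h\<close>.\<close>

fun qpower_deriv :: "nat \<Rightarrow> quat \<Rightarrow> quat \<Rightarrow> quat" where
  "qpower_deriv 0 q h = 0"
| "qpower_deriv (Suc n) q h = q * qpower_deriv n q h + h * q ^ n"

lemma has_derivative_qpower: "((\<lambda>q. q ^ n) has_derivative qpower_deriv n q) (at q within S)"
proof (induction n)
  case (Suc n)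
  have "((\<lambda>q. q * q ^ n) has_derivative (\<lambda>h. q * qpower_deriv n q h + h * q ^ n)) (at q within S)"
    by (rule has_derivative_mult[OF has_derivative_ident Suc])
  moreover have "qpower_deriv (Suc n) q = (\<lambda>h. q * qpower_deriv n q h + h * q ^ n)" by auto
  ultimately show ?case by simp
qed simp

lemma norm_qpower_deriv_le:
  assumes "norm q \<le> r" shows "norm (qpower_deriv n q h) \<le> real n * r ^ (n - 1) * norm h"
proof (induction n)
  case (Suc n)
  have r: "0 \<le> r" using assms norm_ge_zero order_trans by blast
  have "norm (qpower_deriv (Suc n) q h) \<le> norm q * norm (qpower_deriv n q h) + norm h * norm q ^ n"
    by (simp, rule order_trans[OF norm_triangle_ineq], simp add: norm_mult norm_power)
  also have "\<dots> \<le> r * (real n * r ^ (n - 1) * norm h) + norm h * r ^ n"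
    using Suc assms r by (intro add_mono mult_mono mult_left_mono power_mono) auto
  also have "\<dots> = real (Suc n) * r ^ (Suc n - 1) * norm h" by (cases n) (auto simp: algebra_simps)
  finally show ?case .
qed simp

text \<open>Meant for the direction \<open>i\<close> at a point of its own slice, where it commutes
  with the point; this is the origin of the slice equation.\<close>

lemma qpower_deriv_commute:
  assumes "h * q = q * h" shows "qpower_deriv n q h = h * qpower_deriv n q 1"
proof (induction n)
  case (Suc n)
  have "q * (h * t) = h * (q * t)" for t using assms by (metis mult.assoc)
  then show ?case by (simp add: Suc algebra_simps)
qed simp

text \<open>Termwise differentiation on smaller balls gives a real derivative \<open>D\<close>. On
  the slice of \<open>i\<close> the direction \<open>i\<close> commutes with the point, so
  \<open>D i = i * D 1\<close>, and \<open>D 1 + i * D i = 0\<close> follows.\<close>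

lemma power_series_slice_regular:
  assumes c: "\<And>q. q \<in> ball 0 1 \<Longrightarrow> (\<lambda>n. q ^ n * c n) sums f q" and f0: "\<And>q. q \<notin> ball 0 1 \<Longrightarrow> f q = 0"
  shows "f \<in> slice_regular"
proof -
  have sc: "summable (\<lambda>n. norm (c n) * s ^ n)" if s: "norm s < 1" for s :: real
  proof -
    \<comment> \<open>Convergence at a real point \<open>t\<close> strictly between
      \<open>|s|\<close> and 1 forces absolute convergence at \<open>s\<close>.\<close>
    obtain t where t: "norm s < t" "t < 1" using s dense by blast
    then have "0 < t" using norm_ge_zero[of s] by linarith
    have "summable (\<lambda>n. of_real t ^ n * c n)"
      by (rule sums_summable[OF c]) (use t \<open>0 < t\<close> in auto)
    then have "summable (\<lambda>n. c n * of_real t ^ n)"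
    proof -
      have "of_real u * x = x * of_real u" for u and x :: quat by (simp add: of_real_def)
      then show ?thesis using \<open>summable (\<lambda>n. of_real t ^ n * c n)\<close> by (simp flip: of_real_power)
    qed
    then have "summable (\<lambda>n. norm (c n * of_real s ^ n))"
      by (rule powser_insidea) (use t \<open>0 < t\<close> in auto)
    then have "summable (\<lambda>n. norm (norm (c n) * s ^ n))" by (simp add: norm_mult norm_power power_abs abs_mult)
    then show ?thesis by (rule summable_norm_cancel)
  qed
  define g' where "g' q h = (\<Sum>n. qpower_deriv n q h * c n)" for q h
  have sb: "summable (\<lambda>n. real n * r ^ (n - 1) * norm (c n))" if r: "0 \<le> r" "r < 1" for r
  proof -
    have "summable (\<lambda>n. diffs (\<lambda>n. norm (c n)) n * r ^ n)"
      by (rule termdiff_converges[of r 1]) (use r sc in auto)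
    then have "summable (\<lambda>n. real (Suc n) * r ^ n * norm (c (Suc n)))" by (simp add: diffs_def mult_ac)
    then show ?thesis using summable_Suc_iff[of "\<lambda>n. real n * r ^ (n - 1) * norm (c n)"] by simp
  qed
  have der: "(f has_derivative g' q) (at q)" and sg: "\<And>h. (\<lambda>n. qpower_deriv n q h * c n) sums g' q h" if q: "q \<in> ball 0 1" for q
  proof -
    obtain r where r: "norm q < r" "r < 1" using q dense by auto
    have r0: "0 \<le> r" using r norm_ge_zero[of q] by linarith
    have b: "norm (qpower_deriv n x h * c n) \<le> real n * r ^ (n - 1) * norm (c n) * norm h" if "norm x \<le> r" for n x h
      using mult_right_mono[OF norm_qpower_deriv_le[OF that, of n h] norm_ge_zero[of "c n"]] by (simp add: norm_mult mult_ac)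
    have sn: "summable (\<lambda>n. qpower_deriv n x h * c n)" if "norm x \<le> r" for x h
      by (rule summable_comparison_test'[OF summable_mult2[OF sb[OF r0 r(2)], of "norm h"], of 0]) (rule b[OF that])
    show "(\<lambda>n. qpower_deriv n q h * c n) sums g' q h" for h
      unfolding g'_def by (rule summable_sums[OF sn]) (use r in simp)
    have "\<exists>g. \<forall>x\<in>ball 0 r. (\<lambda>n. x ^ n * c n) sums g x \<and> (g has_derivative g' x) (at x within ball 0 r)"
    proof (rule has_derivative_series[where f' = "\<lambda>n x h. qpower_deriv n x h * c n" and x = q and l = "f q"])
      show "((\<lambda>x. x ^ n * c n) has_derivative (\<lambda>h. qpower_deriv n x h * c n)) (at x within ball 0 r)" for n x
        by (rule has_derivative_mult_left[OF has_derivative_qpower])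
      show "(\<lambda>n. q ^ n * c n) sums f q" by (rule c[OF q])
      fix e :: real assume e: "e > 0"
      obtain N where N: "\<And>n. n \<ge> N \<Longrightarrow> norm (\<Sum>k. real (k + n) * r ^ (k + n - 1) * norm (c (k + n))) < e"
        using suminf_exist_split[OF e sb[OF r0 r(2)]] by auto
      show "\<forall>\<^sub>F n in sequentially. \<forall>x\<in>ball 0 r. \<forall>h. norm ((\<Sum>k<n. qpower_deriv k x h * c k) - g' x h) \<le> e * norm h"
        unfolding eventually_sequentially
      proof (intro exI[of _ N] allI impI ballI)
        fix n x h assume n: "n \<ge> N" and x: "x \<in> ball (0::quat) r"
        then have x': "norm x \<le> r" by simp
        have sbn: "summable (\<lambda>k. real (k + n) * r ^ (k + n - 1) * norm (c (k + n)))"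
          using summable_ignore_initial_segment[OF sb[OF r0 r(2)], of n] .
        have "g' x h = (\<Sum>k. qpower_deriv (k + n) x h * c (k + n)) + (\<Sum>k<n. qpower_deriv k x h * c k)"
          unfolding g'_def by (rule suminf_split_initial_segment[OF sn[OF x']])
        then have "norm ((\<Sum>k<n. qpower_deriv k x h * c k) - g' x h) = norm (\<Sum>k. qpower_deriv (k + n) x h * c (k + n))"
          by simp
        also have "\<dots> \<le> (\<Sum>k. real (k + n) * r ^ (k + n - 1) * norm (c (k + n)) * norm h)"
          by (rule norm_suminf_le[OF b[OF x'] summable_mult2[OF sbn]])
        also have "\<dots> = (\<Sum>k. real (k + n) * r ^ (k + n - 1) * norm (c (k + n))) * norm h"
          by (rule suminf_mult2[OF sbn, symmetric])
        also have "\<dots> \<le> e * norm h" using N[OF n] by (intro mult_right_mono) auto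
        finally show "norm ((\<Sum>k<n. qpower_deriv k x h * c k) - g' x h) \<le> e * norm h" .
      qed
    qed (use r in auto)
    then obtain g where g: "\<And>x. x \<in> ball 0 r \<Longrightarrow> (\<lambda>n. x ^ n * c n) sums g x"
      "\<And>x. x \<in> ball 0 r \<Longrightarrow> (g has_derivative g' x) (at x within ball 0 r)" by blast
    have qr: "q \<in> ball 0 r" using r by simp
    have "(g has_derivative g' q) (at q)" using g(2)[OF qr] at_within_open[OF qr open_ball] by simp
    then show "(f has_derivative g' q) (at q)"
    proof (rule has_derivative_transform_within_open[OF _ open_ball qr])
      fix x :: quat assume x: "x \<in> ball 0 r"
      then have "x \<in> ball 0 1" using r by auto
      then show "g x = f x" using sums_unique2[OF g(1)[OF x] c] by simp
    qed
  qed
  have "f differentiable_on ball 0 1"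
    unfolding differentiable_on_def differentiable_def using der has_derivative_at_withinI by blast
  moreover have "vector_derivative (\<lambda>s. f (of_real s + i * of_real y)) (at x)
        + i * vector_derivative (\<lambda>t. f (of_real x + i * of_real t)) (at y) = 0"
    if i: "i \<in> imag_sphere" and q: "of_real x + i * of_real y \<in> ball 0 1" for i x y
  proof -
    let ?q = "of_real x + i * of_real y"
    define D where "D = g' ?q"
    have D: "(f has_derivative D) (at ?q)" using der[OF q] by (simp only: D_def)
    have lin: "linear D" by (rule has_derivative_linear[OF D])
    have "((\<lambda>s. of_real s + i * of_real y) has_derivative (\<lambda>h. of_real h)) (at x)"
      by (auto intro!: derivative_eq_intros)
    from has_derivative_compose[OF this D]
    have p1: "((\<lambda>s. f (of_real s + i * of_real y)) has_vector_derivative D 1) (at x)"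
      by (simp add: has_vector_derivative_def of_real_def linear_scale[OF lin])
    have "((\<lambda>t. of_real x + i * of_real t) has_derivative (\<lambda>h. i * of_real h)) (at y)"
      by (auto intro!: derivative_eq_intros)
    from has_derivative_compose[OF this D]
    have p2: "((\<lambda>t. f (of_real x + i * of_real t)) has_vector_derivative D i) (at y)"
      by (simp add: has_vector_derivative_def of_real_def linear_scale[OF lin])
    have com: "i * ?q = ?q * i" by (simp add: of_real_def algebra_simps)
    have "(\<lambda>n. qpower_deriv n ?q i * c n) sums (i * g' ?q 1)"
      using sums_mult[OF sg[OF q, of 1], of i] unfolding qpower_deriv_commute[OF com] by (simp add: mult.assoc)
    then have "D i = i * D 1" unfolding D_def using sg[OF q, of i] sums_unique2 by blast
    then show ?thesis
      unfolding vector_derivative_at[OF p1] vector_derivative_at[OF p2]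
      by (simp add: imag_sphere_square_mult[OF i])
  qed
  ultimately show ?thesis using f0 unfolding slice_regular_def by blast
qed

section \<open>Slice extension and atoms\<close>

lemma power_series_zero_coeffs:
  fixes d :: "nat \<Rightarrow> real"
  assumes "\<And>t. norm t < 1 \<Longrightarrow> (\<lambda>n. d n * t ^ n) sums 0"
  shows "d = (\<lambda>_. 0)"
proof (rule ccontr)
  assume "d \<noteq> (\<lambda>_. 0)"
  then obtain m where m: "d m \<noteq> 0" by auto
  have "(\<lambda>n. d n * 0 ^ n) sums d 0" by (rule powser_sums_zero)
  then have d0: "d 0 = 0" using assms[of 0] sums_unique2 by fastforce
  then have "m > 0" using m by (cases m) auto
  show False
  proof (rule powser_0_nonzero[where \<xi> = 0 and r = 1 and a = d and f = "\<lambda>_. 0" and m = m])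
    fix s :: real assume "0 < s" and "\<And>z::real. z \<in> cball 0 s - {0} \<Longrightarrow> (0::real) \<noteq> 0"
    from this(2)[of s] this(1) show False by simp
  qed (use assms m \<open>m > 0\<close> in auto)
qed

lemma sr_coeff_eqI:
  assumes c: "\<And>q. q \<in> ball 0 1 \<Longrightarrow> (\<lambda>n. q ^ n * c n) sums f q"
  shows "sr_coeff f = c"
  unfolding sr_coeff_def
proof (rule the_equality)
  show "\<forall>q\<in>ball 0 1. (\<lambda>n. q ^ n * c n) sums f q" using c by blast
  fix c' assume c': "\<forall>q\<in>ball 0 1. (\<lambda>n. q ^ n * c' n) sums f q"
  \<comment> \<open>Pairing with an arbitrary \<open>b\<close> and restricting to real points
    reduces the uniqueness of coefficients to real power series; afterwards \<open>b\<close> is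
    taken to be the difference itself.\<close>
  have z: "(\<lambda>n. (c' n - c n) \<bullet> b) = (\<lambda>_. 0)" for b
  proof (rule power_series_zero_coeffs)
    fix t :: real assume t: "norm t < 1"
    then have "of_real t \<in> ball (0::quat) 1" by simp
    then have "(\<lambda>n. of_real t ^ n * c' n - of_real t ^ n * c n) sums (f (of_real t) - f (of_real t))"
      using c c' by (intro sums_diff) auto
    then have "(\<lambda>n. t ^ n *\<^sub>R (c' n - c n)) sums 0"
      by (simp add: scaleR_conv_of_real right_diff_distrib)
    from bounded_linear.sums[OF bounded_linear_inner_left this, of b]
    show "(\<lambda>n. (c' n - c n) \<bullet> b * t ^ n) sums 0" by (simp add: mult.commute)
  qed
  show "c' = c"
  proof
    fix n
    have "(c' n - c n) \<bullet> (c' n - c n) = 0" using fun_cong[OF z, of n] by simp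
    then show "c' n = c n" by simp
  qed
qed

section \<open>Power series of the atoms\<close>

text \<open>Multiplying the geometric series by \<open>a - q\<close> leaves two terms in each degree
  \<open>n \<ge> 1\<close>: \<open>qcnj a ^ n * a - qcnj a ^ (n - 1)\<close>.\<close>

definition moebius_coeff :: "quat \<Rightarrow> nat \<Rightarrow> quat" where
  "moebius_coeff a n = (case n of 0 \<Rightarrow> a | Suc m \<Rightarrow> qcnj a ^ m * (qcnj a * a - 1))"

text \<open>The slice product reads off coefficients by a definite description, so those of both
  factors have to be identified through uniqueness before the Cauchy product can be
  evaluated.\<close>

lemma slice_moebius_sums:
  assumes a: "norm a < 1" and q: "q \<in> ball 0 1"
  shows "(\<lambda>n. q ^ n * moebius_coeff a n) sums slice_moebius a q"
proof -
  have na: "norm (qcnj a) = norm a" by (simp add: quat_norm_eq_sqrt)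
  define d where "d n = (if n = 0 then a else if n = 1 then - 1 else 0)" for n :: nat
  have 1: "sr_coeff (\<lambda>q. \<Sum>n. q ^ n * qcnj a ^ n) = (\<lambda>n. qcnj a ^ n)"
  proof (rule sr_coeff_eqI)
    fix q :: quat assume q: "q \<in> ball 0 1"
    have "norm q * norm a < 1" using mult_strict_mono'[of "norm q" 1 "norm a" 1] q a by simp
    then have "summable (\<lambda>n. (norm q * norm a) ^ n)" by (intro summable_geometric) (simp add: abs_mult)
    then have "summable (\<lambda>n. norm (q ^ n * qcnj a ^ n))"
      by (simp add: norm_mult norm_power na power_mult_distrib)
    then show "(\<lambda>n. q ^ n * qcnj a ^ n) sums (\<Sum>n. q ^ n * qcnj a ^ n)"
      by (rule summable_sums[OF summable_norm_cancel])
  qed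
  have 2: "sr_coeff (\<lambda>q. a - q) = d"
  proof (rule sr_coeff_eqI)
    fix q :: quat
    have "(\<lambda>n. q ^ n * d n) sums (\<Sum>n<2. q ^ n * d n)"
      by (rule sums_finite) (auto simp: d_def)
    then show "(\<lambda>n. q ^ n * d n) sums (a - q)" by (simp add: d_def numeral_2_eq_2)
  qed
  have 3: "(\<Sum>k\<le>n. qcnj a ^ k * d (n - k)) = moebius_coeff a n" for n
  proof (cases n)
    case (Suc m)
    have "(\<Sum>k\<le>Suc m. qcnj a ^ k * d (Suc m - k)) = (\<Sum>k<m. qcnj a ^ k * d (Suc m - k)) + qcnj a ^ m * d 1 + qcnj a ^ Suc m * d 0"
      by (simp add: lessThan_Suc_atMost[symmetric])
    also have "(\<Sum>k<m. qcnj a ^ k * d (Suc m - k)) = 0" by (rule sum.neutral) (auto simp: d_def)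
    finally show ?thesis using Suc by (simp add: d_def moebius_coeff_def right_diff_distrib power_commutes flip: mult.assoc)
  qed (simp add: d_def moebius_coeff_def)
  have qa: "qcnj a * a = of_real ((norm a)\<^sup>2)"
    by (simp add: quat_eq_iff of_real_def quat_norm_eq_sqrt power2_eq_square)
  have nb: "norm (moebius_coeff a (Suc m)) = norm a ^ m * (1 - (norm a)\<^sup>2)" for m
  proof -
    have "norm (qcnj a * a - 1) = norm (of_real ((norm a)\<^sup>2 - 1) :: quat)" by (simp add: qa)
    also have "\<dots> = 1 - (norm a)\<^sup>2" unfolding norm_of_real using a by (simp add: power_le_one)
    finally show ?thesis by (simp add: moebius_coeff_def norm_mult norm_power na)
  qed
  have "summable (\<lambda>n. q ^ n * moebius_coeff a n)"
  proof -
    have "summable (\<lambda>m. norm (q ^ Suc m * moebius_coeff a (Suc m)))"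
    proof (rule summable_comparison_test'[of "\<lambda>m. norm q ^ m" 0])
      show "summable (\<lambda>m. norm q ^ m)" using q by (intro summable_geometric) simp
      show "norm (norm (q ^ Suc m * moebius_coeff a (Suc m))) \<le> norm q ^ m" for m
      proof -
        have "norm q ^ m * (norm q * (norm a ^ m * (1 - (norm a)\<^sup>2))) \<le> norm q ^ m * (1 * (1 * 1))"
          using a q by (intro mult_left_mono mult_mono) (auto simp: power_le_one)
        then have A: "norm q ^ m * (norm q * (norm a ^ m * (1 - (norm a)\<^sup>2))) \<le> norm q ^ m" by simp
        have "norm (q ^ Suc m * moebius_coeff a (Suc m)) = norm q ^ m * (norm q * (norm a ^ m * (1 - (norm a)\<^sup>2)))"
          by (simp add: norm_mult nb norm_power)
        from A[folded this] show ?thesis unfolding real_norm_def abs_norm_cancel .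
      qed
    qed
    then show ?thesis using summable_Suc_iff summable_norm_cancel by blast
  qed
  then show ?thesis
    using q by (simp add: slice_moebius_def sr_mult_def 1 2 3 summable_sums)
qed

lemma slice_moebius_on_slice:
  assumes i: "i \<in> imag_sphere" and w: "w \<in> ball 0 1" and z: "z \<in> ball 0 1"
  shows "slice_moebius (of_complex_slice i w) (of_complex_slice i z) = of_complex_slice i (disc_moebius w z)"
proof -
  let ?e = "of_complex_slice i"
  have cn: "qcnj (?e w) = ?e (cnj w)" using i
    by (simp add: quat_eq_iff of_complex_slice_scaleR imag_sphere_iff)
  define m where "m n = (case n of 0 \<Rightarrow> w | Suc k \<Rightarrow> cnj w ^ k * (cnj w * w - 1))" for n
  have mc: "moebius_coeff (?e w) n = ?e (m n)" for n
    by (cases n) (simp_all add: moebius_coeff_def m_def cn of_complex_slice_mult[OF i] of_complex_slice_power[OF i] of_complex_slice_diff)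
  have nz: "norm (cnj w * z) < 1" using w z norm_mult_less[of "cnj w" 1 z 1] by simp
  then have "(\<lambda>k. (cnj w * z) ^ k) sums (1 / (1 - cnj w * z))" by (rule geometric_sums)
  from sums_mult[OF this, of "z * (cnj w * w - 1)"]
  have "(\<lambda>k. z ^ Suc k * m (Suc k)) sums (z * (cnj w * w - 1) / (1 - cnj w * z))"
    by (simp add: m_def power_mult_distrib mult_ac)
  then have "(\<lambda>n. z ^ n * m n) sums (z * (cnj w * w - 1) / (1 - cnj w * z) + z ^ 0 * m 0)" by (rule sums_Suc)
  also have "z * (cnj w * w - 1) / (1 - cnj w * z) + z ^ 0 * m 0 = disc_moebius w z"
    using one_minus_cnj_mult_nonzero[of w z] w z by (simp add: m_def disc_moebius_def field_simps)
  finally have "(\<lambda>n. ?e (z ^ n * m n)) sums ?e (disc_moebius w z)"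
    by (rule bounded_linear.sums[OF bounded_linear_of_complex_slice])
  then have "(\<lambda>n. ?e z ^ n * moebius_coeff (?e w) n) sums ?e (disc_moebius w z)"
    by (simp add: mc of_complex_slice_mult[OF i] of_complex_slice_power[OF i])
  then show ?thesis
    using slice_moebius_sums[of "?e w" "?e z"] w z sums_unique2 by (auto simp: norm_of_complex_slice[OF i])
qed

section \<open>The slice extension\<close>

context
  fixes i :: quat assumes i: "i \<in> imag_sphere"
begin

text \<open>The extension at \<open>q\<close> combines two values of \<open>g\<close>, with weights
  and points depending on \<open>q\<close> alone; so it is right linear and commutes with pointwise
  series. For real \<open>q\<close> the unit is \<open>sgn 0 = 0\<close> and both weights are
  \<open>1/2\<close>.\<close>

definition ext_unit :: "quat \<Rightarrow> quat" where "ext_unit q = sgn (q - of_real (qRe q))"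

definition ext_point :: "quat \<Rightarrow> complex" where "ext_point q = Complex (qRe q) (norm (q - of_real (qRe q)))"

definition ext_coeff1 :: "quat \<Rightarrow> quat" where "ext_coeff1 q = (1/2) *\<^sub>R (1 + ext_unit q * i)"

definition ext_coeff2 :: "quat \<Rightarrow> quat" where "ext_coeff2 q = (1/2) *\<^sub>R (1 - ext_unit q * i)"

lemma slice_extend_eq:
  assumes "q \<in> ball 0 1"
  shows "slice_extend i g q = ext_coeff1 q * g (of_complex_slice i (cnj (ext_point q)))
      + ext_coeff2 q * g (of_complex_slice i (ext_point q))"
proof -
  have "of_complex_slice i (cnj (ext_point q)) = of_real (qRe q) - of_real (norm (q - of_real (qRe q))) * i"
    "of_complex_slice i (ext_point q) = of_real (qRe q) + of_real (norm (q - of_real (qRe q))) * i"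
    by (simp_all add: of_complex_slice_scaleR ext_point_def of_real_def)
  then have "slice_extend i g q = (1/2) *\<^sub>R ((1 + ext_unit q * i) * g (of_complex_slice i (cnj (ext_point q)))
      + (1 - ext_unit q * i) * g (of_complex_slice i (ext_point q)))"
    using assms by (simp add: slice_extend_def Let_def ext_unit_def)
  then show ?thesis
    by (simp only: ext_coeff1_def ext_coeff2_def mult_scaleR_left scaleR_add_right[symmetric])
qed

lemma norm_ext_point: "norm (ext_point q) = norm q"
proof -
  have "(norm (q - of_real (qRe q)))\<^sup>2 = (qIm1 q)\<^sup>2 + (qIm2 q)\<^sup>2 + (qIm3 q)\<^sup>2"
    by (simp add: quat_norm_eq_sqrt of_real_def)
  then show ?thesis by (simp add: ext_point_def cmod_def quat_norm_eq_sqrt[of q] add.assoc)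
qed

lemma ext_point_mem:
  assumes "q \<in> ball 0 1"
  shows "of_complex_slice i (ext_point q) \<in> slice_ball i" "of_complex_slice i (cnj (ext_point q)) \<in> slice_ball i"
  using assms by (auto simp: slice_ball_eq[OF i] norm_ext_point)

lemma ext_coeff_sum: "ext_coeff1 q + ext_coeff2 q = 1"
  by (simp add: ext_coeff1_def ext_coeff2_def flip: scaleR_add_right scaleR_2)

text \<open>With \<open>w\<close> the n-th power of \<open>ext_point q\<close>, \<open>q^n\<close>
  equals \<open>Re w + Im w I\<close> for the unit \<open>I\<close> of \<open>q\<close>, and the two
  weights recover this from \<open>w\<close> and its conjugate placed on the slice of
  \<open>i\<close>. For real \<open>q\<close> one has \<open>Im w = 0\<close>.\<close>

lemma power_ext:
  "q ^ n = ext_coeff1 q * of_complex_slice i (cnj (ext_point q)) ^ n + ext_coeff2 q * of_complex_slice i (ext_point q) ^ n"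
proof -
  define w where "w = ext_point q ^ n"
  have "ext_coeff1 q * of_complex_slice i (cnj w) + ext_coeff2 q * of_complex_slice i w
      = Re w *\<^sub>R 1 + Im w *\<^sub>R ext_unit q"
  proof -
    have ii: "ext_unit q * i * i = - ext_unit q" using imag_sphere_square[OF i] by (simp add: mult.assoc)
    have "2 *\<^sub>R (ext_coeff1 q * of_complex_slice i (cnj w) + ext_coeff2 q * of_complex_slice i w)
      = (1 + ext_unit q * i) * of_complex_slice i (cnj w) + (1 - ext_unit q * i) * of_complex_slice i w"
    proof -
      have "2 *\<^sub>R ext_coeff1 q = 1 + ext_unit q * i" "2 *\<^sub>R ext_coeff2 q = 1 - ext_unit q * i"
        by (simp_all add: ext_coeff1_def ext_coeff2_def)
      then show ?thesis by (simp only: scaleR_add_right mult_scaleR_left[symmetric])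
    qed
    also have "\<dots> = 2 *\<^sub>R (Re w *\<^sub>R 1 + Im w *\<^sub>R ext_unit q)"
      by (simp add: of_complex_slice_scaleR algebra_simps ii flip: mult.assoc) (simp add: quat_eq_iff)
    finally show ?thesis by simp
  qed
  moreover have "q ^ n = Re w *\<^sub>R 1 + Im w *\<^sub>R ext_unit q"
  proof (cases "q - of_real (qRe q) = 0")
    case True
    then have q: "q = of_real (qRe q)" by simp
    have "ext_point q = of_real (qRe q)" using True by (simp add: ext_point_def complex_eq_iff)
    then have "w = of_real (qRe q ^ n)" by (simp add: w_def)
    moreover have "q ^ n = of_real (qRe q ^ n)" by (subst q) simp
    ultimately show ?thesis by (simp add: of_real_def)
  next
    case False
    have I: "ext_unit q \<in> imag_sphere" using False
      by (simp add: imag_sphere_def ext_unit_def sgn_div_norm norm_sgn of_real_def)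
    have "q = of_complex_slice (ext_unit q) (ext_point q)"
      using False by (simp add: of_complex_slice_scaleR ext_unit_def ext_point_def sgn_div_norm)
        (simp add: scaleR_conv_of_real)
    then have "q ^ n = of_complex_slice (ext_unit q) w"
      by (metis w_def of_complex_slice_power[OF I])
    then show ?thesis by (simp add: of_complex_slice_scaleR)
  qed
  ultimately show ?thesis by (simp add: w_def of_complex_slice_power[OF i, symmetric])
qed

lemma slice_extend_sums:
  assumes "\<And>z. z \<in> slice_ball i \<Longrightarrow> (\<lambda>k. g k z) sums G z" and q: "q \<in> ball 0 1"
  shows "(\<lambda>k. slice_extend i (g k) q) sums slice_extend i G q"
  unfolding slice_extend_eq[OF q]
  by (intro sums_add sums_mult assms(1) ext_point_mem[OF q])

lemma slice_extend_mult_right: "slice_extend i (\<lambda>z. g z * c) q = slice_extend i g q * c"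
  by (cases "q \<in> ball 0 1") (simp_all only: slice_extend_eq, simp_all add: slice_extend_def distrib_right mult.assoc)

lemma slice_extend_add: "slice_extend i (\<lambda>z. g z + h z) q = slice_extend i g q + slice_extend i h q"
  by (cases "q \<in> ball 0 1") (simp_all only: slice_extend_eq, simp_all add: slice_extend_def algebra_simps)

lemma slice_extend_cong:
  "(\<And>z. z \<in> slice_ball i \<Longrightarrow> g z = h z) \<Longrightarrow> slice_extend i g q = slice_extend i h q"
  by (cases "q \<in> ball 0 1") (simp_all only: slice_extend_eq ext_point_mem, simp add: slice_extend_def)

lemma slice_extend_power:
  assumes q: "q \<in> ball 0 1" shows "slice_extend i (\<lambda>z. z ^ n) q = q ^ n"
  unfolding slice_extend_eq[OF q] power_ext[symmetric] ..

lemma power_series_of_slice_extend: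
  assumes G: "\<And>z. z \<in> slice_ball i \<Longrightarrow> (\<lambda>n. z ^ n * c n) sums G z" and q: "q \<in> ball 0 1"
  shows "(\<lambda>n. q ^ n * c n) sums slice_extend i G q"
  using slice_extend_sums[where g = "\<lambda>n z. z ^ n * c n" and G = G, OF G q]
  by (simp add: slice_extend_mult_right slice_extend_power[OF q])

lemma slice_extend_power_series:
  assumes G: "\<And>q. q \<in> ball 0 1 \<Longrightarrow> (\<lambda>n. q ^ n * c n) sums G q" and q: "q \<in> ball 0 1"
  shows "slice_extend i G q = G q"
  using power_series_of_slice_extend[of c G, OF G q] G[OF q] slice_ball_subset sums_unique2 by blast

lemma slice_extend_moebius:
  assumes a: "a \<in> slice_ball i" and q: "q \<in> ball 0 1"
  shows "slice_extend i (slice_moebius a) q = slice_moebius a q"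
  by (rule slice_extend_power_series[OF slice_moebius_sums q]) (use a in \<open>auto simp: slice_ball_def\<close>)

text \<open>The formula uses \<open>|Im w|\<close> and the unit \<open>i\<close> or
  \<open>- i\<close> according to the sign of \<open>Im w\<close>, so one weight is 1 and the other
  0; on the real axis the two points coincide.\<close>

lemma slice_extend_on_slice:
  assumes z: "z \<in> slice_ball i" shows "slice_extend i g z = g z"
proof -
  obtain w where w: "w \<in> ball 0 1" "z = of_complex_slice i w" using z slice_ball_eq[OF i] by auto
  have zb: "z \<in> ball 0 1" using z slice_ball_subset by blast
  have r: "qRe z = Re w" using i w by (simp add: of_complex_slice_scaleR imag_sphere_iff)
  have v: "z - of_real (Re w) = Im w *\<^sub>R i" by (simp add: w of_complex_slice_scaleR of_real_def)
  have p: "ext_point z = Complex (Re w) \<bar>Im w\<bar>" by (simp add: ext_point_def v r norm_imag_sphere[OF i])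
  have u: "ext_unit z = sgn (Im w) *\<^sub>R i"
    using norm_imag_sphere[OF i] by (simp add: ext_unit_def v r sgn_scaleR sgn_div_norm)
  have ii: "i * i = - 1" by (rule imag_sphere_square[OF i])
  consider "Im w > 0" | "Im w < 0" | "Im w = 0" by linarith
  then show ?thesis
  proof cases
    case 1
    then have "ext_point z = w" "ext_coeff1 z = 0" "ext_coeff2 z = 1"
      by (auto simp: p complex_eq_iff ext_coeff1_def ext_coeff2_def u ii simp flip: scaleR_2)
    then show ?thesis by (simp add: slice_extend_eq[OF zb] w(2)[symmetric])
  next
    case 2
    then have "cnj (ext_point z) = w" "ext_coeff1 z = 1" "ext_coeff2 z = 0"
      by (auto simp: p complex_eq_iff ext_coeff1_def ext_coeff2_def u ii simp flip: scaleR_2)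
    then show ?thesis by (simp add: slice_extend_eq[OF zb] w(2)[symmetric])
  next
    case 3
    then have "ext_point z = w" "cnj (ext_point z) = w" by (auto simp: p complex_eq_iff)
    then show ?thesis
      using ext_coeff_sum[of z] by (simp add: slice_extend_eq[OF zb] w(2)[symmetric] flip: distrib_right)
  qed
qed

section \<open>Transfer of atomic representations between disc, slice and ball\<close>

abbreviation "qatomic X \<equiv> atomic_le slice_moebius (slice_ball i) X"

lemma slice_moebius_slice_ball:
  assumes "a \<in> slice_ball i" "z \<in> slice_ball i" shows "slice_moebius a z \<in> slice_ball i"
  using assms unfolding slice_ball_eq[OF i]
  by (auto simp: slice_moebius_on_slice[OF i] norm_disc_moebius_less)

text \<open>On the slice the atoms have modulus below 1; at a general point the extension combines
  two such values with weights of norm at most 1.\<close>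

lemma norm_slice_moebius_le:
  assumes a: "a \<in> slice_ball i" and q: "q \<in> ball 0 1" shows "norm (slice_moebius a q) \<le> 2"
proof -
  have u: "norm (ext_unit q * i) \<le> 1" using norm_imag_sphere[OF i] by (simp add: norm_mult ext_unit_def norm_sgn)
  have c: "norm (ext_coeff1 q) \<le> 1" "norm (ext_coeff2 q) \<le> 1"
    using norm_triangle_ineq[of 1 "ext_unit q * i"] norm_triangle_ineq4[of 1 "ext_unit q * i"] u
    by (auto simp: ext_coeff1_def ext_coeff2_def)
  have m: "norm (slice_moebius a z) \<le> 1" if "z \<in> slice_ball i" for z
    using slice_moebius_slice_ball[OF a that] by (simp add: slice_ball_def)
  have "norm (slice_moebius a q) \<le> norm (ext_coeff1 q) * norm (slice_moebius a (of_complex_slice i (cnj (ext_point q))))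
     + norm (ext_coeff2 q) * norm (slice_moebius a (of_complex_slice i (ext_point q)))"
    unfolding slice_extend_moebius[OF a q, symmetric] slice_extend_eq[OF q]
    by (rule order_trans[OF norm_triangle_ineq]) (simp add: norm_mult)
  also have "\<dots> \<le> 1 * 1 + 1 * 1" by (intro add_mono mult_mono c m ext_point_mem q) auto
  finally show ?thesis by simp
qed

lemma slice_ball_nonempty: "slice_ball i \<noteq> {}"
  unfolding slice_ball_eq[OF i] by simp

lemma qatomic_bounded: "p \<in> slice_ball i \<Longrightarrow> x \<in> slice_ball i \<Longrightarrow> norm (slice_moebius p x) \<le> 2"
  using norm_slice_moebius_le slice_ball_subset by blast

text \<open>The extension fixes constants and atoms and is right linear, so the same parameters and
  coefficients serve on the ball.\<close>

lemma qatomic_slice_extend: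
  assumes "qatomic (slice_ball i) f c" shows "qatomic (ball 0 1) (slice_extend i f) c"
proof -
  obtain a \<gamma> where a: "\<And>k. a (Suc k) \<in> slice_ball i" and s: "summable (\<lambda>k. norm (\<gamma> k))"
    and c: "(\<Sum>k. norm (\<gamma> k)) \<le> c"
    and S: "\<And>x. x \<in> slice_ball i \<Longrightarrow> (\<lambda>k. slice_moebius (a (Suc k)) x * \<gamma> (Suc k)) sums (f x - \<gamma> 0)"
    using assms by (elim atomic_leE) blast
  show ?thesis
  proof (rule atomic_leI[where a = a and \<gamma> = \<gamma>, OF a s c])
    fix q :: quat assume q: "q \<in> ball 0 1"
    have "slice_extend i (\<lambda>x. f x - \<gamma> 0) q = slice_extend i f q - \<gamma> 0"
      using ext_coeff_sum[of q] by (simp add: slice_extend_eq[OF q] right_diff_distrib algebra_simps flip: distrib_right)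
    then show "(\<lambda>k. slice_moebius (a (Suc k)) q * \<gamma> (Suc k)) sums (slice_extend i f q - \<gamma> 0)"
      using slice_extend_sums[where G = "\<lambda>x. f x - \<gamma> 0" and g = "\<lambda>k x. slice_moebius (a (Suc k)) x * \<gamma> (Suc k)", OF S q]
      by (simp add: slice_extend_mult_right slice_extend_moebius[OF a q])
  qed
qed

lemma qatomic_subset: "qatomic (ball 0 1) f c \<Longrightarrow> qatomic (slice_ball i) f c"
  unfolding atomic_le_def using slice_ball_subset by (meson subsetD)

text \<open>Such a function is therefore determined by its values on the slice of
  \<open>i\<close>.\<close>

lemma qatomic_imp_slice_extend:
  assumes "qatomic (ball 0 1) f c" and q: "q \<in> ball 0 1" shows "slice_extend i f q = f q"
proof -
  obtain a \<gamma> where a: "\<And>k. a (Suc k) \<in> slice_ball i"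
    and S: "\<And>x. x \<in> ball 0 1 \<Longrightarrow> (\<lambda>k. slice_moebius (a (Suc k)) x * \<gamma> (Suc k)) sums (f x - \<gamma> 0)"
    using assms(1) by (elim atomic_leE) blast
  have S': "(\<lambda>k. slice_moebius (a (Suc k)) x * \<gamma> (Suc k)) sums (f x + - \<gamma> 0)" if "x \<in> slice_ball i" for x
    using S[OF subsetD[OF slice_ball_subset that]] by simp
  have "(\<lambda>k. slice_moebius (a (Suc k)) q * \<gamma> (Suc k)) sums (slice_extend i f q + slice_extend i (\<lambda>x. - \<gamma> 0) q)"
    using slice_extend_sums[where G = "\<lambda>x. f x + - \<gamma> 0" and g = "\<lambda>k x. slice_moebius (a (Suc k)) x * \<gamma> (Suc k)", OF S' q]
    by (simp only: slice_extend_add slice_extend_mult_right slice_extend_moebius[OF a q])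
  moreover have "slice_extend i (\<lambda>x. - \<gamma> 0) q = - \<gamma> 0"
    unfolding slice_extend_eq[OF q] distrib_right[symmetric] ext_coeff_sum by simp
  ultimately show ?thesis using S[OF q] sums_unique2 by fastforce
qed

lemma catomic_imp_qatomic:
  assumes "catomic F c" shows "qatomic (slice_ball i) (\<lambda>q. of_complex_slice i (F (slice_proj i q))) c"
proof -
  let ?e = "of_complex_slice i"
  obtain a \<gamma> where a: "\<And>k. a (Suc k) \<in> ball 0 1" and s: "summable (\<lambda>k. norm (\<gamma> k))"
    and c: "(\<Sum>k. norm (\<gamma> k)) \<le> c"
    and S: "\<And>x. x \<in> ball 0 1 \<Longrightarrow> (\<lambda>k. disc_moebius (a (Suc k)) x * \<gamma> (Suc k)) sums (F x - \<gamma> 0)"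
    using assms by (elim atomic_leE) blast
  show ?thesis
  proof (rule atomic_leI[where a = "\<lambda>k. ?e (a k)" and \<gamma> = "\<lambda>k. ?e (\<gamma> k)"])
    show "?e (a (Suc k)) \<in> slice_ball i" for k using a unfolding slice_ball_eq[OF i] by blast
    fix x assume "x \<in> slice_ball i"
    then obtain z where z: "z \<in> ball 0 1" "x = ?e z" unfolding slice_ball_eq[OF i] by blast
    show "(\<lambda>k. slice_moebius (?e (a (Suc k))) x * ?e (\<gamma> (Suc k))) sums (?e (F (slice_proj i x)) - ?e (\<gamma> 0))"
      using bounded_linear.sums[OF bounded_linear_of_complex_slice S[OF z(1)], of i] i
      by (simp only: z(2) slice_moebius_on_slice[OF i a z(1)] slice_proj_of_complex_slice of_complex_slice_mult of_complex_slice_diff)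
  qed (use s c in \<open>simp_all add: norm_of_complex_slice[OF i]\<close>)
qed

text \<open>At points of the slice the atoms take values in the slice and stand on the left, so they
  pass through the projection; projecting the coefficients does not increase their norms.\<close>

lemma qatomic_imp_catomic:
  assumes "qatomic (slice_ball i) f c" shows "catomic (\<lambda>z. slice_proj i (f (of_complex_slice i z))) c"
proof -
  let ?e = "of_complex_slice i"
  obtain a \<gamma> where a: "\<And>k. a (Suc k) \<in> slice_ball i" and s: "summable (\<lambda>k. norm (\<gamma> k))"
    and c: "(\<Sum>k. norm (\<gamma> k)) \<le> c"
    and S: "\<And>x. x \<in> slice_ball i \<Longrightarrow> (\<lambda>k. slice_moebius (a (Suc k)) x * \<gamma> (Suc k)) sums (f x - \<gamma> 0)"
    using assms by (elim atomic_leE) blast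
  have b: "slice_proj i (a (Suc k)) \<in> ball 0 1" "?e (slice_proj i (a (Suc k))) = a (Suc k)" for k
    using a[of k] i unfolding slice_ball_eq[OF i] by auto
  have s': "summable (\<lambda>k. norm (slice_proj i (\<gamma> k)))"
    by (rule summable_comparison_test'[OF s, of 0]) (simp add: norm_slice_proj_le[OF i])
  show ?thesis
  proof (rule atomic_leI[where a = "\<lambda>k. slice_proj i (a k)" and \<gamma> = "\<lambda>k. slice_proj i (\<gamma> k)", OF b(1) s'])
    have "(\<Sum>k. norm (slice_proj i (\<gamma> k))) \<le> (\<Sum>k. norm (\<gamma> k))"
      by (rule suminf_le[OF norm_slice_proj_le[OF i] s' s])
    then show "(\<Sum>k. norm (slice_proj i (\<gamma> k))) \<le> c" using c by simp
    fix z :: complex assume z: "z \<in> ball 0 1"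
    then have "?e z \<in> slice_ball i" unfolding slice_ball_eq[OF i] by blast
    from bounded_linear.sums[OF bounded_linear_slice_proj[OF i] S[OF this]]
    have "(\<lambda>k. slice_proj i (slice_moebius (?e (slice_proj i (a (Suc k)))) (?e z) * \<gamma> (Suc k))) sums slice_proj i (f (?e z) - \<gamma> 0)"
      by (simp only: b(2))
    then show "(\<lambda>k. disc_moebius (slice_proj i (a (Suc k))) z * slice_proj i (\<gamma> (Suc k))) sums (slice_proj i (f (?e z)) - slice_proj i (\<gamma> 0))"
      by (simp only: slice_moebius_on_slice[OF i b(1) z] slice_proj_left_mult[OF i] slice_proj_diff)
  qed
qed

text \<open>By \<open>disc_moebius_compose\<close> each atom becomes a unimodular constant times
  another atom; on the slice the constant commutes with the atom and is absorbed into the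
  coefficient from the left.\<close>

lemma qatomic_moebius_compose:
  assumes "qatomic (slice_ball i) f c" and b: "b \<in> slice_ball i"
  shows "qatomic (slice_ball i) (\<lambda>z. f (slice_moebius b z)) c"
proof -
  let ?e = "of_complex_slice i"
  obtain a \<gamma> where a: "\<And>k. a (Suc k) \<in> slice_ball i" and s: "summable (\<lambda>k. norm (\<gamma> k))"
    and c: "(\<Sum>k. norm (\<gamma> k)) \<le> c"
    and S: "\<And>x. x \<in> slice_ball i \<Longrightarrow> (\<lambda>k. slice_moebius (a (Suc k)) x * \<gamma> (Suc k)) sums (f x - \<gamma> 0)"
    using assms(1) by (elim atomic_leE) blast
  obtain w where w: "w \<in> ball 0 1" "b = ?e w" using b unfolding slice_ball_eq[OF i] by blast
  have "\<forall>k. \<exists>v. v \<in> ball 0 1 \<and> a (Suc k) = ?e v" using a unfolding slice_ball_eq[OF i] by blast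
  then obtain v where v: "\<And>k. v k \<in> ball 0 1" "\<And>k. a (Suc k) = ?e (v k)" by metis
  define u where "u k = - ((1 - v k * cnj w) / (1 - cnj (v k) * w))" for k
  have nu: "norm (u k) = 1" for k
    unfolding u_def norm_minus_cancel by (rule norm_moebius_factor) (use v w in auto)
  define a' where "a' k = ?e (disc_moebius w (v (k - 1)))" for k
  define \<gamma>' where "\<gamma>' k = (if k = 0 then \<gamma> 0 else ?e (u (k - 1)) * \<gamma> k)" for k
  have ng: "norm (\<gamma>' k) = norm (\<gamma> k)" for k
    by (simp add: \<gamma>'_def norm_mult norm_of_complex_slice[OF i] nu)
  show ?thesis
  proof (rule atomic_leI[where a = a' and \<gamma> = \<gamma>'])
    have mw: "disc_moebius w (v k) \<in> ball 0 1" for k using norm_disc_moebius_less[of w "v k"] v w by simp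
    then show "a' (Suc k) \<in> slice_ball i" for k unfolding slice_ball_eq[OF i] a'_def by simp
    fix x assume x: "x \<in> slice_ball i"
    then obtain z where z: "z \<in> ball 0 1" "x = ?e z" unfolding slice_ball_eq[OF i] by blast
    have wz: "disc_moebius w z \<in> ball 0 1" using norm_disc_moebius_less[of w z] w z by simp
    have "slice_moebius (a (Suc k)) (slice_moebius b x) * \<gamma> (Suc k) = slice_moebius (a' (Suc k)) x * \<gamma>' (Suc k)" for k
    proof -
      have "disc_moebius (v k) (disc_moebius w z) = disc_moebius (disc_moebius w (v k)) z * u k"
        unfolding u_def using disc_moebius_compose[of "v k" w z] v[of k] w z by (simp add: mult.commute)
      then have "slice_moebius (a (Suc k)) (slice_moebius b x) = slice_moebius (a' (Suc k)) x * ?e (u k)"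
        by (simp add: v(2) w(2) z(2) a'_def slice_moebius_on_slice[OF i w(1) z(1)] slice_moebius_on_slice[OF i v(1) wz]
            slice_moebius_on_slice[OF i mw z(1)] of_complex_slice_mult[OF i])
      then show ?thesis by (simp add: \<gamma>'_def mult.assoc)
    qed
    then show "(\<lambda>k. slice_moebius (a' (Suc k)) x * \<gamma>' (Suc k)) sums (f (slice_moebius b x) - \<gamma>' 0)"
      using S[OF slice_moebius_slice_ball[OF b x]] by (simp add: \<gamma>'_def)
  qed (use s c in \<open>simp_all add: ng\<close>)
qed

lemma slice_moebius_involution:
  assumes "b \<in> slice_ball i" "x \<in> slice_ball i" shows "slice_moebius b (slice_moebius b x) = x"
proof -
  obtain w z where w: "w \<in> ball 0 1" "b = of_complex_slice i w" and z: "z \<in> ball 0 1" "x = of_complex_slice i z"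
    using assms unfolding slice_ball_eq[OF i] by blast
  have wz: "disc_moebius w z \<in> ball 0 1" using norm_disc_moebius_less[of w z] w z by simp
  show ?thesis
    using disc_moebius_involution[of w z] w z
    by (simp add: slice_moebius_on_slice[OF i w(1) z(1)] slice_moebius_on_slice[OF i w(1) wz])
qed

end

section \<open>The Besov space\<close>

lemma slice_ball_borel: "i \<in> imag_sphere \<Longrightarrow> slice_ball i \<in> sets borel"
proof -
  assume i: "i \<in> imag_sphere"
  have "slice_ball i = ball 0 1 \<inter> {q. of_complex_slice i (slice_proj i q) = q}"
  proof -
    have "x \<in> slice i \<longleftrightarrow> of_complex_slice i (slice_proj i x) = x" for x
    proof
      assume "x \<in> slice i"
      then obtain w where "x = of_complex_slice i w" unfolding slice_eq_range by blast
      then show "of_complex_slice i (slice_proj i x) = x" by (simp only: slice_proj_of_complex_slice[OF i])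
    next
      assume "of_complex_slice i (slice_proj i x) = x"
      then show "x \<in> slice i" using of_complex_slice_mem[of i "slice_proj i x"] by (simp only:)
    qed
    then show ?thesis by (auto simp: slice_ball_def)
  qed
  moreover have "closed {q. of_complex_slice i (slice_proj i q) = q}"
    by (intro closed_Collect_eq continuous_intros
        linear_continuous_on[OF bounded_linear_compose[OF bounded_linear_of_complex_slice bounded_linear_slice_proj[OF i]]])
  ultimately show ?thesis by auto
qed

text \<open>The hyperbolic density cancels two powers of \<open>1 - |z|^2\<close>, and
  \<open>of_complex_slice i\<close> is isometric, so the integral can be pulled back to the
  disc.\<close>

lemma besov_integral_eq:
  assumes i: "i \<in> imag_sphere" and G: "G1 holomorphic_on ball 0 1" "G2 holomorphic_on ball 0 1"
    and f: "\<And>z. z \<in> ball 0 1 \<Longrightarrow> f (of_complex_slice i z) = of_complex_slice i (G1 z) + of_complex_slice i (G2 z) * j"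
    and n: "n \<ge> 2"
  shows "(\<integral>\<^sup>+z\<in>slice_ball i. ennreal ((1 - (norm z)\<^sup>2) ^ n * norm ((real_partial ^^ n) f z)) \<partial>slice_hyp_area i)
    = (\<integral>\<^sup>+w. ennreal (1 / pi) * (ennreal ((1 - (norm w)\<^sup>2) ^ (n - 2)
        * norm (of_complex_slice i ((deriv ^^ n) G1 w) + of_complex_slice i ((deriv ^^ n) G2 w) * j)) * indicator (ball 0 1) w) \<partial>lborel)"
proof -
  let ?e = "of_complex_slice i"
  define N where "N w = norm (?e ((deriv ^^ n) G1 w) + ?e ((deriv ^^ n) G2 w) * j)" for w
  define \<phi> where "\<phi> w = indicator (ball 0 1) w *\<^sub>R ((1 - (norm w)\<^sup>2) ^ n * N w)" for w :: complex
  have ce: "continuous_on (ball 0 1) (\<lambda>w. ?e ((deriv ^^ n) G w))" if "G holomorphic_on ball 0 1" for G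
    by (rule bounded_linear.continuous_on[OF bounded_linear_of_complex_slice
          holomorphic_on_imp_continuous_on[OF holomorphic_higher_deriv[OF that open_ball]]])
  have [measurable]: "\<phi> \<in> borel_measurable borel"
    unfolding \<phi>_def[abs_def] N_def
    by (intro borel_measurable_continuous_on_indicator continuous_intros ce G) simp
  have [measurable]: "slice_proj i \<in> borel_measurable borel"
    by (intro borel_measurable_continuous_onI linear_continuous_on bounded_linear_slice_proj i)
  have [measurable]: "?e \<in> borel_measurable borel"
    by (intro borel_measurable_continuous_onI linear_continuous_on bounded_linear_of_complex_slice)
  note [measurable] = slice_ball_borel[OF i]
  \<comment> \<open>\<open>\<Phi>\<close> agrees with the integrand, which vanishes off the slice
    ball, but is written through \<open>slice_proj\<close> and continuous functions on the disc, so
    that it is Borel on all quaternions.\<close>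
  define \<Phi> where "\<Phi> q = ennreal (\<phi> (slice_proj i q)) * indicator (slice_ball i) q" for q
  have [measurable]: "\<Phi> \<in> borel_measurable borel" unfolding \<Phi>_def[abs_def] by measurable
  have [measurable]: "(\<lambda>w. ennreal (1 / pi) * indicator (ball 0 1) w) \<in> borel_measurable (lborel :: complex measure)"
    by (intro borel_measurable_times_ennreal borel_measurable_indicator) simp_all
  have [measurable]: "(\<lambda>w. ennreal (1 / (1 - (norm (?e w))\<^sup>2)\<^sup>2) * \<Phi> (?e w)) \<in> borel_measurable lborel"
    by measurable
  have sA: "sets (slice_area i) = sets borel" by (simp add: slice_area_def)
  have mA: "borel_measurable (slice_area i) = borel_measurable borel" by (rule measurable_cong_sets[OF sA refl])
  have "(\<integral>\<^sup>+z\<in>slice_ball i. ennreal ((1 - (norm z)\<^sup>2) ^ n * norm ((real_partial ^^ n) f z)) \<partial>slice_hyp_area i)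
     = (\<integral>\<^sup>+z. \<Phi> z \<partial>slice_hyp_area i)"
  proof (rule nn_integral_cong)
    fix z
    show "ennreal ((1 - (norm z)\<^sup>2) ^ n * norm ((real_partial ^^ n) f z)) * indicator (slice_ball i) z = \<Phi> z"
    proof (cases "z \<in> slice_ball i")
      case True
      then obtain w where w: "w \<in> ball 0 1" "z = ?e w" unfolding slice_ball_eq[OF i] by blast
      show ?thesis
        using True w(1) real_partial_funpow_on_slice[OF i G f w(1), of n]
        by (simp add: \<Phi>_def \<phi>_def N_def w(2) slice_proj_of_complex_slice[OF i] norm_of_complex_slice[OF i])
    qed (simp add: \<Phi>_def)
  qed
  also have "\<dots> = (\<integral>\<^sup>+z. ennreal (1 / (1 - (norm z)\<^sup>2)\<^sup>2) * \<Phi> z \<partial>slice_area i)"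
    unfolding slice_hyp_area_def by (intro nn_integral_density) (simp_all add: mA)
  also have "\<dots> = (\<integral>\<^sup>+w. ennreal (1 / (1 - (norm (?e w))\<^sup>2)\<^sup>2) * \<Phi> (?e w)
      \<partial>density lborel (\<lambda>w. ennreal (1 / pi) * indicator (ball 0 1) w))"
    unfolding slice_area_def by (rule nn_integral_distr) measurable
  also have "\<dots> = (\<integral>\<^sup>+w. (ennreal (1 / pi) * indicator (ball 0 1) w) * (ennreal (1 / (1 - (norm (?e w))\<^sup>2)\<^sup>2) * \<Phi> (?e w)) \<partial>lborel)"
    by (rule nn_integral_density) measurable
  also have "\<dots> = (\<integral>\<^sup>+w. ennreal (1 / pi) * (ennreal ((1 - (norm w)\<^sup>2) ^ (n - 2) * N w) * indicator (ball 0 1) w) \<partial>lborel)"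
  proof (rule nn_integral_cong)
    fix w :: complex
    show "(ennreal (1 / pi) * indicator (ball 0 1) w) * (ennreal (1 / (1 - (norm (?e w))\<^sup>2)\<^sup>2) * \<Phi> (?e w))
       = ennreal (1 / pi) * (ennreal ((1 - (norm w)\<^sup>2) ^ (n - 2) * N w) * indicator (ball 0 1) w)"
    proof (cases "w \<in> ball 0 1")
      case True
      have "1 - (norm w)\<^sup>2 > 0" using True by (simp add: power_less_one_iff)
      define t where "t = 1 - (norm w)\<^sup>2"
      have t: "t > 0" using \<open>1 - (norm w)\<^sup>2 > 0\<close> by (simp add: t_def)
      have "t ^ n = t\<^sup>2 * t ^ (n - 2)" unfolding power_add[symmetric] le_add_diff_inverse[OF n] ..
      then have "1 / t\<^sup>2 * (t ^ n * N w) = t ^ (n - 2) * N w" using t by simp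
      then have "ennreal (1 / t\<^sup>2) * ennreal (t ^ n * N w) = ennreal (t ^ (n - 2) * N w)"
        using t by (subst ennreal_mult[symmetric]) (auto simp: N_def)
      moreover have "?e w \<in> slice_ball i" using True unfolding slice_ball_eq[OF i] by blast
      ultimately show ?thesis using True
        by (simp add: \<Phi>_def \<phi>_def slice_proj_of_complex_slice[OF i] norm_of_complex_slice[OF i] flip: t_def)
    qed simp
  qed
  finally show ?thesis by (simp add: N_def)
qed

text \<open>Forward uses whichever \<open>n\<close> makes the integral finite, backward produces
  \<open>n = 2\<close>. The bounds \<open>N_lower\<close> and \<open>N_upper\<close> pass between
  \<open>f\<close> and its two holomorphic components.\<close>

lemma besov1_iff:
  assumes i: "i \<in> imag_sphere"
  shows "f \<in> besov1 i \<longleftrightarrow> (\<forall>q. q \<notin> ball 0 1 \<longrightarrow> f q = 0) \<and> (\<exists>c. qatomic i (ball 0 1) f c)"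
proof -
  let ?e = "of_complex_slice i"
  obtain j where j: "j \<in> imag_sphere" "inner i j = 0" using ex_orthogonal_imag_sphere by blast
  define G1 where "G1 z = slice_proj i (f (?e z))" for z
  define G2 where "G2 z = slice_proj i (f (?e z) * - j)" for z
  have dec: "f (?e z) = ?e (G1 z) + ?e (G2 z) * j" for z
    unfolding G1_def G2_def by (rule slice_decomposition[OF i j, symmetric])
  define N where "N n w = norm (?e ((deriv ^^ n) G1 w) + ?e ((deriv ^^ n) G2 w) * j)" for n w
  have N_lower: "norm ((deriv ^^ n) G1 w) \<le> N n w" "norm ((deriv ^^ n) G2 w) \<le> N n w" for n w
  proof -
    define q where "q = ?e ((deriv ^^ n) G1 w) + ?e ((deriv ^^ n) G2 w) * j"
    have "norm (q * - j) = norm q" using norm_imag_sphere[OF j(1)] by (simp add: norm_mult)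
    then show "norm ((deriv ^^ n) G1 w) \<le> N n w" "norm ((deriv ^^ n) G2 w) \<le> N n w"
      using slice_components[OF i j q_def] norm_slice_proj_le[OF i, of q] norm_slice_proj_le[OF i, of "q * - j"]
      by (simp_all add: N_def q_def[symmetric])
  qed
  have N_upper: "N n w \<le> norm ((deriv ^^ n) G1 w) + norm ((deriv ^^ n) G2 w)" for n w
    unfolding N_def
    by (rule order_trans[OF norm_triangle_ineq]) (simp add: norm_mult norm_imag_sphere[OF j(1)] norm_of_complex_slice[OF i])
  have pos: "0 \<le> (1 - (norm w)\<^sup>2) ^ k" if "w \<in> ball 0 1" for w :: complex and k
    using that by (simp add: power_le_one)
  show ?thesis
  proof
    assume f: "f \<in> besov1 i"
    then have sr: "f \<in> slice_regular" by (simp add: besov1_def)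
    then have f0: "\<forall>q. q \<notin> ball 0 1 \<longrightarrow> f q = 0" unfolding slice_regular_def by blast
    obtain n where n: "n > 1" and fin: "(\<integral>\<^sup>+z\<in>slice_ball i. ennreal ((1 - (norm z)\<^sup>2) ^ n * norm ((real_partial ^^ n) f z)) \<partial>slice_hyp_area i) < \<infinity>"
      using f unfolding besov1_def by blast
    have G: "G1 holomorphic_on ball 0 1" "G2 holomorphic_on ball 0 1"
      using slice_regular_components[OF i sr] by (auto simp: G1_def[abs_def] G2_def[abs_def])
    have n2: "n \<ge> 2" using n by simp
    let ?I = "\<integral>\<^sup>+w. ennreal (1 / pi) * (ennreal ((1 - (norm w)\<^sup>2) ^ (n - 2) * N n w) * indicator (ball 0 1) w) \<partial>lborel"
    have I: "?I < \<infinity>" using fin unfolding besov_integral_eq[OF i G dec n2] N_def .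
    have at: "\<exists>c. catomic G c" if G': "G holomorphic_on ball 0 1" and le: "\<And>w. norm ((deriv ^^ n) G w) \<le> N n w" for G
    proof (rule catomic_of_finite_besov_weight[OF G' n2])
      have "(\<integral>\<^sup>+z. ennreal (besov_weight n G z) * indicator (ball 0 1) z \<partial>lborel)
         = (\<integral>\<^sup>+z. ennreal pi * (ennreal (1 / pi) * (ennreal (besov_weight n G z) * indicator (ball 0 1) z)) \<partial>lborel)"
        by (simp add: ennreal_mult[symmetric] flip: mult.assoc)
      also have "\<dots> = ennreal pi * (\<integral>\<^sup>+z. ennreal (1 / pi) * (ennreal (besov_weight n G z) * indicator (ball 0 1) z) \<partial>lborel)"
        using borel_measurable_besov_weight[OF G', of n] by (intro nn_integral_cmult) simp
      also have "\<dots> \<le> ennreal pi * ?I"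
        unfolding besov_weight_def
        by (intro mult_left_mono nn_integral_mono) (auto simp: indicator_def intro!: ennreal_leI mult_left_mono le pos)
      also have "\<dots> < \<infinity>" using I by (simp add: ennreal_mult_less_top)
      finally show "(\<integral>\<^sup>+z. ennreal (besov_weight n G z) * indicator (ball 0 1) z \<partial>lborel) < \<infinity>" .
    qed
    obtain c1 c2 where c: "catomic G1 c1" "catomic G2 c2" using at[OF G(1) N_lower(1)] at[OF G(2) N_lower(2)] by blast
    have "qatomic i (slice_ball i) (\<lambda>q. ?e (G1 (slice_proj i q)) + ?e (G2 (slice_proj i q)) * j) (c1 + c2 * norm j)"
      by (rule atomic_le_add[OF catomic_imp_qatomic[OF i c(1)] atomic_le_mult_right[OF catomic_imp_qatomic[OF i c(2)]]
            slice_ball_nonempty[OF i] qatomic_bounded[OF i]])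
    then have "qatomic i (slice_ball i) f (c1 + c2 * norm j)"
    proof (rule atomic_le_cong)
      fix x assume "x \<in> slice_ball i"
      then obtain w where "w \<in> ball 0 1" "x = ?e w" unfolding slice_ball_eq[OF i] by blast
      then show "?e (G1 (slice_proj i x)) + ?e (G2 (slice_proj i x)) * j = f x"
        by (simp add: dec slice_proj_of_complex_slice[OF i])
    qed
    then have "qatomic i (ball 0 1) (slice_extend i f) (c1 + c2 * norm j)" by (rule qatomic_slice_extend[OF i])
    then have "qatomic i (ball 0 1) f (c1 + c2 * norm j)"
      by (rule atomic_le_cong) (rule slice_extend_power_series[OF i slice_regular_power_series[OF sr]])
    with f0 show "(\<forall>q. q \<notin> ball 0 1 \<longrightarrow> f q = 0) \<and> (\<exists>c. qatomic i (ball 0 1) f c)" by blast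
  next
    assume R: "(\<forall>q. q \<notin> ball 0 1 \<longrightarrow> f q = 0) \<and> (\<exists>c. qatomic i (ball 0 1) f c)"
    then obtain c where at: "qatomic i (ball 0 1) f c" by blast
    have at': "qatomic i (slice_ball i) f c" by (rule qatomic_subset[OF i at])
    have c1: "catomic G1 c" unfolding G1_def[abs_def] by (rule qatomic_imp_catomic[OF i at'])
    have c2: "catomic G2 (c * norm (- j))"
      unfolding G2_def[abs_def] by (rule qatomic_imp_catomic[OF i atomic_le_mult_right[OF at']])
    note G = catomic_imp_finite_besov_weight(1)[OF c1] catomic_imp_finite_besov_weight(1)[OF c2]
    note W = catomic_imp_finite_besov_weight(2)[OF c1] catomic_imp_finite_besov_weight(2)[OF c2]
    define d where "d n = ?e ((deriv ^^ n) G1 0 / fact n) + ?e ((deriv ^^ n) G2 0 / fact n) * j" for n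
    \<comment> \<open>On the slice this is the Taylor series of the components; since
      \<open>f\<close> equals its slice extension, the same series represents it on the
      ball.\<close>
    have ps: "(\<lambda>n. q ^ n * d n) sums f q" if q: "q \<in> ball 0 1" for q
    proof -
      have "(\<lambda>n. z ^ n * d n) sums f z" if "z \<in> slice_ball i" for z
      proof -
        obtain w where w: "w \<in> ball 0 1" "z = ?e w" using \<open>z \<in> slice_ball i\<close> unfolding slice_ball_eq[OF i] by blast
        show ?thesis using slice_power_series[OF i G w(1), of j] unfolding w(2) dec d_def .
      qed
      from power_series_of_slice_extend[OF i this q] show ?thesis by (simp add: qatomic_imp_slice_extend[OF i at q])
    qed
    have sr: "f \<in> slice_regular" by (rule power_series_slice_regular[OF ps]) (use R in auto)
    have "(\<integral>\<^sup>+z\<in>slice_ball i. ennreal ((1 - (norm z)\<^sup>2) ^ 2 * norm ((real_partial ^^ 2) f z)) \<partial>slice_hyp_area i)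
       = (\<integral>\<^sup>+w. ennreal (1 / pi) * (ennreal ((1 - (norm w)\<^sup>2) ^ (2 - 2) * N 2 w) * indicator (ball 0 1) w) \<partial>lborel)"
      unfolding N_def by (rule besov_integral_eq[OF i G dec order_refl])
    also have "\<dots> \<le> (\<integral>\<^sup>+w. ennreal (besov_weight 2 G1 w) * indicator (ball 0 1) w + ennreal (besov_weight 2 G2 w) * indicator (ball 0 1) w \<partial>lborel)"
    proof (rule nn_integral_mono)
      fix w :: complex
      have "ennreal (1 / pi) * ennreal (N 2 w) \<le> 1 * ennreal (norm ((deriv ^^ 2) G1 w) + norm ((deriv ^^ 2) G2 w))"
        using pi_ge_two by (intro mult_mono ennreal_leI N_upper) (auto intro: ennreal_le_1[THEN iffD2])
      also have "\<dots> = ennreal (norm ((deriv ^^ 2) G1 w)) + ennreal (norm ((deriv ^^ 2) G2 w))" by simp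
      finally show "ennreal (1 / pi) * (ennreal ((1 - (norm w)\<^sup>2) ^ (2 - 2) * N 2 w) * indicator (ball 0 1) w)
        \<le> ennreal (besov_weight 2 G1 w) * indicator (ball 0 1) w + ennreal (besov_weight 2 G2 w) * indicator (ball 0 1) w"
        by (auto simp: besov_weight_def indicator_def)
    qed
    also have "\<dots> = (\<integral>\<^sup>+w. ennreal (besov_weight 2 G1 w) * indicator (ball 0 1) w \<partial>lborel)
        + (\<integral>\<^sup>+w. ennreal (besov_weight 2 G2 w) * indicator (ball 0 1) w \<partial>lborel)"
      using borel_measurable_besov_weight[OF G(1), of 2] borel_measurable_besov_weight[OF G(2), of 2] by (intro nn_integral_add) simp_all
    also have "\<dots> < \<infinity>" using W by simp
    finally have "(\<integral>\<^sup>+z\<in>slice_ball i. ennreal ((1 - (norm z)\<^sup>2) ^ 2 * norm ((real_partial ^^ 2) f z)) \<partial>slice_hyp_area i) < \<infinity>" .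
    then show "f \<in> besov1 i" using sr unfolding besov1_def by (auto intro!: exI[of _ 2])
  qed
qed

section \<open>The atomic norm and completeness\<close>

text \<open>The hypothesis makes the competing set nonempty, which gives the infimum its meaning:
  every \<open>d\<close> above it bounds the cost of some representation.\<close>

lemma besov1_norm_bounds:
  assumes "qatomic i (ball 0 1) f c"
  shows besov1_norm_le: "besov1_norm i f \<le> c"
    and besov1_norm_nonneg: "0 \<le> besov1_norm i f"
    and qatomic_of_norm_less: "besov1_norm i f < d \<Longrightarrow> qatomic i (ball 0 1) f d"
proof -
  define S where "S = {(\<Sum>k. norm (\<gamma> k)) | \<gamma> :: nat \<Rightarrow> quat.
       summable (\<lambda>k. norm (\<gamma> k)) \<and>
       (\<exists>a :: nat \<Rightarrow> quat. (\<forall>k\<ge>1. a k \<in> slice_ball i) \<and>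
          (\<forall>q\<in>ball 0 1. (\<lambda>k. slice_moebius (a (Suc k)) q * \<gamma> (Suc k)) sums (f q - \<gamma> 0)))}"
  have N: "besov1_norm i f = Inf S" by (simp add: besov1_norm_def S_def)
  have S0: "0 \<le> s" if "s \<in> S" for s using that by (auto simp: S_def suminf_nonneg)
  have bdd: "bdd_below S" by (rule bdd_belowI[of _ 0]) (rule S0)
  obtain s where s: "s \<in> S" "s \<le> c" using assms unfolding atomic_le_def S_def by blast
  show "besov1_norm i f \<le> c" unfolding N using cInf_lower[OF s(1) bdd] s(2) by simp
  show "0 \<le> besov1_norm i f" unfolding N by (rule cInf_greatest) (use s S0 in auto)
  assume "besov1_norm i f < d"
  then obtain s where "s \<in> S" "s < d" unfolding N using cInf_lessD s(1) by blast
  then show "qatomic i (ball 0 1) f d" unfolding atomic_le_def S_def by (blast intro: less_imp_le)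
qed

context
  fixes i :: quat assumes i: "i \<in> imag_sphere"
begin

lemma besov1_qatomic: "f \<in> besov1 i \<Longrightarrow> besov1_norm i f < d \<Longrightarrow> qatomic i (ball 0 1) f d"
  using besov1_iff[OF i] qatomic_of_norm_less by blast

lemma besov1_outside: "f \<in> besov1 i \<Longrightarrow> q \<notin> ball 0 1 \<Longrightarrow> f q = 0"
  using besov1_iff[OF i] by blast

lemma besov1I: "qatomic i (ball 0 1) f c \<Longrightarrow> (\<And>q. q \<notin> ball 0 1 \<Longrightarrow> f q = 0) \<Longrightarrow> f \<in> besov1 i"
  using besov1_iff[OF i] by blast

lemmas qatomic_add = atomic_le_add[OF _ _ slice_ball_nonempty[OF i] norm_slice_moebius_le[OF i]]

lemma besov1_zero: "(\<lambda>_. 0) \<in> besov1 i" "besov1_norm i (\<lambda>_. 0) = 0"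
proof -
  have z: "qatomic i (ball 0 1) (\<lambda>_. 0) 0"
    using atomic_le_const[OF slice_ball_nonempty[OF i], of slice_moebius "ball 0 1" 0] by simp
  show "(\<lambda>_. 0) \<in> besov1 i" by (rule besov1I[OF z]) simp
  show "besov1_norm i (\<lambda>_. 0) = 0"
    using besov1_norm_le[OF z] besov1_norm_nonneg[OF z] by simp
qed

lemma besov1_norm_ge_0: "f \<in> besov1 i \<Longrightarrow> 0 \<le> besov1_norm i f"
  using besov1_iff[OF i] besov1_norm_nonneg by blast

lemma besov1_add:
  assumes "f \<in> besov1 i" "g \<in> besov1 i"
  shows "(\<lambda>q. f q + g q) \<in> besov1 i" "besov1_norm i (\<lambda>q. f q + g q) \<le> besov1_norm i f + besov1_norm i g"
proof -
  \<comment> \<open>The infimum need not be attained, so representations are taken with a slack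
    \<open>e\<close> that is removed at the end.\<close>
  have at: "qatomic i (ball 0 1) (\<lambda>q. f q + g q) ((besov1_norm i f + e) + (besov1_norm i g + e))" if "e > 0" for e
    using assms that by (intro qatomic_add besov1_qatomic) auto
  show "(\<lambda>q. f q + g q) \<in> besov1 i"
    by (rule besov1I[OF at[of 1]]) (use besov1_outside[OF assms(1)] besov1_outside[OF assms(2)] in simp_all)
  show "besov1_norm i (\<lambda>q. f q + g q) \<le> besov1_norm i f + besov1_norm i g"
  proof (rule field_le_epsilon)
    fix e :: real assume "e > 0"
    then show "besov1_norm i (\<lambda>q. f q + g q) \<le> besov1_norm i f + besov1_norm i g + e"
      using besov1_norm_le[OF at[of "e/2"]] by simp
  qed
qed

lemma besov1_mult:
  assumes "f \<in> besov1 i"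
  shows "(\<lambda>q. f q * c) \<in> besov1 i" "besov1_norm i (\<lambda>q. f q * c) = besov1_norm i f * norm c"
proof -
  have at: "qatomic i (ball 0 1) (\<lambda>q. f q * c) ((besov1_norm i f + e) * norm c)" if "e > 0" "f \<in> besov1 i" for e f c
    using that by (intro atomic_le_mult_right besov1_qatomic) auto
  show mem: "(\<lambda>q. f q * c) \<in> besov1 i" for c
    by (rule besov1I[OF at[of 1]]) (use assms besov1_outside[OF assms] in simp_all)
  have le: "besov1_norm i (\<lambda>q. f q * c) \<le> besov1_norm i f * norm c" if "f \<in> besov1 i" for f c
  proof (cases "c = 0")
    case True then show ?thesis by (simp add: besov1_zero)
  next
    case False
    show ?thesis
    proof (rule field_le_epsilon)
      fix e :: real assume "e > 0"
      then show "besov1_norm i (\<lambda>q. f q * c) \<le> besov1_norm i f * norm c + e"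
        using besov1_norm_le[OF at[of "e / norm c" f c]] that False by (simp add: distrib_right)
    qed
  qed
  show "besov1_norm i (\<lambda>q. f q * c) = besov1_norm i f * norm c"
  proof (cases "c = 0")
    case True then show ?thesis by (simp add: besov1_zero)
  next
    case False
    \<comment> \<open>Applying the inequality to \<open>inverse c\<close> gives the opposite
      estimate.\<close>
    have "besov1_norm i f \<le> besov1_norm i (\<lambda>q. f q * c) * norm (inverse c)"
      using le[OF mem[of c], of "inverse c"] False by (simp add: mult.assoc)
    then have "besov1_norm i f \<le> besov1_norm i (\<lambda>q. f q * c) / norm c"
      using False by (simp only: nonzero_norm_inverse divide_inverse not_False_eq_True)
    then have "besov1_norm i f * norm c \<le> besov1_norm i (\<lambda>q. f q * c)"
      using False by (simp add: pos_le_divide_eq)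
    then show ?thesis using le[OF assms, of c] by simp
  qed
qed

lemma besov1_diff:
  assumes "f \<in> besov1 i" "g \<in> besov1 i"
  shows "(\<lambda>q. f q - g q) \<in> besov1 i"
  using besov1_add(1)[OF assms(1) besov1_mult(1)[OF assms(2), of "- 1"]] by simp

lemma besov1_norm_minus_commute:
  assumes "f \<in> besov1 i" "g \<in> besov1 i"
  shows "besov1_norm i (\<lambda>q. f q - g q) = besov1_norm i (\<lambda>q. g q - f q)"
  using besov1_mult(2)[OF besov1_diff[OF assms], of "- 1"] by simp

lemma besov1_norm_eq_0:
  assumes f: "f \<in> besov1 i" shows "besov1_norm i f = 0 \<longleftrightarrow> f = (\<lambda>_. 0)"
proof
  assume z: "besov1_norm i f = 0"
  show "f = (\<lambda>_. 0)"
  proof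
    fix q show "f q = 0"
    proof (cases "q \<in> ball 0 1")
      case True
      have "norm (f q) \<le> 0 + e" if "e > 0" for e
        using atomic_le_norm_bound[OF besov1_qatomic[OF f, of "e/2"] True norm_slice_moebius_le[OF i _ True]] z that by simp
      then have "norm (f q) \<le> 0" by (rule field_le_epsilon)
      then show ?thesis by simp
    qed (rule besov1_outside[OF f])
  qed
qed (simp add: besov1_zero)

text \<open>A subsequence with increments of cost at most \<open>2^-k\<close> converges pointwise,
  and \<open>atomic_le_sums\<close> merges its tails into representations of small cost; so the
  pointwise limit is also the limit in norm.\<close>

lemma besov1_complete:
  assumes F: "\<And>n. F n \<in> besov1 i"
    and C: "\<And>e. e > 0 \<Longrightarrow> \<exists>M. \<forall>m\<ge>M. \<forall>n\<ge>M. besov1_norm i (\<lambda>q. F m q - F n q) < e"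
  shows "\<exists>f\<in>besov1 i. (\<lambda>n. besov1_norm i (\<lambda>q. F n q - f q)) \<longlonglongrightarrow> 0"
proof -
  have "\<forall>k. \<exists>M. \<forall>m\<ge>M. \<forall>n\<ge>M. besov1_norm i (\<lambda>q. F m q - F n q) < (1/2) ^ k" using C by simp
  then obtain M where M: "\<And>k m n. m \<ge> M k \<Longrightarrow> n \<ge> M k \<Longrightarrow> besov1_norm i (\<lambda>q. F m q - F n q) < (1/2) ^ k" by metis
  \<comment> \<open>Partial sums of \<open>M\<close> give monotone indices with
    \<open>p k \<ge> M k\<close>.\<close>
  define p where "p k = (\<Sum>l\<le>k. M l)" for k
  have p: "M k \<le> p k" "p k \<le> p (Suc k)" for k
    by (auto simp: p_def intro: member_le_sum)
  define G where "G k = F (p k)" for k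
  have G: "G k \<in> besov1 i" for k by (simp add: G_def F)
  have at: "qatomic i (ball 0 1) (\<lambda>q. G (Suc k) q - G k q) ((1/2) ^ k)" for k
    using M[of k "p (Suc k)" "p k"] p[of k] besov1_diff[OF G G]
    by (intro besov1_qatomic) (auto simp: G_def)
  define f where "f q = lim (\<lambda>k. G k q)" for q
  have conv: "(\<lambda>k. G k q) \<longlonglongrightarrow> f q" for q
  proof -
    have "convergent (\<lambda>k. G k q)"
    proof (cases "q \<in> ball 0 1")
      case True
      have "summable (\<lambda>k. G (Suc k) q - G k q)"
      proof (rule summable_comparison_test'[of "\<lambda>k. 2 * (1/2) ^ k" 0])
        show "summable (\<lambda>k. 2 * (1/2::real) ^ k)" by (intro summable_mult summable_geometric) simp
        show "norm (G (Suc k) q - G k q) \<le> 2 * (1/2) ^ k" for k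
          using atomic_le_norm_bound[OF at True norm_slice_moebius_le[OF i _ True]] by simp
      qed
      then have "convergent (\<lambda>n. \<Sum>k<n. G (Suc k) q - G k q)" by (simp add: summable_iff_convergent)
      then have "convergent (\<lambda>n. G n q - G 0 q)" by (simp only: sum_lessThan_telescope[of "\<lambda>k. G k q"])
      then show ?thesis by (simp add: convergent_diff_const_right_iff)
    next
      case False
      then have "G k q = 0" for k by (rule besov1_outside[OF G])
      then show ?thesis by (simp add: convergent_const)
    qed
    then show ?thesis unfolding f_def by (simp add: convergent_LIMSEQ_iff)
  qed
  have f0: "f q = 0" if "q \<notin> ball 0 1" for q
  proof -
    have "G k q = 0" for k using that by (rule besov1_outside[OF G])
    then show ?thesis using conv[of q] by (simp add: LIMSEQ_const_iff)
  qed
  have rest: "qatomic i (ball 0 1) (\<lambda>q. f q - G K q) (2 * (1/2) ^ K)" for K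
  proof -
    have "qatomic i (ball 0 1) (\<lambda>q. f q - G K q) (suminf (\<lambda>m. (1/2) ^ (m + K)))"
    proof (rule atomic_le_sums[where f = "\<lambda>m q. G (Suc (m + K)) q - G (m + K) q", OF at _ _ norm_slice_moebius_le[OF i]])
      show "summable (\<lambda>m. (1/2::real) ^ (m + K))"
        by (intro summable_ignore_initial_segment summable_geometric) simp
      show "(\<lambda>m. G (Suc (m + K)) q - G (m + K) q) sums (f q - G K q)" for q
        using telescope_sums[OF LIMSEQ_ignore_initial_segment[OF conv[of q], of K]] by simp
    qed
    also have "suminf (\<lambda>m. (1/2::real) ^ (m + K)) = 2 * (1/2) ^ K"
      using suminf_mult2[OF summable_geometric[of "1/2::real"], of "(1/2) ^ K"] by (simp add: power_add suminf_geometric)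
    finally show ?thesis .
  qed
  have d: "(\<lambda>q. f q - G K q) \<in> besov1 i" for K
    by (rule besov1I[OF rest]) (simp add: f0 besov1_outside[OF G])
  have f: "f \<in> besov1 i" using besov1_add(1)[OF d[of 0] G[of 0]] by simp
  have "(\<lambda>n. besov1_norm i (\<lambda>q. F n q - f q)) \<longlonglongrightarrow> 0"
  proof (rule LIMSEQ_I)
    fix e :: real assume "e > 0"
    \<comment> \<open>\<open>F n\<close> is within \<open>2^-K\<close> of \<open>G K\<close>, and
      \<open>G K\<close> within \<open>2 * 2^-K\<close> of \<open>f\<close>; hence the threshold
      \<open>e / 3\<close>.\<close>
    then obtain K where K: "(1/2) ^ K < e / 3" using real_arch_pow_inv[of "e/3" "1/2"] by auto
    show "\<exists>n0. \<forall>n\<ge>n0. norm (besov1_norm i (\<lambda>q. F n q - f q) - 0) < e"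
    proof (intro exI[of _ "M K"] allI impI)
      fix n assume n: "n \<ge> M K"
      have "besov1_norm i (\<lambda>q. (F n q - G K q) + (G K q - f q))
         \<le> besov1_norm i (\<lambda>q. F n q - G K q) + besov1_norm i (\<lambda>q. G K q - f q)"
        by (intro besov1_add besov1_diff F G f)
      also have "besov1_norm i (\<lambda>q. G K q - f q) \<le> 2 * (1/2) ^ K"
        using besov1_norm_le[OF rest[of K]] besov1_norm_minus_commute[OF f G] by simp
      also have "besov1_norm i (\<lambda>q. F n q - G K q) < (1/2) ^ K"
        unfolding G_def by (rule M[OF n p(1)])
      finally have "besov1_norm i (\<lambda>q. F n q - f q) < e" using K by simp
      then show "norm (besov1_norm i (\<lambda>q. F n q - f q) - 0) < e"
        using besov1_norm_ge_0[OF besov1_diff[OF F f]] by simp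
    qed
  qed
  with f show ?thesis by blast
qed

section \<open>Composition with Moebius maps\<close>

text \<open>The extension is additive and right linear, so the two components recombine before
  extending; the composition therefore does not depend on \<open>j\<close>.\<close>

lemma slice_comp_eq:
  assumes j: "j \<in> imag_sphere" and ij: "inner i j = 0"
  shows "slice_comp i j f h q = slice_extend i (slice_restrict i f \<circ> slice_restrict i h) q"
proof -
  let ?p = "\<lambda>v. (of_complex_slice i (slice_proj i v), of_complex_slice i (slice_proj i (v * - j)))"
  have sp: "slice_split i j v = ?p v" for v
    unfolding slice_split_def
  proof (rule the_equality)
    show "fst (?p v) \<in> slice i \<and>
      snd (?p v) \<in> slice i \<and>
      v = fst (?p v)
        + snd (?p v) * j"
      by (simp only: fst_conv snd_conv of_complex_slice_mem slice_decomposition[OF i j ij] simp_thms)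
    fix p assume p: "fst p \<in> slice i \<and> snd p \<in> slice i \<and> v = fst p + snd p * j"
    have sl: "\<exists>w. x = of_complex_slice i w" if "x \<in> slice i" for x
    proof -
      from that obtain r s where "x = of_real r + i * of_real s" by (auto simp: slice_def)
      then show ?thesis by (intro exI[of _ "Complex r s"]) (simp add: of_complex_slice_def)
    qed
    from p sl obtain w z where wz: "fst p = of_complex_slice i w" "snd p = of_complex_slice i z" by metis
    then have "v = of_complex_slice i w + of_complex_slice i z * j" using p by simp
    from slice_components[OF i j ij this] wz
    show "p = ?p v"
      by (simp add: prod_eq_iff)
  qed
  have dec: "fst (slice_split i j v) + snd (slice_split i j v) * j = v" for v
    unfolding sp fst_conv snd_conv by (rule slice_decomposition[OF i j ij])
  show ?thesis
    unfolding slice_comp_def Let_def slice_extend_mult_right[OF i, symmetric] slice_extend_add[OF i, symmetric]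
    by (simp add: o_def dec)
qed

text \<open>On the slice this is ordinary composition, which preserves the cost of a representation,
  and the extension carries that representation to the ball.\<close>

lemma slice_comp_moebius:
  assumes j: "j \<in> imag_sphere" and ij: "inner i j = 0" and f: "f \<in> besov1 i" and a: "a \<in> slice_ball i"
  defines "g \<equiv> slice_comp i j f (slice_moebius a)"
  shows "g \<in> besov1 i" and "besov1_norm i g \<le> besov1_norm i f"
    and "z \<in> slice_ball i \<Longrightarrow> g z = f (slice_moebius a z)"
proof -
  have res: "(slice_restrict i f \<circ> slice_restrict i (slice_moebius a)) z = f (slice_moebius a z)" if "z \<in> slice_ball i" for z
    using that slice_moebius_slice_ball[OF i a that] by (simp add: slice_restrict_def)
  have g: "g = slice_extend i (\<lambda>z. f (slice_moebius a z))"
    unfolding g_def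
    by (rule ext) (subst slice_comp_eq[OF j ij], rule slice_extend_cong[OF i res])
  have at: "qatomic i (ball 0 1) g c" if "qatomic i (ball 0 1) f c" for c
    unfolding g by (rule qatomic_slice_extend[OF i qatomic_moebius_compose[OF i qatomic_subset[OF i that] a]])
  have "qatomic i (ball 0 1) g (besov1_norm i f + 1)" by (rule at[OF besov1_qatomic[OF f]]) simp
  then show "g \<in> besov1 i" by (rule besov1I) (simp add: g slice_extend_def)
  show "besov1_norm i g \<le> besov1_norm i f"
  proof (rule field_le_epsilon)
    fix e :: real assume "e > 0"
    then show "besov1_norm i g \<le> besov1_norm i f + e"
      by (intro besov1_norm_le[OF at[OF besov1_qatomic[OF f]]]) simp
  qed
  show "g z = f (slice_moebius a z)" if "z \<in> slice_ball i"
    unfolding g by (rule slice_extend_on_slice[OF i that])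
qed

text \<open>Composing twice gives back \<open>f\<close>: the Moebius map is an involution on the
  slice, and both functions are determined there. The norm inequality applied to both compositions
  then yields equality.\<close>

lemma besov1_norm_slice_comp:
  assumes j: "j \<in> imag_sphere" and ij: "inner i j = 0" and f: "f \<in> besov1 i" and a: "a \<in> slice_ball i"
  shows "besov1_norm i (slice_comp i j f (slice_moebius a)) = besov1_norm i f"
proof -
  define g where "g = slice_comp i j f (slice_moebius a)"
  define h where "h = slice_comp i j g (slice_moebius a)"
  note g = slice_comp_moebius[OF j ij f a, folded g_def]
  note h = slice_comp_moebius[OF j ij g(1) a, folded h_def]
  have "h z = f z" if z: "z \<in> slice_ball i" for z
    using h(3)[OF z] g(3)[OF slice_moebius_slice_ball[OF i a z]] slice_moebius_involution[OF i a z] by simp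
  then have "slice_extend i h q = slice_extend i f q" for q by (rule slice_extend_cong[OF i])
  then have eq: "slice_extend i h = slice_extend i f" ..
  have ex: "slice_extend i f' = f'" if "f' \<in> besov1 i" for f'
  proof
    fix q
    note at = besov1_qatomic[OF that less_add_one]
    show "slice_extend i f' q = f' q"
    proof (cases "q \<in> ball 0 1")
      case False
      then show ?thesis using besov1_outside[OF that False] by (simp add: slice_extend_def)
    qed (rule qatomic_imp_slice_extend[OF i at])
  qed
  have "h = f" using eq unfolding ex[OF h(1)] ex[OF f] .
  then show ?thesis using g(2) h(2) unfolding g_def by simp
qed

end

theorem proposition4p17:
  fixes i :: quat
  assumes "i \<in> imag_sphere"
  shows "right_quat_banach (besov1 i) (besov1_norm i) \<and>
    (\<forall>j\<in>imag_sphere. inner i j = 0 \<longrightarrow>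
      (\<forall>f\<in>besov1 i. \<forall>a\<in>slice_ball i.
        slice_comp i j f (slice_moebius a) \<in> besov1 i \<and>
        besov1_norm i (slice_comp i j f (slice_moebius a)) = besov1_norm i f))"
proof (intro conjI ballI impI)
  show "right_quat_banach (besov1 i) (besov1_norm i)"
    unfolding right_quat_banach_def
  proof (intro conjI ballI allI impI)
    fix F :: "nat \<Rightarrow> quat \<Rightarrow> quat"
    assume "(\<forall>n. F n \<in> besov1 i) \<and> (\<forall>e>0. \<exists>M. \<forall>m\<ge>M. \<forall>n\<ge>M. besov1_norm i (\<lambda>q. F m q - F n q) < e)"
    then show "\<exists>f\<in>besov1 i. (\<lambda>n. besov1_norm i (\<lambda>q. F n q - f q)) \<longlonglongrightarrow> 0"
      by (intro besov1_complete[OF assms]) auto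
  qed (simp_all add: besov1_zero[OF assms] besov1_add[OF assms] besov1_mult[OF assms]
      besov1_norm_ge_0[OF assms] besov1_norm_eq_0[OF assms])
qed (simp_all add: slice_comp_moebius(1)[OF assms] besov1_norm_slice_comp[OF assms])

end
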